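(* Let $n\ge 2$ and let $\varphi:\mathbb{R}^n\to\mathbb{R}^n$ be a homeomorphism such that the mapping $f\mapsto f\circ\varphi$ induced by $\varphi$ is bounded on $\dot{B}^s_{n/s,q}(\mathbb{R}^n)$ for some $0<s<1$ and $1<q<\infty$ with $q\neq n/s$. Then $\varphi$ is bi-Lipschitz.
   Context: For $0<s<1$, $1\le p,q<\infty$ and a measurable function $f$ on $\mathbb{R}^n$, put $$\|f\|_{\dot{B}^s_{p,q}(\mathbb{R}^n)}=\left(\int_{\mathbb{R}^n}|h|^{-qs}\left(\int_{\mathbb{R}^n}|f(x+h)-f(x)|^p\,dx\right)^{q/p}\frac{dh}{|h|^n}\right)^{1/q}\in[0,\infty].$$ The homogeneous Besov space $\dot{B}^s_{p,q}(\mathbb{R}^n)$ consists of the measurable functions (modulo functions that are constant almost everywhere) for which this is finite. "The mapping induced by $\varphi$ is bounded on $\dot{B}^s_{p,q}(\mathbb{R}^n)$" means: there is a constant $C$ such that for every continuous $f$ with $\|f\|_{\dot{B}^s_{p,q}(\mathbb{R}^n)}<\infty$ one has $\|f\circ\varphi\|_{\dot{B}^s_{p,q}(\mathbb{R}^n)}\le C\|f\|_{\dot{B}^s_{p,q}(\mathbb{R}^n)}$ (the mapping is then defined on the rest of the space by completion). A map $\varphi$ is bi-Lipschitz if there is $L\ge 1$ with $L^{-1}|x-y|\le|\varphi(x)-\varphi(y)|\le L|x-y|$ for all $x,y$. *)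

theory Defs
  imports "HOL-Analysis.Analysis"
begin

text \<open>Powers in \<open>[0,\<infinity>]\<close>; meant for exponents \<open>a > 0\<close>, so that \<open>\<infinity>\<close> to the power \<open>a\<close> is \<open>\<infinity>\<close>.\<close>

definition ennpowr :: "ennreal \<Rightarrow> real \<Rightarrow> ennreal" where
  "ennpowr x a = (if x = \<infinity> then \<infinity> else ennreal (enn2real x powr a))"

text \<open>Meant for \<open>0 < s < 1\<close>, \<open>1 \<le> p < \<infinity>\<close> and \<open>1 \<le> q < \<infinity>\<close>.  The library's total functions make
  the weight \<open>0\<close> at the single point \<open>h = 0\<close>, which has measure zero.  Using \<open>lborel\<close> rather than
  \<open>lebesgue\<close> makes no difference by the library fact \<open>nn_integral_completion\<close>.\<close>

definition besov_norm :: "real \<Rightarrow> real \<Rightarrow> real \<Rightarrow> ('a::euclidean_space \<Rightarrow> real) \<Rightarrow> ennreal" where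
  "besov_norm s p q f =
     ennpowr
       (\<integral>\<^sup>+ h. ennreal (norm h powr (- (q * s))) *
              ennpowr (\<integral>\<^sup>+ x. ennreal (\<bar>f (x + h) - f x\<bar> powr p) \<partial>lborel) (q / p) *
              ennreal (1 / norm h ^ DIM('a)) \<partial>lborel)
       (1 / q)"

definition composition_bounded_on_besov ::
    "real \<Rightarrow> real \<Rightarrow> real \<Rightarrow> ('a::euclidean_space \<Rightarrow> 'a) \<Rightarrow> bool" where
  "composition_bounded_on_besov s p q \<phi> \<longleftrightarrow>
     (\<exists>C::real. C \<ge> 0 \<and>
       (\<forall>f. continuous_on UNIV f \<and> besov_norm s p q f < \<infinity> \<longrightarrow>
            besov_norm s p q (f \<circ> \<phi>) \<le> ennreal C * besov_norm s p q f))"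

definition bi_Lipschitz :: "('a::metric_space \<Rightarrow> 'b::metric_space) \<Rightarrow> bool" where
  "bi_Lipschitz \<phi> \<longleftrightarrow>
     (\<exists>L\<ge>1. \<forall>x y. inverse L * dist x y \<le> dist (\<phi> x) (\<phi> y) \<and> dist (\<phi> x) (\<phi> y) \<le> L * dist x y)"

end

theory Submission
  imports Defs
begin

text \<open>
  Write \<open>p = n/s\<close>, \<open>I(h) = \<integral> \<bar>f(x + h) - f(x)\<bar>\<^sup>p dx\<close> and let the energy \<open>E f\<close> be the \<open>q\<close>-th power of the Besov norm, so
  that \<open>E (f \<circ> \<phi>) \<le> C E f\<close>. The energy is invariant under scaling.

  Two continua of comparable size and distance are separated only by functions of energy bounded below (a Loewner
  estimate), whereas averages of concentric bumps of geometric radii separate the boundary components of a fat ring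
  with small energy, because \<open>q > 1\<close>. Comparing the two shows that \<open>\<phi>\<close> and its inverse \<open>\<psi>\<close> are quasisymmetric.

  The sum of \<open>N\<close> disjoint bumps of one size has energy of order \<open>N\<^sup>q\<^sup>/\<^sup>p\<close>, the sum of \<open>N\<close> bumps of lacunary sizes has
  energy of order \<open>N\<close>. If the images under \<open>\<phi>\<close> (when \<open>q > p\<close>) or under \<open>\<psi>\<close> (when \<open>q < p\<close>) of balls of one radius could
  have arbitrarily different sizes, then by continuity all intermediate sizes occur, and a suitable sum of bumps
  exchanges the two configurations under composition with \<open>\<phi>\<close> in the direction forbidden by boundedness. Hence balls
  of one radius have images of comparable size, and subdividing segments gives the bi-Lipschitz bounds.
\<close>

subsection \<open>Powers in the extended nonnegative reals\<close>

text \<open>With \<open>p = n / s\<close> the weight satisfies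
  \<open>norm h powr (q * s) = (norm h ^ n) powr (q / p)\<close>, so measuring \<open>I(h)\<close>
  in units of \<open>norm h ^ n\<close> leaves only the scale-invariant kernel
  \<open>1 / norm h ^ n\<close>. For \<open>q = p\<close> the energy is a double integral over pairs
  of points, and both bump configurations have energy of order \<open>N\<close>, so they carry no
  information; this is the excluded exponent. For \<open>q\<close> different from \<open>p\<close>
  the energy is not additive over pairs. The Loewner estimate therefore uses only the bound of
  \<open>I(h)\<close> by a multiple of \<open>norm h ^ n\<close> times the power
  \<open>p / q\<close> of the energy. That bound loses all summability over scales, and the loss is
  made up by allowing the jumps at successive scales to decay geometrically.

  Boundedness is available for \<phi> alone. Test functions live in the target and are pulled back,
  so the ring estimate controls \<psi> directly and \<phi> only by contraposition, and the sign of
  \<open>q - p\<close> decides which of the two maps is compared across base points. Dimension at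
  least 2 enters because the exterior of a ball must be connected.\<close>

lemma ennpowr_ennreal: "0 \<le> x \<Longrightarrow> ennpowr (ennreal x) a = ennreal (x powr a)"
  by (simp add: ennpowr_def)

lemma ennpowr_top [simp]: "ennpowr \<infinity> a = \<infinity>" "ennpowr top a = top"
  by (simp_all add: ennpowr_def)

lemma ennpowr_0 [simp]: "ennpowr 0 a = 0"
  by (simp add: ennpowr_def)

lemma ennpowr_mono: "x \<le> y \<Longrightarrow> 0 \<le> a \<Longrightarrow> ennpowr x a \<le> ennpowr y a"
  by (cases x; cases y) (auto simp: ennpowr_ennreal intro!: ennreal_leI powr_mono2 simp: top_unique)

lemma ennpowr_mult: "ennpowr (x * y) a = ennpowr x a * ennpowr y a"
proof (cases x; cases y)
  fix r t :: real
  assume "0 \<le> r" "x = ennreal r" "0 \<le> t" "y = ennreal t"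
  then show ?thesis
    by (simp add: ennpowr_ennreal powr_mult flip: ennreal_mult)
next
  fix r :: real
  assume "0 \<le> r" "x = ennreal r" "y = top"
  then show ?thesis
    by (cases "r = 0") (auto simp: ennpowr_ennreal ennreal_mult_top)
next
  fix r :: real
  assume "0 \<le> r" "y = ennreal r" "x = top"
  then show ?thesis
    by (cases "r = 0") (auto simp: ennpowr_ennreal ennreal_top_mult)
qed auto

lemma ennpowr_ennpowr: "ennpowr (ennpowr x a) b = ennpowr x (a * b)"
  by (cases x) (auto simp: ennpowr_ennreal powr_powr)

lemma ennpowr_one [simp]: "ennpowr x 1 = x"
  by (cases x) (auto simp: ennpowr_ennreal)

lemma ennpowr_less_top_iff: "ennpowr x a < top \<longleftrightarrow> x < top"
  by (cases x) (auto simp: ennpowr_ennreal)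

text \<open>Stands in for Hoelder's inequality at every exponent \<alpha> \<ge> 0, which matters
  because \<open>q / p\<close> may lie on either side of 1. With \<open>m\<close> the largest ratio
  \<open>a i / w i\<close>, the sum of the \<open>a i\<close> is at most \<open>m\<close> times the
  sum of the weights, and \<open>m powr \<alpha>\<close> is one of the terms on the right.\<close>

lemma powr_sum_le:
  fixes a w :: "'i \<Rightarrow> real"
  assumes "finite I" "\<And>i. i \<in> I \<Longrightarrow> 0 < w i" "\<And>i. i \<in> I \<Longrightarrow> 0 \<le> a i" "0 \<le> \<alpha>"
  shows "(\<Sum>i\<in>I. a i) powr \<alpha> \<le> (\<Sum>i\<in>I. w i) powr \<alpha> * (\<Sum>i\<in>I. (a i / w i) powr \<alpha>)"
proof (cases "I = {}")
  case False
  define m where "m = Max ((\<lambda>i. a i / w i) ` I)"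
  have "m \<in> (\<lambda>i. a i / w i) ` I"
    unfolding m_def using False assms(1) by (intro Max_in) auto
  then obtain k where k: "k \<in> I" "m = a k / w k" by auto
  have le: "a i \<le> m * w i" if "i \<in> I" for i
  proof -
    have "a i / w i \<le> m" unfolding m_def using that assms(1) by (intro Max_ge) auto
    then show ?thesis using assms(2)[OF that] by (simp add: field_simps)
  qed
  have m0: "0 \<le> m" using k assms by (simp add: less_imp_le)
  have W0: "0 \<le> (\<Sum>i\<in>I. w i)" using assms(2) by (intro sum_nonneg) (auto simp: less_imp_le)
  have "(\<Sum>i\<in>I. a i) \<le> (\<Sum>i\<in>I. w i) * m"
    unfolding sum_distrib_right by (intro sum_mono) (use le in \<open>simp add: mult.commute\<close>)
  then have "(\<Sum>i\<in>I. a i) powr \<alpha> \<le> ((\<Sum>i\<in>I. w i) * m) powr \<alpha>"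
    using assms by (intro powr_mono2 sum_nonneg) auto
  also have "\<dots> = (\<Sum>i\<in>I. w i) powr \<alpha> * m powr \<alpha>"
    using m0 W0 by (simp add: powr_mult)
  also have "m powr \<alpha> \<le> (\<Sum>i\<in>I. (a i / w i) powr \<alpha>)"
    unfolding k(2) by (rule member_le_sum[OF k(1)]) (use assms(1) in auto)
  finally show ?thesis by (simp add: mult_left_mono)
qed auto

lemma powr_add_le:
  fixes x y a :: real
  assumes "0 \<le> x" "0 \<le> y" "0 \<le> a"
  shows "(x + y) powr a \<le> 2 powr a * (x powr a + y powr a)"
proof -
  have "(x + y) powr a \<le> (2 * max x y) powr a"
    using assms by (intro powr_mono2) auto
  also have "\<dots> = 2 powr a * max x y powr a"
    using assms by (intro powr_mult)
  also have "\<dots> \<le> 2 powr a * (x powr a + y powr a)"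
    by (intro mult_left_mono) (auto simp: max_def)
  finally show ?thesis .
qed

lemma ennpowr_add_le:
  assumes "0 \<le> a"
  shows "ennpowr (x + y) a \<le> ennreal (2 powr a) * (ennpowr x a + ennpowr y a)"
proof (cases "x = top \<or> y = top")
  case True
  then show ?thesis by (auto simp: ennreal_mult_top)
next
  case False
  then obtain r t where "x = ennreal r" "0 \<le> r" "y = ennreal t" "0 \<le> t"
    by (cases x; cases y) auto
  then show ?thesis
    using powr_add_le[of r t a] assms
    by (simp add: ennpowr_ennreal flip: ennreal_plus ennreal_mult)
qed

lemma measurable_ennpowr [measurable (raw)]:
  assumes "f \<in> borel_measurable M"
  shows "(\<lambda>x. ennpowr (f x) a) \<in> borel_measurable M"
proof -
  note assms [measurable]
  show ?thesis unfolding ennpowr_def by measurable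
qed

subsection \<open>The energy\<close>

definition shift_energy :: "real \<Rightarrow> ('a::euclidean_space \<Rightarrow> real) \<Rightarrow> 'a \<Rightarrow> ennreal" where
  "shift_energy p f h = (\<integral>\<^sup>+ x. ennreal (\<bar>f (x + h) - f x\<bar> powr p) \<partial>lborel)"

definition besov_energy :: "real \<Rightarrow> real \<Rightarrow> real \<Rightarrow> ('a::euclidean_space \<Rightarrow> real) \<Rightarrow> ennreal" where
  "besov_energy s p q f =
     (\<integral>\<^sup>+ h. ennreal (norm h powr (- (q * s)) / norm h ^ DIM('a)) * ennpowr (shift_energy p f h) (q / p) \<partial>lborel)"

lemma besov_norm_eq: "besov_norm s p q f = ennpowr (besov_energy s p q f) (1 / q)"
proof -
  have "ennreal (norm h powr - (q * s)) * ennpowr (shift_energy p f h) (q / p) * ennreal (1 / norm h ^ DIM('a))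
     = ennreal (norm h powr (- (q * s)) / norm h ^ DIM('a)) * ennpowr (shift_energy p f h) (q / p)" for h
    by (simp add: mult_ac flip: ennreal_mult)
  then show ?thesis
    unfolding besov_norm_def besov_energy_def shift_energy_def[symmetric] by simp
qed

lemma measurable_shift_energy [measurable]:
  assumes "f \<in> borel_measurable borel"
  shows "shift_energy p f \<in> borel_measurable borel"
proof -
  note assms [measurable]
  have "(\<lambda>h. \<integral>\<^sup>+ x. ennreal (\<bar>f (x + h) - f x\<bar> powr p) \<partial>lborel) \<in> borel_measurable lborel"
    by (rule lborel.borel_measurable_nn_integral) measurable
  then show ?thesis by (simp add: shift_energy_def[abs_def])
qed

section \<open>Ball volumes, translations and reflections\<close>

lemma emeasure_lborel_cball:
  fixes c :: "'a::euclidean_space"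
  assumes "0 \<le> r"
  shows "emeasure lborel (cball c r) = ennreal (unit_ball_vol (real DIM('a)) * r ^ DIM('a))"
  using emeasure_cball[OF assms, of c] by simp

lemma nn_integral_lborel_shift:
  fixes f :: "'a::euclidean_space \<Rightarrow> ennreal"
  assumes "f \<in> borel_measurable borel"
  shows "(\<integral>\<^sup>+ x. f (c + x) \<partial>lborel) = (\<integral>\<^sup>+ x. f x \<partial>lborel)"
proof -
  have "(\<integral>\<^sup>+ x. f x \<partial>lborel) = (\<integral>\<^sup>+ x. f x \<partial>distr lborel borel ((+) c))"
    by (simp add: lborel_distr_plus)
  also have "\<dots> = (\<integral>\<^sup>+ x. f (c + x) \<partial>lborel)"
    using assms by (subst nn_integral_distr) auto
  finally show ?thesis by simp
qed

lemma nn_integral_lborel_reflect: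
  fixes f :: "'a::euclidean_space \<Rightarrow> ennreal"
  assumes "f \<in> borel_measurable borel"
  shows "(\<integral>\<^sup>+ x. f (c - x) \<partial>lborel) = (\<integral>\<^sup>+ x. f x \<partial>lborel)"
proof -
  have "(\<integral>\<^sup>+ x. f x \<partial>lborel) = (\<integral>\<^sup>+ x. f x \<partial>(density (distr lborel borel (\<lambda>x. c + (-1) *\<^sub>R x)) (\<lambda>_. \<bar>-1::real\<bar> ^ DIM('a))))"
    by (subst lborel_affine[of "-1" c, symmetric]) auto
  also have "\<dots> = (\<integral>\<^sup>+ x. f (c - x) \<partial>lborel)"
    using assms by (subst nn_integral_density) (auto simp: nn_integral_distr)
  finally show ?thesis by simp
qed

lemma composition_bounded_energy:
  assumes "composition_bounded_on_besov s p q \<phi>" "0 < q"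
  shows "\<exists>C>0. \<forall>f. continuous_on UNIV f \<and> besov_energy s p q f < \<infinity> \<longrightarrow>
            besov_energy s p q (f \<circ> \<phi>) \<le> ennreal C * besov_energy s p q f"
proof -
  obtain C where C: "0 \<le> C" "\<And>f. continuous_on UNIV f \<Longrightarrow> besov_norm s p q f < \<infinity> \<Longrightarrow>
            besov_norm s p q (f \<circ> \<phi>) \<le> ennreal C * besov_norm s p q f"
    using assms(1) unfolding composition_bounded_on_besov_def by blast
  \<comment> \<open>The constant \<open>C\<close> may be 0; \<open>C + 1\<close> gives a strictly
    positive factor, by which a later proof divides.\<close>
  have "besov_energy s p q (f \<circ> \<phi>) \<le> ennreal ((C + 1) powr q) * besov_energy s p q f"
    if "continuous_on UNIV f" "besov_energy s p q f < \<infinity>" for f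
  proof -
    have "besov_norm s p q f < \<infinity>"
      using that(2) by (simp add: besov_norm_eq ennpowr_less_top_iff)
    then have "besov_norm s p q (f \<circ> \<phi>) \<le> ennreal C * besov_norm s p q f" using C(2) that(1) by blast
    then have "ennpowr (besov_norm s p q (f \<circ> \<phi>)) q \<le> ennpowr (ennreal C * besov_norm s p q f) q"
      using assms(2) by (intro ennpowr_mono) auto
    then have "besov_energy s p q (f \<circ> \<phi>) \<le> ennreal (C powr q) * besov_energy s p q f"
      using assms(2) C(1) by (simp add: besov_norm_eq ennpowr_mult ennpowr_ennpowr ennpowr_ennreal)
    also have "\<dots> \<le> ennreal ((C + 1) powr q) * besov_energy s p q f"
      using C(1) assms(2) by (intro mult_right_mono ennreal_leI powr_mono2) auto
    finally show ?thesis .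
  qed
  moreover have "0 < (C + 1) powr q" using C(1) by simp
  ultimately show ?thesis by blast
qed

text \<open>The increment over \<open>h\<close> is the increment over \<open>k\<close> followed by
  one over \<open>h - k\<close> at the translated point \<open>k + x\<close>; translation invariance
  of Lebesgue measure removes the translation.\<close>

lemma shift_energy_triangle:
  assumes "f \<in> borel_measurable borel" "0 \<le> p"
  shows "shift_energy p f h \<le> ennreal (2 powr p) * (shift_energy p f k + shift_energy p f (h - k))"
proof -
  note assms [measurable]
  have [measurable]: "f \<in> borel_measurable lborel" using assms by simp
  have "shift_energy p f h \<le> (\<integral>\<^sup>+ x. ennreal (2 powr p) *
      (ennreal (\<bar>f (x + k) - f x\<bar> powr p) + ennreal (\<bar>f ((k + x) + (h - k)) - f (k + x)\<bar> powr p)) \<partial>lborel)"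
    unfolding shift_energy_def
  proof (rule nn_integral_mono)
    fix x
    have "\<bar>f (x + h) - f x\<bar> powr p \<le> (\<bar>f (x + k) - f x\<bar> + \<bar>f ((k + x) + (h - k)) - f (k + x)\<bar>) powr p"
      using assms(2) by (intro powr_mono2) (auto simp: algebra_simps)
    also have "\<dots> \<le> 2 powr p * (\<bar>f (x + k) - f x\<bar> powr p + \<bar>f ((k + x) + (h - k)) - f (k + x)\<bar> powr p)"
      using assms(2) by (intro powr_add_le) auto
    finally show "ennreal (\<bar>f (x + h) - f x\<bar> powr p) \<le> ennreal (2 powr p) *
      (ennreal (\<bar>f (x + k) - f x\<bar> powr p) + ennreal (\<bar>f ((k + x) + (h - k)) - f (k + x)\<bar> powr p))"
      by (simp flip: ennreal_mult ennreal_plus)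
  qed
  also have "\<dots> = ennreal (2 powr p) *
      ((\<integral>\<^sup>+ x. ennreal (\<bar>f (x + k) - f x\<bar> powr p) \<partial>lborel) + (\<integral>\<^sup>+ x. ennreal (\<bar>f ((k + x) + (h - k)) - f (k + x)\<bar> powr p) \<partial>lborel))"
    by (simp add: nn_integral_cmult nn_integral_add)
  also have "(\<integral>\<^sup>+ x. ennreal (\<bar>f ((k + x) + (h - k)) - f (k + x)\<bar> powr p) \<partial>lborel) = shift_energy p f (h - k)"
    unfolding shift_energy_def by (rule nn_integral_lborel_shift) measurable
  finally show ?thesis by (simp add: shift_energy_def)
qed

section \<open>Control of increments by the energy\<close>

locale besov_exponents =
  fixes s p q :: real and type :: "'a::euclidean_space itself"
  assumes s: "0 < s" "s < 1" and q: "1 < q" and ps: "p * s = real DIM('a)"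
begin

lemma p_gt_0: "0 < p"
proof -
  have "0 < p * s" unfolding ps by simp
  then show ?thesis using s(1) by (simp add: zero_less_mult_iff)
qed

abbreviation E :: "('a \<Rightarrow> real) \<Rightarrow> ennreal" where "E \<equiv> besov_energy s p q"

text \<open>The \<open>L\<^sup>p\<close> modulus of continuity is almost subadditive in the shift; averaging the decomposition
  \<open>h = k + (h - k)\<close> over \<open>\<bar>k\<bar> \<le> \<bar>h\<bar>\<close> bounds it pointwise by the energy.\<close>

lemma shift_energy_le_energy:
  "\<exists>C>0. \<forall>f\<in>borel_measurable borel. \<forall>h.
     shift_energy p f h \<le> ennreal (C * norm h ^ DIM('a)) * ennpowr (E f) (p / q)"
proof -
  define n where "n = DIM('a)"
  define ball_vol where "ball_vol = unit_ball_vol (real n)"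
  \<comment> \<open>The factors, in order: the triangle inequality for shifts raised to the power
    \<open>q / p\<close>, the quasi-subadditivity of that power, two terms made equal by reflection,
    and the weight at radius \<open>2 * r\<close>, divided by the volume of the ball of
    averaging.\<close>
  define D where "D = 2 powr q * 2 powr (q/p) * 2 * 2 powr (q * s) * 2 ^ n / ball_vol"
  have bv: "ball_vol > 0" by (simp add: ball_vol_def)
  have D0: "D > 0" unfolding D_def using bv by simp
  have main: "shift_energy p f h \<le> ennreal (D powr (p/q) * norm h ^ n) * ennpowr (E f) (p / q)"
    if f: "f \<in> borel_measurable borel" for f :: "'a \<Rightarrow> real" and h
  proof (cases "h = 0")
    case True
    then show ?thesis by (simp add: shift_energy_def)
  next
    case False
    define I where "I = shift_energy p f"
    define r where "r = norm h"
    have r: "r > 0" using False r_def by simp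
    have [measurable]: "I \<in> borel_measurable borel" "I \<in> borel_measurable lborel"
      unfolding I_def using f by auto
    \<comment> \<open>For \<open>k\<close> in the ball of radius \<open>r\<close> both
      \<open>k\<close> and \<open>h - k\<close> have norm at most \<open>2 * r\<close>, and on that
      larger ball the Besov weight is bounded below by its value at \<open>2 * r\<close>. So the
      truncation is harmless, and the unweighted integral of \<open>J\<close> is controlled by the
      energy.\<close>
    define J where "J k = ennpowr (I k) (q/p) * indicator (cball 0 (2*r)) k" for k
    have J_meas [measurable]: "J \<in> borel_measurable borel"
      unfolding J_def[abs_def]
      by (intro borel_measurable_times_ennreal borel_measurable_indicator measurable_ennpowr) auto
    have [measurable]: "J \<in> borel_measurable lborel" using J_meas by simp
    have qp: "0 < q/p" using q p_gt_0 by simp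
    have J_le: "J k \<le> ennreal ((2*r) powr (q * s) * (2*r)^n) *
         (ennreal (norm k powr (- (q * s)) / norm k ^ n) * ennpowr (I k) (q / p))" if "k \<noteq> 0" for k
    proof (cases "k \<in> cball 0 (2*r)")
      case True
      have nk: "0 < norm k" "norm k \<le> 2*r" using True that by auto
      have "1 = norm k powr (q * s) * norm k ^ n * (norm k powr (- (q * s)) / norm k ^ n)"
        using nk by (simp add: powr_minus field_simps)
      also have "\<dots> \<le> ((2*r) powr (q * s) * (2*r)^n) * (norm k powr (- (q * s)) / norm k ^ n)"
        using nk q s by (intro mult_right_mono mult_mono powr_mono2 power_mono) auto
      finally have "ennreal 1 \<le> ennreal (((2*r) powr (q * s) * (2*r)^n) * (norm k powr (- (q * s)) / norm k ^ n))"
        by (rule ennreal_leI)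
      then have "1 * ennpowr (I k) (q/p) \<le> ennreal (((2*r) powr (q * s) * (2*r)^n) * (norm k powr (- (q * s)) / norm k ^ n)) * ennpowr (I k) (q/p)"
        by (intro mult_right_mono) auto
      then show ?thesis
        using True r by (subst (asm) ennreal_mult) (auto simp: J_def mult.assoc)
    qed (simp add: J_def)
    have J_int: "(\<integral>\<^sup>+ k. J k \<partial>lborel) \<le> ennreal ((2*r) powr (q * s) * (2*r)^n) * E f"
    proof -
      have "(\<integral>\<^sup>+ k. J k \<partial>lborel) \<le> (\<integral>\<^sup>+ k. ennreal ((2*r) powr (q * s) * (2*r)^n) *
         (ennreal (norm k powr (- (q * s)) / norm k ^ n) * ennpowr (I k) (q / p)) \<partial>lborel)"
        by (rule nn_integral_mono_AE) (use AE_lborel_singleton[of 0] J_le in auto)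
      also have "\<dots> = ennreal ((2*r) powr (q * s) * (2*r)^n) * E f"
        unfolding besov_energy_def I_def[symmetric] n_def[symmetric]
        by (rule nn_integral_cmult) measurable
      finally show ?thesis .
    qed
    have sub: "ennpowr (I h) (q/p) \<le> ennreal (2 powr q * 2 powr (q/p)) * (J k + J (h - k))"
      if "k \<in> cball 0 r" for k
    proof -
      have "norm (h - k) \<le> 2 * r" "norm k \<le> 2 * r"
        using norm_triangle_ineq4[of h k] that r unfolding r_def mem_cball_0 by linarith+
      then have J: "J k = ennpowr (I k) (q/p)" "J (h - k) = ennpowr (I (h - k)) (q/p)"
        by (auto simp: J_def)
      have "ennpowr (I h) (q/p) \<le> ennpowr (ennreal (2 powr p) * (I k + I (h - k))) (q/p)"
        unfolding I_def using f p_gt_0 qp by (intro ennpowr_mono shift_energy_triangle) auto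
      also have "\<dots> = ennreal (2 powr q) * ennpowr (I k + I (h - k)) (q/p)"
        using p_gt_0 by (simp add: ennpowr_mult ennpowr_ennreal powr_powr)
      also have "\<dots> \<le> ennreal (2 powr q) * (ennreal (2 powr (q/p)) * (J k + J (h - k)))"
        unfolding J using qp by (intro mult_left_mono ennpowr_add_le) auto
      finally show ?thesis by (simp add: ennreal_mult mult.assoc)
    qed
    have "ennpowr (I h) (q/p) * emeasure lborel (cball (0::'a) r)
        = (\<integral>\<^sup>+ k. ennpowr (I h) (q/p) * indicator (cball (0::'a) r) k \<partial>lborel)"
      by (simp add: nn_integral_cmult_indicator)
    also have "\<dots> \<le> (\<integral>\<^sup>+ k. ennreal (2 powr q * 2 powr (q/p)) * (J k + J (h - k)) \<partial>lborel)"
      by (rule nn_integral_mono) (use sub in \<open>auto simp: indicator_def\<close>)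
    also have "\<dots> = ennreal (2 powr q * 2 powr (q/p)) * ((\<integral>\<^sup>+ k. J k \<partial>lborel) + (\<integral>\<^sup>+ k. J (h - k) \<partial>lborel))"
      by (subst nn_integral_cmult) (auto simp: nn_integral_add)
    also have "\<dots> = ennreal (2 powr q * 2 powr (q/p)) * (2 * (\<integral>\<^sup>+ k. J k \<partial>lborel))"
      by (simp add: nn_integral_lborel_reflect flip: mult_2)
    also have "\<dots> \<le> ennreal (2 powr q * 2 powr (q/p)) * (2 * (ennreal ((2*r) powr (q * s) * (2*r)^n) * E f))"
      by (intro mult_left_mono J_int) auto
    also have "\<dots> = ennreal (2 powr q * 2 powr (q/p) * 2 * ((2*r) powr (q * s) * (2*r)^n)) * E f"
      using r by (simp add: ennreal_mult mult_ac)
    finally have A: "ennpowr (I h) (q/p) * ennreal (ball_vol * r^n)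
       \<le> ennreal (2 powr q * 2 powr (q/p) * 2 * ((2*r) powr (q * s) * (2*r)^n)) * E f"
      using r by (simp add: emeasure_lborel_cball ball_vol_def n_def)
    have "ennpowr (I h) (q/p) = ennpowr (I h) (q/p) * ennreal (ball_vol * r^n) * ennreal (1 / (ball_vol * r^n))"
      using bv r by (simp add: mult.assoc flip: ennreal_mult)
    also have "\<dots> \<le> (ennreal (2 powr q * 2 powr (q/p) * 2 * ((2*r) powr (q * s) * (2*r)^n)) * E f) * ennreal (1 / (ball_vol * r^n))"
      by (intro mult_right_mono A) auto
    also have "\<dots> = ennreal (2 powr q * 2 powr (q/p) * 2 * ((2*r) powr (q * s) * (2*r)^n) * (1 / (ball_vol * r^n))) * E f"
      using bv r by (subst ennreal_mult) (auto simp: mult_ac)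
    also have "2 powr q * 2 powr (q/p) * 2 * ((2*r) powr (q * s) * (2*r)^n) * (1 / (ball_vol * r^n)) = D * r powr (q * s)"
      unfolding D_def using r bv by (simp add: field_simps powr_mult)
    finally have "ennpowr (ennpowr (I h) (q/p)) (p/q) \<le> ennpowr (ennreal (D * r powr (q * s)) * E f) (p/q)"
      using q p_gt_0 by (intro ennpowr_mono) auto
    moreover have "ennpowr (ennpowr (I h) (q/p)) (p/q) = I h"
      using q p_gt_0 by (simp add: ennpowr_ennpowr)
    \<comment> \<open>Here \<open>p * s = n\<close> turns \<open>r powr (q * s)\<close> into the
      volume factor \<open>r ^ n\<close>.\<close>
    moreover have "ennpowr (ennreal (D * r powr (q * s)) * E f) (p/q) = ennreal (D powr (p/q) * r^n) * ennpowr (E f) (p/q)"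
    proof -
      have "r powr (q * s * (p/q)) = r ^ n"
        using q r ps by (simp add: mult.commute n_def powr_realpow)
      then show ?thesis
        using D0 r by (simp add: ennpowr_mult ennpowr_ennreal powr_mult powr_powr)
    qed
    ultimately show ?thesis by (simp add: I_def r_def)
  qed
  have "D powr (p/q) > 0" using D0 by simp
  with main show ?thesis unfolding n_def by blast
qed

text \<open>Substituting \<open>y = x + h\<close> and exchanging the integrals leaves
  \<open>shift_energy p f h\<close> integrated over the ball of radius \<open>R\<close>; the
  pointwise bound contributes one factor \<open>R ^ n\<close> and the volume of the ball
  another.\<close>

lemma double_integral_le_energy:
  "\<exists>C>0. \<forall>f\<in>borel_measurable borel. \<forall>R\<ge>0.
     (\<integral>\<^sup>+ x. (\<integral>\<^sup>+ y. indicator (cball x R) y * ennreal (\<bar>f y - f x\<bar> powr p) \<partial>lborel) \<partial>lborel)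
       \<le> ennreal (C * R ^ (2 * DIM('a))) * ennpowr (E f) (p / q)"
proof -
  define n where "n = DIM('a)"
  define w where "w = unit_ball_vol (real n)"
  have w: "w > 0" by (simp add: w_def)
  obtain C where C: "C > 0" "\<And>f h. f \<in> borel_measurable borel \<Longrightarrow>
     shift_energy p f h \<le> ennreal (C * norm h ^ n) * ennpowr (E f) (p / q)"
    using shift_energy_le_energy unfolding n_def by blast
  have "(\<integral>\<^sup>+ x. (\<integral>\<^sup>+ y. indicator (cball x R) y * ennreal (\<bar>f y - f x\<bar> powr p) \<partial>lborel) \<partial>lborel)
       \<le> ennreal (C * w * R ^ (2 * n)) * ennpowr (E f) (p / q)"
    if f [measurable]: "f \<in> borel_measurable borel" and R: "0 \<le> R" for f :: "'a \<Rightarrow> real" and R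
  proof -
    have [measurable]: "cball (x::'a) R \<in> sets borel" for x by simp
    have "(\<integral>\<^sup>+ y. indicator (cball x R) y * ennreal (\<bar>f y - f x\<bar> powr p) \<partial>lborel)
        = (\<integral>\<^sup>+ h. indicator (cball 0 R) h * ennreal (\<bar>f (x + h) - f x\<bar> powr p) \<partial>lborel)" for x
    proof -
      have "(\<integral>\<^sup>+ y. indicator (cball x R) y * ennreal (\<bar>f y - f x\<bar> powr p) \<partial>lborel)
        = (\<integral>\<^sup>+ h. indicator (cball x R) (x + h) * ennreal (\<bar>f (x + h) - f x\<bar> powr p) \<partial>lborel)"
        by (rule nn_integral_lborel_shift[symmetric]) measurable
      also have "\<dots> = (\<integral>\<^sup>+ h. indicator (cball 0 R) h * ennreal (\<bar>f (x + h) - f x\<bar> powr p) \<partial>lborel)"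
        by (simp add: indicator_def dist_norm)
      finally show ?thesis .
    qed
    then have "(\<integral>\<^sup>+ x. (\<integral>\<^sup>+ y. indicator (cball x R) y * ennreal (\<bar>f y - f x\<bar> powr p) \<partial>lborel) \<partial>lborel)
       = (\<integral>\<^sup>+ x. (\<integral>\<^sup>+ h. indicator (cball 0 R) h * ennreal (\<bar>f (x + h) - f x\<bar> powr p) \<partial>lborel) \<partial>lborel)"
      by simp
    also have "\<dots> = (\<integral>\<^sup>+ h. (\<integral>\<^sup>+ x. indicator (cball 0 R) h * ennreal (\<bar>f (x + h) - f x\<bar> powr p) \<partial>lborel) \<partial>lborel)"
      by (rule lborel_pair.Fubini') measurable
    also have "\<dots> = (\<integral>\<^sup>+ h. indicator (cball 0 R) h * shift_energy p f h \<partial>lborel)"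
      unfolding shift_energy_def by (intro nn_integral_cong nn_integral_cmult) measurable
    also have "\<dots> \<le> (\<integral>\<^sup>+ h. (ennreal (C * R ^ n) * ennpowr (E f) (p / q)) * indicator (cball (0::'a) R) h \<partial>lborel)"
    proof (rule nn_integral_mono)
      fix h :: 'a
      show "indicator (cball 0 R) h * shift_energy p f h
          \<le> (ennreal (C * R ^ n) * ennpowr (E f) (p / q)) * indicator (cball (0::'a) R) h"
      proof (cases "h \<in> cball 0 R")
        case True
        have "shift_energy p f h \<le> ennreal (C * norm h ^ n) * ennpowr (E f) (p / q)"
          by (rule C(2)) (rule f)
        also have "\<dots> \<le> ennreal (C * R ^ n) * ennpowr (E f) (p / q)"
          using True C(1) by (intro mult_right_mono ennreal_leI mult_left_mono power_mono) auto
        finally show ?thesis using True by simp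
      qed simp
    qed
    also have "\<dots> = (ennreal (C * R ^ n) * ennpowr (E f) (p / q)) * ennreal (w * R ^ n)"
      using R by (simp add: nn_integral_cmult_indicator emeasure_lborel_cball w_def n_def)
    also have "\<dots> = ennreal (C * R ^ n * (w * R ^ n)) * ennpowr (E f) (p / q)"
      using C(1) w R by (subst ennreal_mult) (auto simp: mult_ac)
    also have "C * R ^ n * (w * R ^ n) = C * w * R ^ (2 * n)"
      by (simp add: mult_2 power_add)
    finally show ?thesis .
  qed
  then show ?thesis using C(1) w unfolding n_def by (intro exI[of _ "C * w"]) (auto simp: n_def)
qed

text \<open>Each pair contributes at least \<open>\<alpha> * \<beta> * d powr p\<close> to the
  double integral over points at distance at most \<open>2 * R\<close>. The inner integral
  \<open>G u\<close> does not depend on \<open>j\<close>, so overlaps matter only for the sets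
  \<open>U j\<close>, and \<open>m\<close> bounds those.\<close>

lemma separated_pairs_le_energy:
  obtains C where "C > 0"
    "\<And>(f :: 'a \<Rightarrow> real) J (U :: 'i \<Rightarrow> 'a set) V x \<alpha> \<beta> d R (m::nat).
      \<lbrakk>f \<in> borel_measurable borel; finite J; 0 \<le> \<alpha>; 0 \<le> \<beta>; 0 \<le> d; 0 \<le> R;
       \<forall>j\<in>J. U j \<in> sets borel \<and> V j \<in> sets borel \<and> U j \<subseteq> cball (x j) R \<and> V j \<subseteq> cball (x j) R \<and>
         ennreal \<alpha> \<le> emeasure lborel (U j) \<and> ennreal \<beta> \<le> emeasure lborel (V j) \<and>
         (\<forall>u\<in>U j. \<forall>v\<in>V j. d \<le> \<bar>f v - f u\<bar>);
       \<forall>u. card {j\<in>J. u \<in> U j} \<le> m\<rbrakk>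
      \<Longrightarrow> ennreal (real (card J) * (\<alpha> * \<beta> * d powr p)) \<le> ennreal (C * real m * R ^ (2 * DIM('a))) * ennpowr (E f) (p / q)"
proof -
  define n where "n = DIM('a)"
  obtain C where C: "C > 0" "\<And>f R. f \<in> borel_measurable borel \<Longrightarrow> 0 \<le> R \<Longrightarrow>
     (\<integral>\<^sup>+ x. (\<integral>\<^sup>+ y. indicator (cball x R) y * ennreal (\<bar>f y - f x\<bar> powr p) \<partial>lborel) \<partial>lborel)
       \<le> ennreal (C * R ^ (2 * n)) * ennpowr (E f) (p / q)"
    using double_integral_le_energy unfolding n_def by blast
  have main: "ennreal (real (card J) * (\<alpha> * \<beta> * d powr p)) \<le> ennreal (C * 2 ^ (2 * n) * real m * R ^ (2 * n)) * ennpowr (E f) (p / q)"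
    if f [measurable]: "f \<in> borel_measurable borel" and J: "finite J" and nonneg: "0 \<le> \<alpha>" "0 \<le> \<beta>" "0 \<le> d" "0 \<le> R"
      and UV: "\<forall>j\<in>J. U j \<in> sets borel \<and> V j \<in> sets borel \<and> U j \<subseteq> cball (x j) R \<and> V j \<subseteq> cball (x j) R \<and>
        ennreal \<alpha> \<le> emeasure lborel (U j) \<and> ennreal \<beta> \<le> emeasure lborel (V j) \<and>
        (\<forall>u\<in>U j. \<forall>v\<in>V j. d \<le> \<bar>f v - f u\<bar>)"
      and m: "\<forall>u. card {j\<in>J. u \<in> U j} \<le> m"
    for f and J and U V :: "'i \<Rightarrow> 'a set" and x \<alpha> \<beta> d R and m :: nat
  proof -
    have cb: "{z :: 'a \<times> 'a. snd z \<in> cball (fst z) (2*R)} \<in> sets borel"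
    proof -
      have "closed {z :: 'a \<times> 'a. dist (fst z) (snd z) \<le> 2*R}"
        by (intro closed_Collect_le continuous_intros)
      then show ?thesis by (simp add: mem_cball)
    qed
    have eqi: "indicator (cball (fst z) (2*R)) (snd z) = (indicator {z. snd z \<in> cball (fst z) (2*R)} z :: ennreal)" for z :: "'a \<times> 'a"
      by (simp add: indicator_def)
    have "(\<lambda>z. indicator (cball (fst z) (2*R)) (snd z) * ennreal (\<bar>f (snd z) - f (fst z)\<bar> powr p)) \<in> borel_measurable (borel \<Otimes>\<^sub>M borel)"
      unfolding eqi
    proof (rule borel_measurable_times_ennreal)
      show "(indicator {z :: 'a \<times> 'a. snd z \<in> cball (fst z) (2 * R)} :: _ \<Rightarrow> ennreal) \<in> borel_measurable (borel \<Otimes>\<^sub>M borel)"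
        using cb unfolding borel_prod by (rule borel_measurable_indicator)
    qed measurable
    then have mz: "(\<lambda>(u, v). indicator (cball u (2*R)) v * ennreal (\<bar>f v - f u\<bar> powr p)) \<in> borel_measurable (lborel \<Otimes>\<^sub>M lborel)"
      by (simp add: case_prod_beta cong: measurable_cong_sets)
    define G where "G u = (\<integral>\<^sup>+ v. indicator (cball u (2*R)) v * ennreal (\<bar>f v - f u\<bar> powr p) \<partial>lborel)" for u
    have Gm: "G \<in> borel_measurable lborel"
      unfolding G_def[abs_def] by (rule lborel.borel_measurable_nn_integral) (rule mz)
    have one: "ennreal (\<alpha> * \<beta> * d powr p) \<le> (\<integral>\<^sup>+ u. indicator (U j) u * G u \<partial>lborel)" if j: "j \<in> J" for j
    proof -
      have G: "ennreal (\<beta> * d powr p) \<le> G u" if u: "u \<in> U j" for u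
      proof -
        have "ennreal (\<beta> * d powr p) = ennreal (d powr p) * ennreal \<beta>"
          using nonneg by (simp add: ennreal_mult mult.commute)
        also have "\<dots> \<le> ennreal (d powr p) * emeasure lborel (V j)"
          using UV j by (intro mult_left_mono) auto
        also have "\<dots> = (\<integral>\<^sup>+ v. ennreal (d powr p) * indicator (V j) v \<partial>lborel)"
          using UV j by (intro nn_integral_cmult_indicator[symmetric]) auto
        also have "\<dots> \<le> G u"
          unfolding G_def
        proof (rule nn_integral_mono)
          fix v
          show "ennreal (d powr p) * indicator (V j) v \<le> indicator (cball u (2*R)) v * ennreal (\<bar>f v - f u\<bar> powr p)"
          proof (cases "v \<in> V j")
            case True
            have "u \<in> cball (x j) R" "v \<in> cball (x j) R" using u True UV j by blast+
            then have "dist (x j) u \<le> R" "dist (x j) v \<le> R" by simp_all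
            then have "dist u v \<le> 2 * R" using dist_triangle3[of u v "x j"] by linarith
            moreover have "d powr p \<le> \<bar>f v - f u\<bar> powr p"
              using u True UV j nonneg p_gt_0 by (intro powr_mono2) auto
            ultimately show ?thesis using True by (simp add: ennreal_leI)
          qed simp
        qed
        finally show ?thesis .
      qed
      have "ennreal (\<alpha> * \<beta> * d powr p) = ennreal (\<beta> * d powr p) * ennreal \<alpha>"
        using nonneg by (simp add: ennreal_mult mult_ac)
      also have "\<dots> \<le> ennreal (\<beta> * d powr p) * emeasure lborel (U j)"
        using UV j by (intro mult_left_mono) auto
      also have "\<dots> = (\<integral>\<^sup>+ u. ennreal (\<beta> * d powr p) * indicator (U j) u \<partial>lborel)"
        using UV j by (intro nn_integral_cmult_indicator[symmetric]) auto
      also have "\<dots> \<le> (\<integral>\<^sup>+ u. indicator (U j) u * G u \<partial>lborel)"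
        by (rule nn_integral_mono) (use G in \<open>auto simp: indicator_def\<close>)
      finally show ?thesis .
    qed
    have "ennreal (real (card J) * (\<alpha> * \<beta> * d powr p)) = (\<Sum>j\<in>J. ennreal (\<alpha> * \<beta> * d powr p))"
      using nonneg by (simp add: ennreal_mult ennreal_of_nat_eq_real_of_nat)
    also have "\<dots> \<le> (\<Sum>j\<in>J. \<integral>\<^sup>+ u. indicator (U j) u * G u \<partial>lborel)"
      by (rule sum_mono) (rule one)
    also have "\<dots> = (\<integral>\<^sup>+ u. (\<Sum>j\<in>J. indicator (U j) u * G u) \<partial>lborel)"
      using UV Gm by (intro nn_integral_sum[symmetric] borel_measurable_times_ennreal borel_measurable_indicator) auto
    also have "\<dots> \<le> (\<integral>\<^sup>+ u. of_nat m * G u \<partial>lborel)"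
    proof (rule nn_integral_mono)
      fix u
      have "(\<Sum>j\<in>J. indicator (U j) u * G u) = of_nat (card {j\<in>J. u \<in> U j}) * G u"
        using J by (simp add: sum_distrib_right[symmetric] indicator_def of_bool_def sum.If_cases Int_def)
      also have "\<dots> \<le> of_nat m * G u"
        using m by (intro mult_right_mono) auto
      finally show "(\<Sum>j\<in>J. indicator (U j) u * G u) \<le> of_nat m * G u" .
    qed
    also have "\<dots> = of_nat m * (\<integral>\<^sup>+ u. G u \<partial>lborel)"
      by (rule nn_integral_cmult) (rule Gm)
    also have "\<dots> \<le> of_nat m * (ennreal (C * (2*R) ^ (2 * n)) * ennpowr (E f) (p / q))"
      unfolding G_def using C(2)[OF f, of "2*R"] nonneg by (intro mult_left_mono) auto
    also have "\<dots> = ennreal (real m * (C * (2*R) ^ (2 * n))) * ennpowr (E f) (p / q)"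
      using C(1) by (simp add: ennreal_mult ennreal_of_nat_eq_real_of_nat mult.assoc)
    also have "real m * (C * (2*R) ^ (2 * n)) = C * 2 ^ (2 * n) * real m * R ^ (2 * n)"
      by (simp add: power_mult_distrib)
    finally show ?thesis .
  qed
  show ?thesis
  proof (rule that[of "C * 2 ^ (2 * DIM('a))"], goal_cases)
    case 1
    then show ?case using C(1) by simp
  next
    case (2 f J U V x \<alpha> \<beta> d R m)
    then show ?case by (rule main[unfolded n_def])
  qed
qed

subsection \<open>A Loewner estimate\<close>

text \<open>For \<open>r > 0\<close> this says that \<open>t\<close> is at most the largest median
  of \<open>f\<close> on the ball, without choosing a median.\<close>

definition half_above :: "('a \<Rightarrow> real) \<Rightarrow> 'a \<Rightarrow> real \<Rightarrow> real \<Rightarrow> bool" where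
  "half_above f x r t \<longleftrightarrow>
     ennreal (unit_ball_vol (real DIM('a)) * r ^ DIM('a) / 2) \<le> emeasure lborel {u \<in> cball x r. t \<le> f u}"

text \<open>The two parts fill the ball, so they cannot both have less than half of its
  volume.\<close>

lemma not_half_above:
  assumes "f \<in> borel_measurable borel" "0 \<le> r" "\<not> half_above f x r t"
  shows "ennreal (unit_ball_vol (real DIM('a)) * r ^ DIM('a) / 2) \<le> emeasure lborel {u \<in> cball x r. f u < t}"
proof (rule ccontr)
  note [measurable] = assms(1)
  have [measurable]: "cball x r \<in> sets borel" by simp
  define w where "w = unit_ball_vol (real DIM('a)) * r ^ DIM('a) / 2"
  have w: "0 \<le> w" using assms(2) by (simp add: w_def)
  have m: "{u \<in> cball x r. t \<le> f u} \<in> sets borel" "{u \<in> cball x r. f u < t} \<in> sets borel"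
    by measurable
  assume "\<not> ?thesis"
  then have "emeasure lborel {u \<in> cball x r. f u < t} < ennreal w" by (simp add: w_def)
  moreover have "emeasure lborel {u \<in> cball x r. t \<le> f u} < ennreal w"
    using assms(3) by (simp add: w_def half_above_def not_le)
  ultimately have "emeasure lborel {u \<in> cball x r. t \<le> f u} + emeasure lborel {u \<in> cball x r. f u < t}
       < ennreal w + ennreal w"
    by (intro add_strict_mono)
  also have "ennreal w + ennreal w = emeasure lborel (cball x r)"
    using w assms(2) by (simp add: emeasure_lborel_cball w_def flip: ennreal_plus)
  also have "emeasure lborel {u \<in> cball x r. t \<le> f u} + emeasure lborel {u \<in> cball x r. f u < t}
      = emeasure lborel ({u \<in> cball x r. t \<le> f u} \<union> {u \<in> cball x r. f u < t})"
    using m by (intro plus_emeasure) auto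
  also have "{u \<in> cball x r. t \<le> f u} \<union> {u \<in> cball x r. f u < t} = cball x r" by auto
  finally show False by simp
qed

lemma half_above_small_scale:
  assumes "continuous_on UNIV f" "t < f x" "r \<longlonglongrightarrow> 0" "\<And>k. 0 < r k"
  shows "\<exists>K::nat. half_above f x (r K) t"
proof -
  have "open {u. t < f u}" using assms(1) by (intro open_Collect_less continuous_intros)
  then obtain d where d: "d > 0" "cball x d \<subseteq> {u. t < f u}"
    using assms(2) by (auto simp: open_contains_cball)
  obtain K where "r K < d" using order_tendstoD(2)[OF assms(3) d(1)] by (auto simp: eventually_sequentially)
  then have "cball x (r K) \<subseteq> {u. t < f u}" using d(2) by (force simp: subset_iff)
  then have "{u \<in> cball x (r K). t \<le> f u} = cball x (r K)" by force
  then have "half_above f x (r K) t"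
    using assms(4)[of K] by (simp add: half_above_def emeasure_lborel_cball ennreal_leI)
  then show ?thesis ..
qed

text \<open>If a point \<open>x\<close> of a continuum has no large ball on which \<open>f\<close> is mostly large, then the median of \<open>f\<close>
  jumps at some scale \<open>2\<^sup>-\<^sup>kl\<close> at \<open>x\<close>. The energy bounds the number of cells, in the projection
  \<open>x \<mapsto> dist a x\<close>, with a jump at a given scale; since \<open>p * s\<close> is the full dimension, the jumps may decay
  geometrically and the cells still fail to cover \<open>[0, l]\<close>.\<close>

lemma continuum_has_half_above:
  obtains \<delta> where "\<delta> > 0"
    "\<And>f X a b l. \<lbrakk>continuous_on UNIV f; connected X; a \<in> X; b \<in> X; 0 < l; l \<le> dist a b;
       \<forall>x\<in>X. 1 \<le> f x; E f < ennreal \<delta>\<rbrakk> \<Longrightarrow> \<exists>x\<in>X. dist a x \<le> l \<and> half_above f x l (3/4)"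
proof -
  define n where "n = DIM('a)"
  define w where "w = unit_ball_vol (real n)"
  have w: "w > 0" by (simp add: w_def)
  obtain C where C: "C > 0" and count: "\<And>(f :: 'a \<Rightarrow> real) J (U :: nat \<Rightarrow> 'a set) V x \<alpha> \<beta> d R (m::nat).
      \<lbrakk>f \<in> borel_measurable borel; finite J; 0 \<le> \<alpha>; 0 \<le> \<beta>; 0 \<le> d; 0 \<le> R;
       \<forall>j\<in>J. U j \<in> sets borel \<and> V j \<in> sets borel \<and> U j \<subseteq> cball (x j) R \<and> V j \<subseteq> cball (x j) R \<and>
         ennreal \<alpha> \<le> emeasure lborel (U j) \<and> ennreal \<beta> \<le> emeasure lborel (V j) \<and>
         (\<forall>u\<in>U j. \<forall>v\<in>V j. d \<le> \<bar>f v - f u\<bar>);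
       \<forall>u. card {j\<in>J. u \<in> U j} \<le> m\<rbrakk>
      \<Longrightarrow> ennreal (real (card J) * (\<alpha> * \<beta> * d powr p)) \<le> ennreal (C * real m * R ^ (2 * DIM('a))) * ennpowr (E f) (p / q)"
    by (rule separated_pairs_le_energy[where 'i = nat]) blast
  note count = count[folded n_def]
  \<comment> \<open>The square root of the scale ratio 1/2. The \<open>p\<close>-th powers of the
    jumps decay like \<open>g ^ k\<close>, so a jump at scale \<open>k\<close> occurs in at most
    order \<open>g ^ - k\<close> cells; each has relative length \<open>g ^ k * g ^ k\<close>, which
    leaves one factor \<open>g ^ k\<close> to make the total length summable.\<close>
  define g :: real where "g = 1 / sqrt 2"
  have g: "0 < g" "g < 1" "g * g = 1/2" by (auto simp: g_def field_simps)
  define \<theta> where "\<theta> = g powr (1 / p)"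
  have \<theta>: "0 < \<theta>" "\<theta> < 1" "\<theta> powr p = g"
    using g p_gt_0 by (auto simp: \<theta>_def powr_powr powr01_less_one)
  define d where "d k = \<theta> ^ k * ((1 - \<theta>) / 8)" for k
  have d0: "d k > 0" for k using \<theta> by (simp add: d_def)
  have dp: "d k powr p = g ^ k * ((1 - \<theta>) / 8) powr p" for k
  proof -
    have "(\<theta> ^ k) powr p = (\<theta> powr real k) powr p"
      using powr_realpow[OF \<theta>(1), of k] by simp
    also have "\<dots> = (\<theta> powr p) powr real k"
      by (simp add: powr_powr mult.commute)
    finally have "(\<theta> ^ k) powr p = g ^ k" using \<theta>(3) powr_realpow[OF g(1), of k] by simp
    then show ?thesis unfolding d_def using \<theta> by (subst powr_mult) auto
  qed
  \<comment> \<open>The levels rise from 3/4 towards 7/8 with increments \<open>d k\<close>, and so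
    stay below the value 1 that \<open>f\<close> attains or exceeds on the continuum.\<close>
  define t where "t k = 7/8 - \<theta> ^ k / 8" for k
  have t0: "t 0 = 3/4" by (simp add: t_def)
  have td: "t (Suc k) - t k = d k" for k by (simp add: t_def d_def field_simps)
  define c where "c = ((1 - \<theta>) / 8) powr p"
  have c0: "c > 0" using \<theta> by (simp add: c_def)
  \<comment> \<open>The 4 comes from two half balls, \<open>2 ^ n\<close> from the halved radius of
    \<open>U m\<close>, and 3 bounds the overlap of the sets \<open>U m\<close> below. The choice of
    \<delta> then keeps the total length of all cells with a jump at most half of
    \<open>l\<close>.\<close>
  define M where "M = 4 * 2 ^ n * C * 3 / (w * w * c)"
  have M0: "M > 0" using C w c0 by (simp add: M_def)
  define \<delta> where "\<delta> = ((1 - g) / (2 * M)) powr (q / p)"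
  have \<delta>0: "\<delta> > 0" using g M0 by (simp add: \<delta>_def)
  have main: "\<exists>x\<in>X. dist a x \<le> l \<and> half_above f x l (3/4)"
    if f: "continuous_on UNIV f" and X: "connected X" "a \<in> X" "b \<in> X" and l: "0 < l" "l \<le> dist a b"
      and f1: "\<forall>x\<in>X. 1 \<le> f x" and Ef: "E f < ennreal \<delta>" for f X a b l
  proof (rule ccontr)
    assume neg: "\<not> ?thesis"
    have fm: "f \<in> borel_measurable borel" by (rule borel_measurable_continuous_onI[OF f])
    note [measurable] = fm
    define r where "r k = l / 2 ^ k" for k :: nat
    have r0: "r k > 0" for k using l by (simp add: r_def)
    have r_lim: "r \<longlonglongrightarrow> 0"
      unfolding r_def by real_asymp
    have rS: "r (Suc k) = r k / 2" for k by (simp add: r_def)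
    have "E f < top" using Ef by (rule less_trans) simp
    then obtain e where e: "E f = ennreal e" "0 \<le> e" by (cases "E f") auto
    define A where "A = e powr (p/q)"
    have A: "ennpowr (E f) (p/q) = ennreal A" using e by (simp add: A_def ennpowr_ennreal)
    have A0: "A \<ge> 0" by (simp add: A_def)
    have AM: "M * A / (1 - g) < 1"
    proof -
      have "e < \<delta>" using Ef e \<delta>0 by (simp add: ennreal_less_iff)
      then have "A \<le> \<delta> powr (p/q)" unfolding A_def using e p_gt_0 q by (intro powr_mono2) auto
      also have "\<dots> = (1 - g) / (2 * M)" using g M0 p_gt_0 q by (simp add: \<delta>_def powr_powr)
      finally show ?thesis using g M0 by (simp add: field_simps)
    qed
    \<comment> \<open>A jump of the median between the scales \<open>r k\<close> and
      \<open>r (Suc k)\<close>. Without one, failure at scale \<open>l\<close> would propagate to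
      all smaller scales by induction, which continuity at \<open>x\<close> forbids because
      \<open>f x\<close> exceeds every level.\<close>
    define bad where "bad k x \<longleftrightarrow> half_above f x (r (Suc k)) (t (Suc k)) \<and> \<not> half_above f x (r k) (t k)" for k x
    have ex_bad: "\<exists>k. bad k x" if x: "x \<in> X" "dist a x \<le> l" for x
    proof (rule ccontr)
      assume nb: "\<nexists>k. bad k x"
      have n: "\<not> half_above f x (r k) (t k)" for k
      proof (induction k)
        case 0
        then show ?case using neg x by (auto simp: r_def t0)
      next
        case (Suc k)
        then show ?case using nb by (auto simp: bad_def)
      qed
      have "7/8 < f x" using f1 x by force
      from half_above_small_scale[OF f this r_lim r0] obtain K where K: "half_above f x (r K) (7/8)" ..
      have "half_above f x (r K) (t K)"
      proof -
        have le: "t K \<le> 7/8" using \<theta> by (simp add: t_def)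
        have "emeasure lborel {u \<in> cball x (r K). 7/8 \<le> f u} \<le> emeasure lborel {u \<in> cball x (r K). t K \<le> f u}"
        proof (rule emeasure_mono)
          have cb [measurable]: "cball x (r K) \<in> sets borel" by simp
          show "{u \<in> cball x (r K). t K \<le> f u} \<in> sets lborel" by simp
        qed (use le in auto)
        then show ?thesis using K unfolding half_above_def by (rule order_trans[rotated])
      qed
      then show False using n by blast
    qed
    define cell where "cell k x = nat \<lfloor>dist a x / r k\<rfloor>" for k x
    have cell: "real (cell k x) * r k \<le> dist a x" "dist a x \<le> (real (cell k x) + 1) * r k" for k x
    proof -
      have "0 \<le> dist a x / r k" using r0[of k] by simp
      then have "real (cell k x) \<le> dist a x / r k" "dist a x / r k \<le> real (cell k x) + 1"
        unfolding cell_def by linarith+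
      then show "real (cell k x) * r k \<le> dist a x" "dist a x \<le> (real (cell k x) + 1) * r k"
        using r0[of k] by (simp_all add: field_simps)
    qed
    define J where "J k = {m. \<exists>x\<in>X. dist a x \<le> l \<and> bad k x \<and> cell k x = m}" for k
    have finJ: "finite (J k)" for k
    proof (rule finite_subset)
      show "J k \<subseteq> {..nat \<lfloor>l / r k\<rfloor>}"
        unfolding J_def cell_def using r0[of k] by (auto intro!: nat_mono floor_mono divide_right_mono)
    qed auto
    have cardJ: "real (card (J k)) * g ^ k \<le> M * A" for k
    proof -
      obtain y where y: "\<And>m. m \<in> J k \<Longrightarrow> y m \<in> X \<and> dist a (y m) \<le> l \<and> bad k (y m) \<and> cell k (y m) = m"
        using bchoice[of "J k" "\<lambda>m x. x \<in> X \<and> dist a x \<le> l \<and> bad k x \<and> cell k x = m"] by (auto simp: J_def)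
      define U where "U m = {u \<in> cball (y m) (r (Suc k)). t (Suc k) \<le> f u}" for m
      define V where "V m = {u \<in> cball (y m) (r k). f u < t k}" for m
      have cb [measurable]: "cball z R \<in> sets borel" for z :: 'a and R by simp
      have UV: "\<forall>m\<in>J k. U m \<in> sets borel \<and> V m \<in> sets borel \<and> U m \<subseteq> cball (y m) (r k) \<and> V m \<subseteq> cball (y m) (r k) \<and>
        ennreal (w * r (Suc k) ^ n / 2) \<le> emeasure lborel (U m) \<and> ennreal (w * r k ^ n / 2) \<le> emeasure lborel (V m) \<and>
        (\<forall>u\<in>U m. \<forall>v\<in>V m. d k \<le> \<bar>f v - f u\<bar>)"
      proof (intro ballI conjI)
        fix m assume m: "m \<in> J k"
        show "U m \<in> sets borel" "V m \<in> sets borel" unfolding U_def V_def by measurable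
        show "U m \<subseteq> cball (y m) (r k)" using r0[of k] by (auto simp: U_def rS)
        show "V m \<subseteq> cball (y m) (r k)" by (auto simp: V_def)
        show "ennreal (w * r (Suc k) ^ n / 2) \<le> emeasure lborel (U m)"
          using y[OF m] by (simp add: bad_def half_above_def U_def w_def n_def)
        show "ennreal (w * r k ^ n / 2) \<le> emeasure lborel (V m)"
          using y[OF m] not_half_above[OF fm, of "r k" "y m" "t k"] r0[of k]
          by (simp add: bad_def V_def w_def n_def)
        fix u v assume "u \<in> U m" "v \<in> V m"
        then have "t (Suc k) \<le> f u" "f v < t k" by (simp_all add: U_def V_def)
        then show "d k \<le> \<bar>f v - f u\<bar>" using td[of k] by linarith
      qed
      \<comment> \<open>A point of \<open>U m\<close> is within half a cell length of
        \<open>y m\<close>, so its projection \<open>dist a u\<close> determines \<open>m\<close> up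
        to 1. This is why \<open>U m\<close> lies in the smaller of the two balls.\<close>
      have ov: "\<forall>u. card {m\<in>J k. u \<in> U m} \<le> 3"
      proof
        fix u
        define m0 where "m0 = \<lfloor>dist a u / r k\<rfloor>"
        have "int ` {m\<in>J k. u \<in> U m} \<subseteq> {m0 - 1..m0 + 1}"
        proof
          fix i assume "i \<in> int ` {m\<in>J k. u \<in> U m}"
          then obtain m where m: "m \<in> J k" "u \<in> U m" "i = int m" by auto
          have "dist (y m) u \<le> r k / 2" using m(2) by (simp add: U_def rS)
          then have "dist a u \<le> dist a (y m) + r k / 2" "dist a (y m) \<le> dist a u + r k / 2"
            using dist_triangle[of a u "y m"] dist_triangle[of a "y m" u] by (auto simp: dist_commute)
          then have "dist a u \<le> (real m + 1) * r k + r k / 2" "real m * r k \<le> dist a u + r k / 2"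
            using cell[where k = k and x = "y m"] y[OF m(1)] by auto
          then have "dist a u / r k \<le> real m + 1 + 1 / 2" "real m \<le> dist a u / r k + 1 / 2"
            using r0[of k] by (simp_all add: field_simps)
          then show "i \<in> {m0 - 1..m0 + 1}" unfolding m0_def m(3) by simp linarith
        qed
        then have "card (int ` {m\<in>J k. u \<in> U m}) \<le> card {m0 - 1..m0 + 1}"
          by (intro card_mono) auto
        then show "card {m\<in>J k. u \<in> U m} \<le> 3" by (subst (asm) card_image) auto
      qed
      have "ennreal (real (card (J k)) * ((w * r (Suc k) ^ n / 2) * (w * r k ^ n / 2) * d k powr p))
         \<le> ennreal (C * real 3 * r k ^ (2 * n)) * ennreal A"
        unfolding A[symmetric]
        by (rule count[OF fm finJ _ _ _ _ UV ov]) (use w r0 d0 in \<open>auto intro: less_imp_le\<close>)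
      then have "real (card (J k)) * ((w * r (Suc k) ^ n / 2) * (w * r k ^ n / 2) * d k powr p) \<le> C * 3 * r k ^ (2 * n) * A"
        using C A0 r0[of k] by (simp add: ennreal_le_iff flip: ennreal_mult)
      also have "real (card (J k)) * ((w * r (Suc k) ^ n / 2) * (w * r k ^ n / 2) * d k powr p)
          = (real (card (J k)) * g ^ k) * (w * w * c / (4 * 2 ^ n)) * r k ^ (2 * n)"
        unfolding dp c_def rS by (simp add: mult_2 power_add power_divide)
      finally have "(real (card (J k)) * g ^ k) * (w * w * c / (4 * 2 ^ n)) * r k ^ (2 * n) \<le> (C * 3 * A) * r k ^ (2 * n)"
        by (simp only: mult_ac)
      then have "(real (card (J k)) * g ^ k) * (w * w * c / (4 * 2 ^ n)) \<le> C * 3 * A"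
        by (rule mult_right_le_imp_le) (use r0[of k] in simp)
      then show ?thesis using w c0 unfolding M_def by (simp add: field_simps)
    qed
    define Z where "Z k = (\<Union>m\<in>J k. {real m * r k .. (real m + 1) * r k})" for k
    have Zm: "Z k \<in> sets lborel" for k unfolding Z_def using finJ by (intro sets.finite_UN) auto
    have Z: "emeasure lborel (Z k) \<le> ennreal (M * A * l * g ^ k)" for k
    proof -
      have "emeasure lborel (Z k) \<le> (\<Sum>m\<in>J k. emeasure lborel {real m * r k .. (real m + 1) * r k})"
        unfolding Z_def using finJ by (intro emeasure_subadditive_finite) auto
      also have "\<dots> = (\<Sum>m\<in>J k. ennreal (r k))"
        using r0[of k] by (intro sum.cong refl) (simp add: algebra_simps)
      also have "\<dots> = ennreal (real (card (J k)) * r k)"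
        using r0[of k] by (simp add: ennreal_mult ennreal_of_nat_eq_real_of_nat)
      also have "\<dots> \<le> ennreal (M * A * l * g ^ k)"
      proof (rule ennreal_leI)
        have "r k = l * (g ^ k * g ^ k)"
          unfolding r_def power_mult_distrib[symmetric] g(3) by (simp add: power_divide)
        then have "real (card (J k)) * r k = (real (card (J k)) * g ^ k) * (l * g ^ k)" by simp
        also have "\<dots> \<le> (M * A) * (l * g ^ k)"
          using cardJ[of k] l g by (intro mult_right_mono) auto
        finally show "real (card (J k)) * r k \<le> M * A * l * g ^ k" by (simp add: mult_ac)
      qed
      finally show ?thesis .
    qed
    have "{0..l} \<subseteq> (\<Union>k. Z k)"
    proof
      fix \<tau> assume \<tau>: "\<tau> \<in> {0..l}"
      \<comment> \<open>Connectedness enters here: \<open>dist a\<close> takes every value of the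
        interval on the continuum, and a point realising such a value has a jump at some
        scale.\<close>
      have "connected (dist a ` X)" using X by (intro connected_continuous_image continuous_intros)
      then have "\<tau> \<in> dist a ` X"
        by (rule connectedD_interval[where x = 0 and y = "dist a b"]) (use X \<tau> l in \<open>auto intro: rev_image_eqI\<close>)
      then obtain x where x: "x \<in> X" "\<tau> = dist a x" by auto
      then obtain k where "bad k x" using ex_bad[of x] \<tau> by auto
      then have "cell k x \<in> J k" using x \<tau> by (auto simp: J_def)
      then have "\<tau> \<in> Z k" unfolding Z_def using cell[where k = k and x = x] x by auto
      then show "\<tau> \<in> (\<Union>k. Z k)" by auto
    qed
    then have "emeasure lborel {0..l} \<le> emeasure lborel (\<Union>k. Z k)"
      using Zm by (intro emeasure_mono) auto
    also have "\<dots> \<le> (\<Sum>k. emeasure lborel (Z k))"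
      using Zm by (intro emeasure_subadditive_countably) auto
    also have "\<dots> \<le> (\<Sum>k. ennreal (M * A * l * g ^ k))"
      by (intro suminf_le Z) auto
    also have "\<dots> = ennreal (M * A * l * (1 / (1 - g)))"
    proof (rule suminf_ennreal_eq)
      show "0 \<le> M * A * l * g ^ k" for k using M0 A0 l g by simp
      show "(\<lambda>k. M * A * l * g ^ k) sums (M * A * l * (1 / (1 - g)))"
        using g by (intro sums_mult geometric_sums) auto
    qed
    finally have "ennreal l \<le> ennreal (M * A * l * (1 / (1 - g)))" using l by simp
    then have "l \<le> (M * A / (1 - g)) * l" using M0 A0 l g by (simp add: ennreal_le_iff mult_ac)
    also have "\<dots> < 1 * l" using AM l by (intro mult_strict_right_mono) auto
    finally show False by simp
  qed
  from \<delta>0 main show ?thesis by (rule that)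
qed

lemma besov_energy_one_minus: "E (\<lambda>x. 1 - f x) = E f"
proof -
  have "\<bar>(1 - f (x + h)) - (1 - f x)\<bar> = \<bar>f (x + h) - f x\<bar>" for x h by simp
  then show ?thesis unfolding besov_energy_def shift_energy_def by presburger
qed

text \<open>If the energy is below the threshold of \<open>continuum_has_half_above\<close>, some
  ball of radius \<open>l\<close> centred on \<open>X\<close> has \<open>f \<ge> 3/4\<close> on half
  of its volume, and the same lemma for \<open>1 - f\<close> gives one centred on \<open>Y\<close>
  with \<open>f \<le> 1/4\<close> on half. The centres are at most \<open>(T + 2) * l\<close> apart,
  so both balls lie in one ball of radius \<open>(T + 3) * l\<close>, and this single separated pair
  already forces energy.\<close>

lemma loewner:
  assumes "0 < T"
  obtains \<delta> where "\<delta> > 0"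
    "\<And>f X Y a b c d l. \<lbrakk>continuous_on UNIV f; connected X; connected Y; a \<in> X; b \<in> X; c \<in> Y; d \<in> Y;
      0 < l; l \<le> dist a b; l \<le> dist c d; dist a c \<le> T * l; \<forall>x\<in>X. 1 \<le> f x; \<forall>y\<in>Y. f y \<le> 0\<rbrakk>
      \<Longrightarrow> ennreal \<delta> \<le> E f"
proof -
  define n where "n = DIM('a)"
  define w where "w = unit_ball_vol (real n)"
  have w: "w > 0" by (simp add: w_def)
  obtain C where C: "C > 0" and count: "\<And>(f :: 'a \<Rightarrow> real) J (U :: nat \<Rightarrow> 'a set) V x \<alpha> \<beta> d R (m::nat).
      \<lbrakk>f \<in> borel_measurable borel; finite J; 0 \<le> \<alpha>; 0 \<le> \<beta>; 0 \<le> d; 0 \<le> R;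
       \<forall>j\<in>J. U j \<in> sets borel \<and> V j \<in> sets borel \<and> U j \<subseteq> cball (x j) R \<and> V j \<subseteq> cball (x j) R \<and>
         ennreal \<alpha> \<le> emeasure lborel (U j) \<and> ennreal \<beta> \<le> emeasure lborel (V j) \<and>
         (\<forall>u\<in>U j. \<forall>v\<in>V j. d \<le> \<bar>f v - f u\<bar>);
       \<forall>u. card {j\<in>J. u \<in> U j} \<le> m\<rbrakk>
      \<Longrightarrow> ennreal (real (card J) * (\<alpha> * \<beta> * d powr p)) \<le> ennreal (C * real m * R ^ (2 * DIM('a))) * ennpowr (E f) (p / q)"
    by (rule separated_pairs_le_energy[where 'i = nat]) blast
  note count = count[folded n_def]
  obtain \<delta>1 where \<delta>1: "\<delta>1 > 0" and half: "\<And>f X a b l. continuous_on UNIV f \<Longrightarrow> connected X \<Longrightarrow> a \<in> X \<Longrightarrow> b \<in> X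
      \<Longrightarrow> 0 < l \<Longrightarrow> l \<le> dist a b \<Longrightarrow> (\<forall>x\<in>X. 1 \<le> f x) \<Longrightarrow> E f < ennreal \<delta>1 \<Longrightarrow> (\<exists>x\<in>X. dist a x \<le> l \<and> half_above f x l (3/4))"
    by (rule continuum_has_half_above) blast
  define K where "K = w * w / 4 * (1/2) powr p / (C * (T + 3) ^ (2 * n))"
  have K: "K > 0" using w C assms by (simp add: K_def)
  define \<delta> where "\<delta> = min \<delta>1 (K powr (q / p))"
  have main: "ennreal \<delta> \<le> E f"
    if f: "continuous_on UNIV f" and conn: "connected X" "connected Y" and abcd: "a \<in> X" "b \<in> X" "c \<in> Y" "d \<in> Y"
      and l: "0 < l" "l \<le> dist a b" "l \<le> dist c d" and ac: "dist a c \<le> T * l"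
      and f1: "\<forall>x\<in>X. 1 \<le> f x" and f0: "\<forall>y\<in>Y. f y \<le> 0" for f X Y a b c d l
  proof (cases "E f < ennreal \<delta>1")
    case True
    have fm: "f \<in> borel_measurable borel" by (rule borel_measurable_continuous_onI[OF f])
    note [measurable] = fm
    obtain x where x: "x \<in> X" "dist a x \<le> l" "half_above f x l (3/4)"
      using half[OF f conn(1) abcd(1,2) l(1,2) f1 True] by blast
    obtain y where y: "y \<in> Y" "dist c y \<le> l" "half_above (\<lambda>x. 1 - f x) y l (3/4)"
    proof -
      have "continuous_on UNIV (\<lambda>x. 1 - f x)" using f by (intro continuous_intros)
      from half[OF this conn(2) abcd(3,4) l(1,3)] f0 True that show ?thesis
        by (auto simp: besov_energy_one_minus)
    qed
    define U where "U = {u \<in> cball x l. 3/4 \<le> f u}"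
    define V where "V = {u \<in> cball y l. 3/4 \<le> 1 - f u}"
    have cb [measurable]: "cball z R \<in> sets borel" for z :: 'a and R by simp
    have xy: "dist x y \<le> (T + 2) * l"
    proof -
      have "dist x y \<le> dist a x + dist a c + dist c y"
        using dist_triangle[of x y a] dist_triangle[of a y c] by (simp add: dist_commute)
      then show ?thesis using x(2) y(2) ac by (simp add: algebra_simps)
    qed
    have "ennreal (real (card {0::nat}) * ((w * l ^ n / 2) * (w * l ^ n / 2) * (1/2) powr p))
         \<le> ennreal (C * real 1 * ((T + 3) * l) ^ (2 * n)) * ennpowr (E f) (p / q)"
    proof (rule count[OF fm, where U = "\<lambda>_. U" and V = "\<lambda>_. V" and x = "\<lambda>_. x"])
      show "\<forall>j\<in>{0::nat}. U \<in> sets borel \<and> V \<in> sets borel \<and> U \<subseteq> cball x ((T + 3) * l) \<and> V \<subseteq> cball x ((T + 3) * l) \<and>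
        ennreal (w * l ^ n / 2) \<le> emeasure lborel U \<and> ennreal (w * l ^ n / 2) \<le> emeasure lborel V \<and>
        (\<forall>u\<in>U. \<forall>v\<in>V. 1/2 \<le> \<bar>f v - f u\<bar>)"
      proof (intro ballI conjI)
        show "U \<in> sets borel" "V \<in> sets borel" unfolding U_def V_def by measurable
        have "1 * l \<le> (T + 3) * l" using l assms by (intro mult_right_mono) auto
        then show "U \<subseteq> cball x ((T + 3) * l)" by (auto simp: U_def)
        show "V \<subseteq> cball x ((T + 3) * l)"
        proof
          fix v assume "v \<in> V"
          then have "dist y v \<le> l" by (simp add: V_def)
          then show "v \<in> cball x ((T + 3) * l)"
            using dist_triangle[of x v y] xy by (simp add: algebra_simps)
        qed
        show "ennreal (w * l ^ n / 2) \<le> emeasure lborel U" "ennreal (w * l ^ n / 2) \<le> emeasure lborel V"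
          using x(3) y(3) by (simp_all add: half_above_def U_def V_def w_def n_def)
        fix u v assume "u \<in> U" "v \<in> V"
        then have "3/4 \<le> f u" "3/4 \<le> 1 - f v" by (simp_all add: U_def V_def)
        then show "1/2 \<le> \<bar>f v - f u\<bar>" by linarith
      qed
      show "\<forall>u. card {j \<in> {0::nat}. u \<in> U} \<le> 1"
      proof
        fix u
        have "card {j \<in> {0::nat}. u \<in> U} \<le> card {0::nat}" by (rule card_mono) auto
        then show "card {j \<in> {0::nat}. u \<in> U} \<le> 1" by simp
      qed
    qed (use w l assms in auto)
    moreover obtain e where e: "E f = ennreal e" "0 \<le> e" using True by (cases "E f") auto
    ultimately have "w * l ^ n / 2 * (w * l ^ n / 2) * (1/2) powr p \<le> C * ((T + 3) * l) ^ (2 * n) * e powr (p/q)"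
      using C l assms by (simp add: ennpowr_ennreal flip: ennreal_mult)
    moreover have "w * l ^ n / 2 * (w * l ^ n / 2) * (1/2) powr p = (w * w / 4 * (1/2) powr p) * l ^ (2 * n)"
      by (simp add: mult_2 power_add)
    moreover have "C * ((T + 3) * l) ^ (2 * n) * e powr (p/q) = (C * (T + 3) ^ (2 * n) * e powr (p/q)) * l ^ (2 * n)"
      by (simp add: power_mult_distrib)
    ultimately have "(w * w / 4 * (1/2) powr p) * l ^ (2 * n) \<le> (C * (T + 3) ^ (2 * n) * e powr (p/q)) * l ^ (2 * n)"
      by (simp only:)
    then have "w * w / 4 * (1/2) powr p \<le> C * (T + 3) ^ (2 * n) * e powr (p/q)"
      by (rule mult_right_le_imp_le) (use l(1) in simp)
    then have "K \<le> e powr (p/q)"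
      using C assms by (simp add: K_def field_simps)
    then have "K powr (q/p) \<le> (e powr (p/q)) powr (q/p)"
      using K q p_gt_0 by (intro powr_mono2) auto
    also have "\<dots> = e" using e q p_gt_0 by (simp add: powr_powr)
    finally show ?thesis unfolding e(1) \<delta>_def by (intro ennreal_leI) auto
  next
    case False
    moreover have "ennreal \<delta> \<le> ennreal \<delta>1" by (intro ennreal_leI) (simp add: \<delta>_def)
    ultimately show ?thesis by (simp add: not_less)
  qed
  have "\<delta> > 0" using \<delta>1 K by (simp add: \<delta>_def)
  from this main show ?thesis by (rule that)
qed

end

subsection \<open>Bump functions and their energy\<close>

text \<open>For \<open>v > 0\<close> this is \<open>exp (- \<bar>ln v\<bar>)\<close>, which measures
  how far apart two scales of ratio \<open>v\<close> are; \<open>mu 0 = 0\<close> because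
  \<open>1 / 0 = 0\<close>.\<close>

definition mu :: "real \<Rightarrow> real" where
  "mu v = min v (1 / v)"

lemma mu_pos: "0 < v \<Longrightarrow> 0 < mu v"
  by (simp add: mu_def)

lemma mu_eq_inverse: "1 \<le> v \<Longrightarrow> mu v = 1 / v"
proof -
  assume v: "1 \<le> v"
  then have "1 / v \<le> 1" by simp
  then show "mu v = 1 / v" using v unfolding mu_def by linarith
qed

lemma mu_eq_self: "0 \<le> v \<Longrightarrow> v \<le> 1 \<Longrightarrow> mu v = v"
  by (cases "v = 0") (auto simp: mu_def min_def field_simps mult_le_one power2_eq_square)

lemma exists_dyadic_interval:
  fixes v :: real
  assumes "1 \<le> v"
  shows "\<exists>k. 2 ^ k \<le> v \<and> v < 2 ^ Suc k"
proof -
  define m where "m = (LEAST n. v < 2 ^ n)"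
  have ex: "\<exists>n. v < 2 ^ n" using real_arch_pow[of 2 v] by simp
  have m: "v < 2 ^ m" unfolding m_def by (rule LeastI_ex[OF ex])
  with assms have "m \<noteq> 0" by (intro notI) simp
  then obtain k where k: "m = Suc k" by (cases m) auto
  have "\<not> v < 2 ^ k" using not_less_Least[of k "\<lambda>n. v < 2 ^ n"] k by (simp add: m_def)
  then show ?thesis using m k by (auto simp: not_less)
qed

text \<open>The ratios \<open>v / L ^ j\<close> fall at least geometrically through 1, so the terms
  are dominated by two geometric series of ratio \<open>2 powr - a\<close>, one on each side of 1.
  The bound is uniform in \<open>v\<close>, \<open>L\<close> and \<open>N\<close>.\<close>

lemma sum_mu_lacunary:
  assumes L: "2 \<le> L" and a: "0 < a" and v: "0 < v"
  shows "(\<Sum>j<N. mu (v / L ^ j) powr a) \<le> 2 / (1 - 2 powr - a)"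
proof -
  define g where "g = 2 powr - a"
  have g: "0 < g" "g < 1" using a by (auto simp: g_def powr_less_one)
  define G where "G = 1 / (1 - g)"
  have G0: "0 < G" using g by (simp add: G_def)
  have small: "(\<Sum>j<N. mu (v / L ^ j) powr a) \<le> G" if "0 < v" "v \<le> 1" for v N
  proof -
    have "(\<Sum>j<N. mu (v / L ^ j) powr a) \<le> (\<Sum>j<N. g ^ j)"
    proof (rule sum_mono)
      fix j
      have L1: "2 ^ j \<le> L ^ j" using L by (intro power_mono) auto
      have "v / L ^ j \<le> 1 / 2 ^ j" using that L L1 by (intro frac_le) auto
      then have "mu (v / L ^ j) \<le> 1 / 2 ^ j" by (simp add: mu_def)
      then have "mu (v / L ^ j) powr a \<le> (1 / 2 ^ j) powr a"
        using that L a by (intro powr_mono2) (auto intro!: less_imp_le mu_pos)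
      also have "\<dots> = (2 powr - real j) powr a"
        by (simp add: powr_minus powr_realpow divide_inverse)
      also have "\<dots> = (2 powr - a) powr real j" by (simp add: powr_powr mult.commute)
      also have "\<dots> = g ^ j" using g by (simp add: powr_realpow g_def)
      finally show "mu (v / L ^ j) powr a \<le> g ^ j" .
    qed
    also have "\<dots> \<le> G"
      using g sum_le_suminf[of "(^) g" "{..<N}"] by (simp add: G_def suminf_geometric summable_geometric)
    finally show ?thesis .
  qed
  define c where "c = g / (1 - g)"
  have c: "0 < c" "1 + c = G" using g by (simp_all add: c_def G_def field_simps)
  \<comment> \<open>The subtracted term strengthens the claim so that induction on \<open>N\<close>
    closes: passing from \<open>v\<close> to \<open>v / L\<close> must pay for the first term
    \<open>v powr - a\<close>, and \<open>c\<close> is chosen so that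
    \<open>1 + c = c * 2 powr a\<close>.\<close>
  have big: "(\<Sum>j<N. mu (v / L ^ j) powr a) \<le> 2 * G - c * v powr - a" if "1 \<le> v" for v N
    using that
  proof (induction N arbitrary: v)
    case 0
    have "v powr - a \<le> 1" using 0 a by (simp add: ge_one_powr_ge_zero powr_minus inverse_le_1_iff)
    then have "c * v powr - a \<le> c * 1" using c by (intro mult_left_mono) auto
    then have "0 \<le> 2 * G - c * v powr - a" using c G0 by linarith
    then show ?case by simp
  next
    case (Suc N)
    have v1: "v powr - a \<le> 1" using Suc.prems a by (simp add: ge_one_powr_ge_zero powr_minus inverse_le_1_iff)
    have first: "mu v powr a = v powr - a"
      using Suc.prems by (simp add: mu_eq_inverse powr_minus powr_divide inverse_eq_divide)
    have "(\<Sum>j<Suc N. mu (v / L ^ j) powr a) = v powr - a + (\<Sum>j<N. mu ((v / L) / L ^ j) powr a)"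
      unfolding sum.lessThan_Suc_shift by (simp add: first)
    also have "\<dots> \<le> 2 * G - c * v powr - a"
    proof (cases "1 \<le> v / L")
      case True
      have "(\<Sum>j<N. mu ((v / L) / L ^ j) powr a) \<le> 2 * G - c * (v / L) powr - a"
        using Suc.IH[OF True] .
      moreover have "(1 + c) * v powr - a \<le> c * (v / L) powr - a"
      proof -
        have "(v / L) powr - a = v powr - a * L powr a"
          using Suc.prems L by (simp add: powr_divide powr_minus field_simps)
        moreover have "2 powr a * v powr - a \<le> L powr a * v powr - a"
          using L a by (intro mult_right_mono powr_mono2) auto
        moreover have "1 + c = c * 2 powr a"
          using g by (simp add: c_def field_simps) (simp add: g_def powr_minus)
        ultimately show ?thesis using c(1) by (simp add: mult_ac)
      qed
      ultimately show ?thesis by (simp add: algebra_simps)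
    next
      case False
      have "0 < v / L" using Suc.prems L by auto
      then have "(\<Sum>j<N. mu ((v / L) / L ^ j) powr a) \<le> G"
        using False by (intro small) auto
      moreover have "c * v powr - a \<le> c"
        using v1 c(1) by (simp add: mult_left_le)
      ultimately show ?thesis using v1 c(2) by linarith
    qed
    finally show ?case .
  qed
  have "(\<Sum>j<N. mu (v / L ^ j) powr a) \<le> 2 * G"
  proof (cases "v \<le> 1")
    case True
    then show ?thesis using small[OF v True, of N] G0 by simp
  next
    case False
    then have "(\<Sum>j<N. mu (v / L ^ j) powr a) \<le> 2 * G - c * v powr - a" by (intro big) auto
    moreover have "0 \<le> c * v powr - a" using c by simp
    ultimately show ?thesis by linarith
  qed
  then show ?thesis by (simp add: G_def g_def)
qed

lemma measurable_mu [measurable]: "mu \<in> borel_measurable borel"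
  unfolding mu_def[abs_def] by measurable

text \<open>The kernel \<open>\<bar>h\<bar>\<^sup>-\<^sup>n\<close> has the same mass on every dyadic annulus.\<close>

lemma nn_integral_mu_kernel:
  assumes a: "0 < a"
  shows "\<exists>C>0. \<forall>\<rho>>0. (\<integral>\<^sup>+ h. ennreal (mu (norm h / \<rho>) powr a / norm h ^ DIM('a)) \<partial>(lborel :: 'a::euclidean_space measure)) \<le> ennreal C"
proof -
  define n where "n = DIM('a)"
  define w where "w = unit_ball_vol (real n)"
  have w: "w > 0" by (simp add: w_def)
  define g where "g = 2 powr - a"
  have g: "0 < g" "g < 1" using a by (auto simp: g_def powr_less_one)
  have gk: "(1 / 2 ^ k) powr a = g ^ k" for k
  proof -
    have "(1 / 2 ^ k) powr a = (2 powr - real k) powr a"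
      by (simp add: powr_minus powr_realpow divide_inverse)
    also have "\<dots> = (2 powr - a) powr real k" by (simp add: powr_powr mult.commute)
    also have "\<dots> = g ^ k" using g by (simp add: powr_realpow g_def)
    finally show ?thesis .
  qed
  define C where "C = w * 2 ^ n * (2 / (1 - g))"
  have "(\<integral>\<^sup>+ h. ennreal (mu (norm h / \<rho>) powr a / norm h ^ n) \<partial>(lborel :: 'a measure)) \<le> ennreal C"
    if \<rho>: "0 < \<rho>" for \<rho>
  proof -
    \<comment> \<open>\<open>A k\<close> dominates the integrand on the annulus from
      \<open>2 ^ k * \<rho>\<close> to \<open>2 ^ Suc k * \<rho>\<close>, and \<open>B k\<close> on
      the mirror annulus inside radius \<rho>. Whole balls in place of annuli cost only a constant,
      since ball and annulus have comparable volume.\<close>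
    define A :: "nat \<Rightarrow> 'a \<Rightarrow> ennreal" where "A k h = ennreal (g ^ k / (2 ^ k * \<rho>) ^ n) * indicator (cball 0 (2 ^ Suc k * \<rho>)) h" for k h
    define B :: "nat \<Rightarrow> 'a \<Rightarrow> ennreal" where "B k h = ennreal (g ^ k / (\<rho> / 2 ^ Suc k) ^ n) * indicator (cball 0 (\<rho> / 2 ^ k)) h" for k h
    have AB: "A k \<in> borel_measurable lborel" "B k \<in> borel_measurable lborel" for k
      unfolding A_def[abs_def] B_def[abs_def]
      by (auto intro!: borel_measurable_times_ennreal borel_measurable_indicator)
    have le_suminf: "F k \<le> (\<Sum>k. F k)" for F :: "nat \<Rightarrow> ennreal" and k
      using sum_le_suminf[of F "{k}"] by simp
    have pw: "ennreal (mu (norm h / \<rho>) powr a / norm h ^ n) \<le> (\<Sum>k. A k h + B k h)" for h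
    proof (cases "h = 0")
      case False
      define v where "v = norm h / \<rho>"
      have v: "0 < v" using False \<rho> by (simp add: v_def)
      have hv: "norm h = v * \<rho>" using \<rho> by (simp add: v_def)
      show ?thesis
      proof (cases "1 \<le> v")
        case True
        then obtain k where k: "2 ^ k \<le> v" "v < 2 ^ Suc k" using exists_dyadic_interval by blast
        have "mu v powr a \<le> (1 / 2 ^ k) powr a"
          using True k a by (intro powr_mono2) (auto simp: mu_eq_inverse intro!: frac_le)
        then have "mu v powr a / norm h ^ n \<le> g ^ k / (2 ^ k * \<rho>) ^ n"
          unfolding gk hv using k \<rho> v g by (intro frac_le power_mono) auto
        then have "ennreal (mu v powr a / norm h ^ n) \<le> A k h"
          using k \<rho> by (simp add: A_def hv ennreal_leI less_imp_le)
        also have "\<dots> \<le> A k h + B k h" by simp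
        also have "\<dots> \<le> (\<Sum>k. A k h + B k h)" by (rule le_suminf)
        finally show ?thesis by (simp add: v_def)
      next
        case False
        then have "1 \<le> 1 / v" using v by simp
        then obtain k where k: "2 ^ k \<le> 1 / v" "1 / v < 2 ^ Suc k" using exists_dyadic_interval by blast
        have k1: "v \<le> 1 / 2 ^ k" "1 / 2 ^ Suc k < v" using k v by (simp_all add: field_simps)
        have "mu v powr a \<le> (1 / 2 ^ k) powr a"
          using False k1 v a by (intro powr_mono2) (auto simp: mu_eq_self)
        moreover have "\<rho> / 2 ^ Suc k \<le> v * \<rho>" using mult_right_mono[OF less_imp_le[OF k1(2)], of \<rho>] \<rho> by simp
        ultimately have "mu v powr a / norm h ^ n \<le> g ^ k / (\<rho> / 2 ^ Suc k) ^ n"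
          unfolding gk hv using \<rho> v g by (intro frac_le power_mono) auto
        moreover have "v * \<rho> \<le> \<rho> / 2 ^ k" using mult_right_mono[OF k1(1), of \<rho>] \<rho> by simp
        ultimately have "ennreal (mu v powr a / norm h ^ n) \<le> B k h"
          unfolding B_def using \<rho> v by (simp add: hv ennreal_leI del: power_Suc)
        also have "\<dots> \<le> A k h + B k h" by simp
        also have "\<dots> \<le> (\<Sum>k. A k h + B k h)" by (rule le_suminf)
        finally show ?thesis by (simp add: v_def)
      qed
    qed (simp add: mu_def)
    have intA: "(\<integral>\<^sup>+ h. A k h \<partial>lborel) = ennreal (w * 2 ^ n * g ^ k)" for k
    proof -
      have "(\<integral>\<^sup>+ h. A k h \<partial>lborel) = ennreal (g ^ k / (2 ^ k * \<rho>) ^ n) * ennreal (w * (2 ^ Suc k * \<rho>) ^ n)"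
        unfolding A_def using \<rho> by (simp add: nn_integral_cmult_indicator emeasure_lborel_cball w_def n_def)
      also have "\<dots> = ennreal (g ^ k / (2 ^ k * \<rho>) ^ n * (w * (2 ^ Suc k * \<rho>) ^ n))"
        using \<rho> g w by (intro ennreal_mult[symmetric]) auto
      also have "(2 ^ Suc k * \<rho>) ^ n = 2 ^ n * (2 ^ k * \<rho>) ^ n" by (simp add: power_mult_distrib)
      finally show ?thesis using \<rho> by (simp add: mult_ac)
    qed
    have intB: "(\<integral>\<^sup>+ h. B k h \<partial>lborel) = ennreal (w * 2 ^ n * g ^ k)" for k
    proof -
      have "(\<integral>\<^sup>+ h. B k h \<partial>lborel) = ennreal (g ^ k / (\<rho> / 2 ^ Suc k) ^ n) * ennreal (w * (\<rho> / 2 ^ k) ^ n)"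
        unfolding B_def using \<rho> by (simp add: nn_integral_cmult_indicator emeasure_lborel_cball w_def n_def)
      also have "\<dots> = ennreal (g ^ k / (\<rho> / 2 ^ Suc k) ^ n * (w * (\<rho> / 2 ^ k) ^ n))"
        using \<rho> g w by (intro ennreal_mult[symmetric]) auto
      also have "(\<rho> / 2 ^ k) ^ n = 2 ^ n * (\<rho> / 2 ^ Suc k) ^ n" by (simp flip: power_mult_distrib)
      finally show ?thesis using \<rho> by (simp add: mult_ac)
    qed
    have "(\<integral>\<^sup>+ h. ennreal (mu (norm h / \<rho>) powr a / norm h ^ n) \<partial>(lborel :: 'a measure))
        \<le> (\<integral>\<^sup>+ h. (\<Sum>k. A k h + B k h) \<partial>lborel)"
      by (intro nn_integral_mono pw)
    also have "\<dots> = (\<Sum>k. \<integral>\<^sup>+ h. (A k h + B k h) \<partial>lborel)"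
      using AB by (intro nn_integral_suminf borel_measurable_add) auto
    also have "\<dots> = (\<Sum>k. ennreal (2 * (w * 2 ^ n * g ^ k)))"
      using AB w g by (simp add: nn_integral_add intA intB mult_ac flip: ennreal_plus)
    also have "\<dots> = ennreal C"
    proof (rule suminf_ennreal_eq)
      show "0 \<le> 2 * (w * 2 ^ n * g ^ k)" for k using w g by simp
      have "(\<lambda>k. (2 * w * 2 ^ n) * g ^ k) sums ((2 * w * 2 ^ n) * (1 / (1 - g)))"
        using g by (intro sums_mult geometric_sums) auto
      then show "(\<lambda>k. 2 * (w * 2 ^ n * g ^ k)) sums C" by (simp add: C_def mult_ac)
    qed
    finally show ?thesis .
  qed
  moreover have "C > 0" using w g by (simp add: C_def)
  ultimately show ?thesis unfolding n_def by blast
qed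

section \<open>Bump functions\<close>

definition bump :: "'a::euclidean_space \<Rightarrow> real \<Rightarrow> 'a \<Rightarrow> real" where
  "bump c \<rho> x = max 0 (min 1 (2 - dist c x / \<rho>))"

lemma bump_bounds: "0 \<le> bump c \<rho> x" "bump c \<rho> x \<le> 1"
  by (auto simp: bump_def)

lemma bump_eq_1: "0 < \<rho> \<Longrightarrow> dist c x \<le> \<rho> \<Longrightarrow> bump c \<rho> x = 1"
  by (simp add: bump_def field_simps min_def)

lemma bump_eq_0: "0 < \<rho> \<Longrightarrow> 2 * \<rho> \<le> dist c x \<Longrightarrow> bump c \<rho> x = 0"
  by (simp add: bump_def field_simps min_def max_def)

lemma continuous_bump [continuous_intros]: "continuous_on S (bump c \<rho>)"
  unfolding bump_def[abs_def] by (cases "\<rho> = 0") (auto intro!: continuous_intros)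

lemma bump_diff_le:
  assumes "0 < \<rho>"
  shows "\<bar>bump c \<rho> x - bump c \<rho> y\<bar> \<le> min 1 (dist x y / \<rho>)"
proof -
  have "\<bar>dist c x - dist c y\<bar> \<le> dist x y"
    using abs_dist_diff_le[of x c y] by (simp add: dist_commute)
  then have "\<bar>dist c x / \<rho> - dist c y / \<rho>\<bar> \<le> dist x y / \<rho>"
    using assms by (simp add: divide_right_mono flip: diff_divide_distrib)
  then have "\<bar>bump c \<rho> x - bump c \<rho> y\<bar> \<le> dist x y / \<rho>"
    unfolding bump_def by (auto simp: max_def min_def)
  moreover have "\<bar>bump c \<rho> x - bump c \<rho> y\<bar> \<le> 1"
    using bump_bounds[of c \<rho> x] bump_bounds[of c \<rho> y] by linarith
  ultimately show ?thesis by simp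
qed

section \<open>Upper energy bounds for one bump and for sums of bumps\<close>

context besov_exponents
begin

text \<open>The worse of two decay rates: for shifts shorter than the radius of a bump the Lipschitz
  bound gains \<open>1 - s\<close>, for longer ones the bounded support gains
  \<open>s\<close>.\<close>

definition eta :: real where
  "eta = min s (1 - s)"

lemma eta: "0 < eta" "eta \<le> s" "eta \<le> 1 - s"
  using s by (auto simp: eta_def)

text \<open>With \<open>v = t / \<rho>\<close> and \<open>v ^ n = v powr (p * s)\<close> this
  reduces to comparing powers of \<open>v\<close>, with exponents \<open>1 - s\<close> for
  \<open>v \<le> 1\<close> and \<open>s\<close> for \<open>v > 1\<close>.\<close>

lemma power_shift_scale:
  assumes "0 < \<rho>" "0 < t"
  shows "\<rho> ^ DIM('a) * min 1 (t / \<rho>) powr p \<le> t ^ DIM('a) * mu (t / \<rho>) powr (p * eta)"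
proof -
  define n where "n = DIM('a)"
  define v where "v = t / \<rho>"
  have v: "0 < v" and t: "t = v * \<rho>" using assms by (simp_all add: v_def)
  have vn: "v ^ n = v powr (p * s)" using v ps by (simp add: n_def powr_realpow)
  have "min 1 v powr p \<le> v ^ n * mu v powr (p * eta)"
  proof (cases "v \<le> 1")
    case True
    have "p * s + p * eta \<le> p"
      using mult_left_mono[OF eta(3), of p] p_gt_0 by (simp add: algebra_simps)
    then have "v powr p \<le> v powr (p * s + p * eta)"
      using True v by (intro powr_mono') auto
    then show ?thesis using True v by (simp add: vn mu_eq_self powr_add min_def)
  next
    case False
    have "1 = v powr (p * s) * v powr (- (p * s))" using v by (simp add: powr_minus)
    also have "\<dots> \<le> v powr (p * s) * v powr (- (p * eta))"
      using False v eta(2) p_gt_0 by (intro mult_left_mono powr_mono) auto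
    also have "v powr (- (p * eta)) = mu v powr (p * eta)"
      using False v by (simp add: mu_eq_inverse powr_minus powr_divide inverse_eq_divide)
    finally show ?thesis using False by (simp add: vn min_def)
  qed
  then have "\<rho> ^ n * min 1 v powr p \<le> \<rho> ^ n * (v ^ n * mu v powr (p * eta))"
    using assms by (intro mult_left_mono) auto
  also have "\<dots> = t ^ n * mu v powr (p * eta)" by (simp add: t power_mult_distrib)
  finally show ?thesis by (simp add: v_def n_def)
qed

text \<open>An increment is at most \<open>min 1 (norm h / \<rho>)\<close> and vanishes outside two
  balls of radius \<open>2 * \<rho>\<close>, centred at \<open>c\<close> and \<open>c - h\<close>;
  \<open>power_shift_scale\<close> rewrites the resulting \<open>\<rho> ^ n\<close> in terms of
  \<open>norm h ^ n\<close>.\<close>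

lemma shift_energy_bump:
  "\<exists>C>0. \<forall>(c::'a) \<rho> h. 0 < \<rho> \<longrightarrow>
     shift_energy p (bump c \<rho>) h \<le> ennreal (C * norm h ^ DIM('a) * mu (norm h / \<rho>) powr (p * eta))"
proof -
  define n where "n = DIM('a)"
  define w where "w = unit_ball_vol (real n)"
  have w: "w > 0" by (simp add: w_def)
  define C where "C = 2 * (w * 2 ^ n)"
  have main: "shift_energy p (bump c \<rho>) h \<le> ennreal (C * norm h ^ n * mu (norm h / \<rho>) powr (p * eta))"
    if \<rho>: "0 < \<rho>" for c h :: 'a and \<rho>
  proof (cases "h = 0")
    case True
    then show ?thesis by (simp add: shift_energy_def)
  next
    case False
    define m where "m = min 1 (norm h / \<rho>) powr p"
    have [measurable]: "cball z r \<in> sets borel" for z :: 'a and r by simp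
    have "shift_energy p (bump c \<rho>) h \<le>
      (\<integral>\<^sup>+ x. ennreal m * indicator (cball c (2 * \<rho>)) x + ennreal m * indicator (cball (c - h) (2 * \<rho>)) x \<partial>lborel)"
      unfolding shift_energy_def
    proof (rule nn_integral_mono)
      fix x
      show "ennreal (\<bar>bump c \<rho> (x + h) - bump c \<rho> x\<bar> powr p)
        \<le> ennreal m * indicator (cball c (2 * \<rho>)) x + ennreal m * indicator (cball (c - h) (2 * \<rho>)) x"
      proof (cases "x \<in> cball c (2 * \<rho>) \<or> x \<in> cball (c - h) (2 * \<rho>)")
        case True
        have "\<bar>bump c \<rho> (x + h) - bump c \<rho> x\<bar> powr p \<le> m"
          unfolding m_def using bump_diff_le[OF \<rho>, of c "x + h" x] p_gt_0
          by (intro powr_mono2) (auto simp: dist_norm)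
        then have "ennreal (\<bar>bump c \<rho> (x + h) - bump c \<rho> x\<bar> powr p) \<le> ennreal m" by (rule ennreal_leI)
        also have "\<dots> \<le> ennreal m * indicator (cball c (2 * \<rho>)) x + ennreal m * indicator (cball (c - h) (2 * \<rho>)) x"
          using True by (auto simp: indicator_def)
        finally show ?thesis .
      next
        case False
        have "dist (c - h) x = dist c (x + h)" by (simp add: dist_norm algebra_simps)
        then have "bump c \<rho> (x + h) = 0" "bump c \<rho> x = 0"
          using False \<rho> by (auto intro!: bump_eq_0)
        then show ?thesis by simp
      qed
    qed
    also have "\<dots> = ennreal m * emeasure lborel (cball c (2 * \<rho>)) + ennreal m * emeasure lborel (cball (c - h) (2 * \<rho>))"
      by (subst nn_integral_add) (auto simp: nn_integral_cmult_indicator intro!: borel_measurable_times_ennreal borel_measurable_indicator)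
    also have "\<dots> = ennreal (C * (\<rho> ^ n * m))"
    proof -
      have m0: "0 \<le> m" by (simp add: m_def)
      have V: "emeasure lborel (cball z (2 * \<rho>)) = ennreal (w * 2 ^ n * \<rho> ^ n)" for z :: 'a
        using \<rho> by (simp add: emeasure_lborel_cball w_def n_def power_mult_distrib mult.assoc)
      have "ennreal m * ennreal (w * 2 ^ n * \<rho> ^ n) = ennreal (m * (w * 2 ^ n * \<rho> ^ n))"
        using m0 \<rho> w by (intro ennreal_mult[symmetric]) auto
      then have "ennreal m * emeasure lborel (cball c (2 * \<rho>)) + ennreal m * emeasure lborel (cball (c - h) (2 * \<rho>))
        = ennreal (m * (w * 2 ^ n * \<rho> ^ n) + m * (w * 2 ^ n * \<rho> ^ n))"
        unfolding V using m0 \<rho> w by (subst ennreal_plus) auto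
      also have "m * (w * 2 ^ n * \<rho> ^ n) + m * (w * 2 ^ n * \<rho> ^ n) = C * (\<rho> ^ n * m)"
        by (simp add: C_def)
      finally show ?thesis .
    qed
    also have "\<dots> \<le> ennreal (C * (norm h ^ n * mu (norm h / \<rho>) powr (p * eta)))"
    proof (intro ennreal_leI mult_left_mono)
      show "\<rho> ^ n * m \<le> norm h ^ n * mu (norm h / \<rho>) powr (p * eta)"
        unfolding m_def n_def by (rule power_shift_scale) (use \<rho> False in simp_all)
      show "0 \<le> C" using w by (simp add: C_def)
    qed
    finally show ?thesis by (simp add: mult.assoc)
  qed
  have C: "C > 0" using w by (simp add: C_def)
  show ?thesis
    by (intro exI[of _ C] conjI allI impI C main[unfolded n_def])
qed

text \<open>The power \<open>q / p\<close> of \<open>norm h ^ n\<close> is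
  \<open>norm h powr (q * s)\<close>, which cancels the Besov weight and leaves the kernel
  \<open>1 / norm h ^ n\<close>. At \<open>h = 0\<close> that weight is 0.\<close>

lemma energy_le_of_shift_energy_le:
  assumes "\<And>h. h \<noteq> 0 \<Longrightarrow> shift_energy p f h \<le> ennreal (norm h ^ DIM('a) * g h)" "\<And>h. 0 \<le> g h"
  shows "E f \<le> (\<integral>\<^sup>+ h. ennreal (g h powr (q / p) / norm h ^ DIM('a)) \<partial>lborel)"
  unfolding besov_energy_def
proof (rule nn_integral_mono)
  fix h :: 'a
  define n where "n = DIM('a)"
  show "ennreal (norm h powr - (q * s) / norm h ^ DIM('a)) * ennpowr (shift_energy p f h) (q / p)
    \<le> ennreal (g h powr (q / p) / norm h ^ DIM('a))"
  proof (cases "h = 0")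
    case False
    then have h: "0 < norm h" by simp
    have "(norm h ^ n) powr (q / p) = (norm h powr (p * s)) powr (q / p)"
      using h ps by (simp add: n_def powr_realpow)
    also have "\<dots> = norm h powr (q * s)" using p_gt_0 by (simp add: powr_powr mult.commute)
    finally have e: "(norm h ^ n * g h) powr (q / p) = norm h powr (q * s) * g h powr (q / p)"
      using assms(2)[of h] by (simp add: powr_mult)
    have "ennpowr (shift_energy p f h) (q / p) \<le> ennpowr (ennreal (norm h ^ n * g h)) (q / p)"
      using assms(1)[OF False] q p_gt_0 by (intro ennpowr_mono) (auto simp: n_def)
    also have "\<dots> = ennreal (norm h powr (q * s) * g h powr (q / p))"
      using assms(2)[of h] h by (simp add: ennpowr_ennreal e)
    finally have "ennreal (norm h powr - (q * s) / norm h ^ n) * ennpowr (shift_energy p f h) (q / p)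
       \<le> ennreal (norm h powr - (q * s) / norm h ^ n) * ennreal (norm h powr (q * s) * g h powr (q / p))"
      by (intro mult_left_mono) auto
    also have "\<dots> = ennreal (norm h powr - (q * s) / norm h ^ n * (norm h powr (q * s) * g h powr (q / p)))"
      by (intro ennreal_mult[symmetric]) auto
    also have "norm h powr - (q * s) / norm h ^ n * (norm h powr (q * s) * g h powr (q / p)) = g h powr (q / p) / norm h ^ n"
      using h by (simp add: powr_minus)
    finally show ?thesis by (simp add: n_def)
  qed simp
qed

text \<open>Bumps with centres \<open>4 * \<rho>\<close> apart do not overlap, so at most two of
  them enter any increment and the \<open>p\<close>-th powers add up to a factor
  \<open>2 powr p\<close>. Thus \<open>shift_energy\<close> is at most a multiple of
  \<open>card J\<close> times the bound for one bump, and the number of bumps appears to the power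
  \<open>q / p\<close>.\<close>

lemma energy_same_scale_le:
  "\<exists>C>0. \<forall>J (x :: nat \<Rightarrow> 'a) \<rho>. finite J \<longrightarrow> 0 < \<rho> \<longrightarrow> (\<forall>i\<in>J. \<forall>j\<in>J. i \<noteq> j \<longrightarrow> 4 * \<rho> \<le> dist (x i) (x j)) \<longrightarrow>
     E (\<lambda>y. \<Sum>j\<in>(J :: nat set). bump (x j) \<rho> y) \<le> ennreal (C * real (card J) powr (q / p))"
proof -
  define n where "n = DIM('a)"
  obtain C0 where C0: "C0 > 0" "\<forall>(c::'a) \<rho> h. 0 < \<rho> \<longrightarrow>
     shift_energy p (bump c \<rho>) h \<le> ennreal (C0 * norm h ^ DIM('a) * mu (norm h / \<rho>) powr (p * eta))"
    using shift_energy_bump by (elim exE conjE) (rule that)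
  note C0 = C0(1) C0(2)[rule_format, folded n_def]
  obtain C1 where C1: "C1 > 0" "\<forall>\<rho>>0.
     (\<integral>\<^sup>+ h. ennreal (mu (norm h / \<rho>) powr (q * eta) / norm h ^ DIM('a)) \<partial>(lborel :: 'a measure)) \<le> ennreal C1"
    using nn_integral_mu_kernel[of "q * eta", where 'a='a, OF mult_pos_pos[OF less_trans[OF zero_less_one q] eta(1)]]
    by (elim exE conjE) (rule that)
  note C1 = C1(1) C1(2)[rule_format, folded n_def]
  define C where "C = (2 powr p * C0) powr (q / p) * C1"
  have main: "E (\<lambda>y. \<Sum>j\<in>J. bump (x j) \<rho> y) \<le> ennreal (C * real (card J) powr (q / p))"
    if J: "finite J" and \<rho>: "0 < \<rho>" and sep: "\<forall>i\<in>J. \<forall>j\<in>J. i \<noteq> j \<longrightarrow> 4 * \<rho> \<le> dist (x i) (x j)"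
    for J :: "nat set" and x \<rho>
  proof -
    define F where "F = (\<lambda>y. \<Sum>j\<in>J. bump (x j) \<rho> y)"
    have bm: "bump c \<rho> \<in> borel_measurable borel" for c :: 'a
      by (rule borel_measurable_continuous_onI) (rule continuous_bump)
    have at_most_one: "card {j\<in>J. bump (x j) \<rho> y \<noteq> 0} \<le> 1" for y
    proof -
      have "i = j" if "i \<in> J" "j \<in> J" "bump (x i) \<rho> y \<noteq> 0" "bump (x j) \<rho> y \<noteq> 0" for i j
      proof (rule ccontr)
        assume "i \<noteq> j"
        then have "4 * \<rho> \<le> dist (x i) (x j)" using sep that by blast
        moreover have "dist (x i) y < 2 * \<rho>" "dist (x j) y < 2 * \<rho>"
          using that \<rho> bump_eq_0 by (meson not_less)+
        ultimately show False using dist_triangle2[of "x i" "x j" y] by linarith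
      qed
      then show ?thesis using J by (auto simp: card_le_Suc0_iff_eq)
    qed
    have pw: "\<bar>F (y + h) - F y\<bar> powr p \<le> 2 powr p * (\<Sum>j\<in>J. \<bar>bump (x j) \<rho> (y + h) - bump (x j) \<rho> y\<bar> powr p)" for y h
    proof -
      define d where "d j = \<bar>bump (x j) \<rho> (y + h) - bump (x j) \<rho> y\<bar>" for j
      define J' where "J' = {j\<in>J. bump (x j) \<rho> (y + h) \<noteq> 0} \<union> {j\<in>J. bump (x j) \<rho> y \<noteq> 0}"
      have J': "finite J'" "J' \<subseteq> J" using J by (auto simp: J'_def)
      have "card J' \<le> card {j\<in>J. bump (x j) \<rho> (y + h) \<noteq> 0} + card {j\<in>J. bump (x j) \<rho> y \<noteq> 0}"
        unfolding J'_def by (rule card_Un_le)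
      then have card: "real (card J') \<le> 2" using at_most_one[of y] at_most_one[of "y + h"] by linarith
      have "\<bar>F (y + h) - F y\<bar> \<le> (\<Sum>j\<in>J. d j)"
        unfolding F_def d_def by (simp add: sum_abs flip: sum_subtractf)
      also have "\<dots> = (\<Sum>j\<in>J'. d j)"
        using J J' by (intro sum.mono_neutral_right) (auto simp: J'_def d_def)
      finally have "\<bar>F (y + h) - F y\<bar> powr p \<le> (\<Sum>j\<in>J'. d j) powr p"
        using p_gt_0 by (intro powr_mono2) auto
      also have "\<dots> \<le> (\<Sum>j\<in>J'. 1) powr p * (\<Sum>j\<in>J'. (d j / 1) powr p)"
        using J' p_gt_0 by (intro powr_sum_le) (auto simp: d_def)
      also have "\<dots> \<le> 2 powr p * (\<Sum>j\<in>J. d j powr p)"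
        using card p_gt_0 J J' by (intro mult_mono powr_mono2) (auto intro!: sum_nonneg sum_mono2)
      finally show ?thesis by (simp add: d_def)
    qed
    define g where "g h = 2 powr p * real (card J) * C0 * mu (norm h / \<rho>) powr (p * eta)" for h :: 'a
    have "shift_energy p F h \<le> ennreal (norm h ^ DIM('a) * g h)" for h
    proof -
      have [measurable]: "bump c \<rho> \<in> borel_measurable borel" for c :: 'a by (rule bm)
      have "shift_energy p F h \<le> (\<integral>\<^sup>+ y. ennreal (2 powr p) * (\<Sum>j\<in>J. ennreal (\<bar>bump (x j) \<rho> (y + h) - bump (x j) \<rho> y\<bar> powr p)) \<partial>lborel)"
        unfolding shift_energy_def
        by (rule nn_integral_mono) (simp add: pw ennreal_leI sum_nonneg flip: ennreal_mult)
      also have "\<dots> = ennreal (2 powr p) * (\<Sum>j\<in>J. shift_energy p (bump (x j) \<rho>) h)"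
        unfolding shift_energy_def by (subst nn_integral_cmult) (auto simp: nn_integral_sum simp del: sum_ennreal)
      also have "\<dots> \<le> ennreal (2 powr p) * (\<Sum>j\<in>J. ennreal (C0 * norm h ^ n * mu (norm h / \<rho>) powr (p * eta)))"
        by (intro mult_left_mono sum_mono C0(2) \<rho>) auto
      also have "\<dots> = ennreal (norm h ^ n * g h)"
        using C0(1) by (simp add: g_def mult_ac ennreal_of_nat_eq_real_of_nat flip: ennreal_mult)
      finally show ?thesis by (simp add: n_def)
    qed
    then have "E F \<le> (\<integral>\<^sup>+ h. ennreal (g h powr (q / p) / norm h ^ n) \<partial>lborel)"
      unfolding n_def using C0(1) by (intro energy_le_of_shift_energy_le) (auto simp: g_def)
    also have "\<dots> = (\<integral>\<^sup>+ h. ennreal ((2 powr p * C0 * real (card J)) powr (q / p)) * ennreal (mu (norm h / \<rho>) powr (q * eta) / norm h ^ n) \<partial>(lborel :: 'a measure))"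
    proof (rule nn_integral_cong)
      fix h :: 'a
      have "g h powr (q / p) = (2 powr p * C0 * real (card J)) powr (q / p) * mu (norm h / \<rho>) powr (q * eta)"
        unfolding g_def using C0(1) p_gt_0 by (simp add: powr_mult powr_powr mult_ac)
      then show "ennreal (g h powr (q / p) / norm h ^ n) = ennreal ((2 powr p * C0 * real (card J)) powr (q / p)) * ennreal (mu (norm h / \<rho>) powr (q * eta) / norm h ^ n)"
        by (simp flip: ennreal_mult)
    qed
    also have "\<dots> = ennreal ((2 powr p * C0 * real (card J)) powr (q / p)) * (\<integral>\<^sup>+ h. ennreal (mu (norm h / \<rho>) powr (q * eta) / norm h ^ n) \<partial>(lborel :: 'a measure))"
      by (rule nn_integral_cmult) measurable
    also have "\<dots> \<le> ennreal ((2 powr p * C0 * real (card J)) powr (q / p)) * ennreal C1"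
      by (intro mult_left_mono C1(2) \<rho>) auto
    also have "\<dots> = ennreal (C * real (card J) powr (q / p))"
      using C0(1) C1(1) by (simp add: C_def powr_mult mult_ac flip: ennreal_mult)
    finally show ?thesis by (simp add: F_def)
  qed
  have C: "C > 0" using C0(1) C1(1) by (simp add: C_def)
  show ?thesis
    by (intro exI[of _ C] conjI allI impI C main)
qed

text \<open>A shift \<open>h\<close> interacts mainly with the bumps whose radius is close to
  \<open>norm h\<close>; the others decay geometrically in the distance of scales, wherever their
  centres are. So at each \<open>h\<close> the sum behaves like boundedly many bumps, and
  integrating the kernel of each bump separately gives \<open>N\<close> times a constant.\<close>

lemma energy_lacunary_le:
  "\<exists>C>0. \<forall>N (x :: nat \<Rightarrow> 'a) \<rho> L. 0 < \<rho> \<longrightarrow> 2 \<le> L \<longrightarrow>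
     E (\<lambda>y. \<Sum>j<N. bump (x j) (\<rho> * L ^ j) y) \<le> ennreal (C * real N)"
proof -
  define n where "n = DIM('a)"
  obtain C0 where C0: "C0 > 0" "\<forall>(c::'a) \<rho> h. 0 < \<rho> \<longrightarrow>
     shift_energy p (bump c \<rho>) h \<le> ennreal (C0 * norm h ^ DIM('a) * mu (norm h / \<rho>) powr (p * eta))"
    using shift_energy_bump by (elim exE conjE) (rule that)
  note C0 = C0(1) C0(2)[rule_format, folded n_def]
  \<comment> \<open>Each of two uses of \<open>powr_sum_le\<close> spends half of the available
    decay on summable weights: the exponent \<open>p * eta\<close> drops to
    \<open>p * eta / 2\<close> when the increments are summed, then to \<open>p * eta / 4\<close>
    when the power \<open>q / p\<close> is taken, which turns it into
    \<open>q * eta / 4\<close>.\<close>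
  define a where "a = q * eta / 4"
  have a: "0 < a" using q eta by (simp add: a_def)
  obtain C1 where C1: "C1 > 0" "\<forall>\<rho>>0.
     (\<integral>\<^sup>+ h. ennreal (mu (norm h / \<rho>) powr a / norm h ^ DIM('a)) \<partial>(lborel :: 'a measure)) \<le> ennreal C1"
    using nn_integral_mu_kernel[OF a, where 'a='a] by (elim exE conjE) (rule that)
  note C1 = C1(1) C1(2)[rule_format, folded n_def]
  define W where "W b = 2 / (1 - 2 powr - b)" for b :: real
  have W: "0 < W b" if "0 < b" for b using that by (simp add: W_def powr_less_one)
  have pe: "0 < p * eta" using p_gt_0 eta by simp
  define C where "C = (W (eta / 2) powr p * C0) powr (q / p) * W (p * eta / 4) powr (q / p) * C1"
  have main: "E (\<lambda>y. \<Sum>j<N. bump (x j) (\<rho> * L ^ j) y) \<le> ennreal (C * real N)"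
    if \<rho>: "0 < \<rho>" and L: "2 \<le> L" for N x \<rho> L
  proof -
    define r where "r j = \<rho> * L ^ j" for j
    have r: "0 < r j" for j using \<rho> L by (simp add: r_def)
    define F where "F = (\<lambda>y. \<Sum>j<N. bump (x j) (r j) y)"
    have bm [measurable]: "bump c \<rho> \<in> borel_measurable borel" for c :: 'a and \<rho>
      by (rule borel_measurable_continuous_onI) (rule continuous_bump)
    define m where "m j h = mu (norm h / r j)" for j and h :: 'a
    have m_sum: "(\<Sum>j<N. m j h powr b) \<le> W b" if "h \<noteq> 0" "0 < b" for h b
      using sum_mu_lacunary[OF L that(2), of "norm h / \<rho>" N] that \<rho> by (simp add: m_def r_def W_def)
    have m0: "0 < m j h" if "h \<noteq> 0" for j h
      unfolding m_def using that r by (intro mu_pos) auto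
    define g where "g h = W (eta / 2) powr p * C0 * (\<Sum>j<N. m j h powr (p * eta / 2))" for h
    have g0: "0 \<le> g h" for h using C0(1) by (simp add: g_def sum_nonneg)
    have sh: "shift_energy p F h \<le> ennreal (norm h ^ DIM('a) * g h)" if h: "h \<noteq> 0" for h
    proof -
      define v where "v j = m j h powr (eta / 2)" for j
      have v: "0 < v j" for j using m0[OF h, of j] by (simp add: v_def)
      have pw: "\<bar>F (y + h) - F y\<bar> powr p \<le> W (eta / 2) powr p * (\<Sum>j<N. v j powr - p * \<bar>bump (x j) (r j) (y + h) - bump (x j) (r j) y\<bar> powr p)" for y
      proof -
        define d where "d j = \<bar>bump (x j) (r j) (y + h) - bump (x j) (r j) y\<bar>" for j
        have "\<bar>F (y + h) - F y\<bar> \<le> (\<Sum>j<N. d j)"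
          unfolding F_def d_def by (simp add: sum_abs flip: sum_subtractf)
        then have "\<bar>F (y + h) - F y\<bar> powr p \<le> (\<Sum>j<N. d j) powr p"
          using p_gt_0 by (intro powr_mono2) auto
        also have "\<dots> \<le> (\<Sum>j<N. v j) powr p * (\<Sum>j<N. (d j / v j) powr p)"
          using v p_gt_0 by (intro powr_sum_le) (auto simp: d_def)
        also have "\<dots> \<le> W (eta / 2) powr p * (\<Sum>j<N. (d j / v j) powr p)"
        proof (intro mult_right_mono powr_mono2 sum_nonneg)
          show "0 \<le> v j" for j using v[of j] by simp
          show "(\<Sum>j<N. v j) \<le> W (eta / 2)" unfolding v_def using eta by (intro m_sum h) auto
        qed (use p_gt_0 in auto)
        also have "(\<Sum>j<N. (d j / v j) powr p) = (\<Sum>j<N. v j powr - p * d j powr p)"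
          using v by (intro sum.cong refl) (simp add: powr_divide powr_minus d_def less_imp_le field_simps)
        finally show ?thesis by (simp add: d_def)
      qed
      have "shift_energy p F h \<le> (\<integral>\<^sup>+ y. ennreal (W (eta / 2) powr p) * (\<Sum>j<N. ennreal (v j powr - p) * ennreal (\<bar>bump (x j) (r j) (y + h) - bump (x j) (r j) y\<bar> powr p)) \<partial>lborel)"
        unfolding shift_energy_def
        by (rule nn_integral_mono) (simp add: pw ennreal_leI sum_nonneg flip: ennreal_mult)
      also have "\<dots> = ennreal (W (eta / 2) powr p) * (\<Sum>j<N. ennreal (v j powr - p) * shift_energy p (bump (x j) (r j)) h)"
        unfolding shift_energy_def by (subst nn_integral_cmult) (auto simp: nn_integral_sum nn_integral_cmult simp del: sum_ennreal)
      also have "\<dots> \<le> ennreal (W (eta / 2) powr p) * (\<Sum>j<N. ennreal (v j powr - p) * ennreal (C0 * norm h ^ n * m j h powr (p * eta)))"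
        unfolding m_def by (intro mult_left_mono sum_mono C0(2) r) auto
      also have "\<dots> = ennreal (W (eta / 2) powr p * (\<Sum>j<N. v j powr - p * (C0 * norm h ^ n * m j h powr (p * eta))))"
        using C0(1) by (simp add: sum_nonneg flip: ennreal_mult)
      also have "(\<Sum>j<N. v j powr - p * (C0 * norm h ^ n * m j h powr (p * eta))) = C0 * norm h ^ n * (\<Sum>j<N. m j h powr (p * eta / 2))"
      proof -
        have "v j powr - p * m j h powr (p * eta) = m j h powr (p * eta / 2)" for j
          by (simp add: v_def powr_powr flip: powr_add)
        then show ?thesis by (simp add: sum_distrib_left mult_ac)
      qed
      finally show ?thesis by (simp add: g_def n_def mult_ac)
    qed
    have "E F \<le> (\<integral>\<^sup>+ h. ennreal (g h powr (q / p) / norm h ^ n) \<partial>lborel)"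
      unfolding n_def by (intro energy_le_of_shift_energy_le sh g0)
    also have "\<dots> \<le> (\<integral>\<^sup>+ h. ennreal ((W (eta / 2) powr p * C0) powr (q / p) * W (p * eta / 4) powr (q / p)) *
        (\<Sum>j<N. ennreal (mu (norm h / r j) powr a / norm h ^ n)) \<partial>(lborel :: 'a measure))"
    proof (rule nn_integral_mono)
      fix h :: 'a
      show "ennreal (g h powr (q / p) / norm h ^ n) \<le> ennreal ((W (eta / 2) powr p * C0) powr (q / p) * W (p * eta / 4) powr (q / p)) *
        (\<Sum>j<N. ennreal (mu (norm h / r j) powr a / norm h ^ n))"
      proof (cases "h = 0")
        case False
        have "(\<Sum>j<N. m j h powr (p * eta / 2)) powr (q / p)
          \<le> (\<Sum>j<N. m j h powr (p * eta / 4)) powr (q / p) * (\<Sum>j<N. (m j h powr (p * eta / 2) / m j h powr (p * eta / 4)) powr (q / p))"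
          using m0[OF False] q p_gt_0 by (intro powr_sum_le) (auto simp: less_le)
        also have "\<dots> \<le> W (p * eta / 4) powr (q / p) * (\<Sum>j<N. (m j h powr (p * eta / 2) / m j h powr (p * eta / 4)) powr (q / p))"
          using q p_gt_0 pe by (intro mult_right_mono powr_mono2 m_sum False sum_nonneg) auto
        also have "(\<Sum>j<N. (m j h powr (p * eta / 2) / m j h powr (p * eta / 4)) powr (q / p)) = (\<Sum>j<N. m j h powr a)"
          using p_gt_0 by (intro sum.cong refl) (simp add: a_def powr_powr field_simps flip: powr_diff)
        finally have "g h powr (q / p) \<le> (W (eta / 2) powr p * C0) powr (q / p) * (W (p * eta / 4) powr (q / p) * (\<Sum>j<N. m j h powr a))"
          unfolding g_def using C0(1) by (subst powr_mult) (auto intro!: mult_left_mono sum_nonneg)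
        then have "g h powr (q / p) / norm h ^ n \<le> (W (eta / 2) powr p * C0) powr (q / p) * (W (p * eta / 4) powr (q / p) * (\<Sum>j<N. m j h powr a)) / norm h ^ n"
          by (intro divide_right_mono) auto
        also have "\<dots> = (W (eta / 2) powr p * C0) powr (q / p) * W (p * eta / 4) powr (q / p) * (\<Sum>j<N. m j h powr a / norm h ^ n)"
          by (simp add: sum_divide_distrib[symmetric])
        finally show ?thesis
          by (simp add: m_def ennreal_leI sum_nonneg flip: ennreal_mult)
      qed (use q p_gt_0 in \<open>simp add: power_0_left n_def\<close>)
    qed
    also have "\<dots> = ennreal ((W (eta / 2) powr p * C0) powr (q / p) * W (p * eta / 4) powr (q / p)) *
        (\<Sum>j<N. \<integral>\<^sup>+ h. ennreal (mu (norm h / r j) powr a / norm h ^ n) \<partial>(lborel :: 'a measure))"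
      by (subst nn_integral_cmult) (auto simp: nn_integral_sum simp del: sum_ennreal)
    also have "\<dots> \<le> ennreal ((W (eta / 2) powr p * C0) powr (q / p) * W (p * eta / 4) powr (q / p)) * (\<Sum>j<N. ennreal C1)"
      by (intro mult_left_mono sum_mono C1(2) r) auto
    also have "\<dots> = ennreal (C * real N)"
      using C1(1) by (simp add: C_def mult_ac ennreal_of_nat_eq_real_of_nat flip: ennreal_mult)
    finally show ?thesis by (simp add: F_def r_def)
  qed
  have C: "C > 0" using C0(1) C1(1) W[of "eta / 2"] W[of "p * eta / 4"] eta pe by (simp add: C_def)
  show ?thesis
    by (intro exI[of _ C] conjI allI impI C main)
qed

end

subsection \<open>Weak quasisymmetry\<close>

text \<open>Quasisymmetry without the requirement that \<open>H\<close> tend to 0 with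
  \<open>T\<close>.\<close>

definition weak_qs :: "('a::metric_space \<Rightarrow> 'b::metric_space) \<Rightarrow> bool" where
  "weak_qs g \<longleftrightarrow> (\<forall>T>0. \<exists>H>0. \<forall>x y z. dist x y \<le> T * dist x z \<longrightarrow> dist (g x) (g y) \<le> H * dist (g x) (g z))"

lemma weak_qsE:
  assumes "weak_qs g" "0 < T"
  obtains H where "0 < H" "\<And>x y z. dist x y \<le> T * dist x z \<Longrightarrow> dist (g x) (g y) \<le> H * dist (g x) (g z)"
  using assms unfolding weak_qs_def by blast

text \<open>Cut the segment from \<open>x\<close> to \<open>y\<close> into steps of length at most
  \<open>dist x z / (2 * M)\<close>. Every subdivision point is at distance at least half of
  \<open>dist x z\<close> from \<open>x\<close> or from \<open>z\<close>, so the image of the next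
  step is no longer than the image distance to one of these two points.\<close>

lemma weak_qs_chain:
  fixes g :: "'a::real_normed_vector \<Rightarrow> 'b::metric_space"
  assumes "0 < M" and M: "\<And>x y z. M * dist x y \<le> dist x z \<Longrightarrow> dist (g x) (g y) \<le> dist (g x) (g z)"
  shows "weak_qs g"
  unfolding weak_qs_def
proof (intro allI impI)
  fix T :: real assume "0 < T"
  obtain N :: nat where N: "2 * M * T \<le> real N" using real_arch_simple by blast
  then have N0: "0 < real N" using mult_pos_pos[OF assms(1) \<open>0 < T\<close>] by linarith
  have "dist (g x) (g y) \<le> 2 ^ N * dist (g x) (g z)" if xyz: "dist x y \<le> T * dist x z" for x y z
  proof -
    define w where "w i = x + (real i / real N) *\<^sub>R (y - x)" for i
    have w: "w 0 = x" "w N = y" using N0 by (simp_all add: w_def)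
    have step: "dist (w i) (w (Suc i)) = dist x y / real N" for i
    proof -
      have "w i - w (Suc i) = (1 / real N) *\<^sub>R (x - y)"
        by (simp add: w_def algebra_simps add_divide_distrib)
      then show ?thesis using N0 by (simp add: dist_norm)
    qed
    have "2 * M * dist x y \<le> (2 * M * T) * dist x z"
      using mult_left_mono[OF xyz, of "2 * M"] assms(1) by (simp add: mult_ac)
    also have "\<dots> \<le> real N * dist x z" using N by (intro mult_right_mono) auto
    finally have small: "M * (dist x y / real N) \<le> dist x z / 2" using N0 by (simp add: field_simps)
    \<comment> \<open>Each step at most doubles the distance and adds
      \<open>dist (g x) (g z)\<close>; the \<open>- 1\<close> solves this recursion exactly.\<close>
    have "dist (g x) (g (w i)) \<le> (2 ^ i - 1) * dist (g x) (g z)" for i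
    proof (induction i)
      case 0
      then show ?case by (simp add: w)
    next
      case (Suc i)
      have "dist x z / 2 \<le> dist (w i) x \<or> dist x z / 2 \<le> dist (w i) z"
        using dist_triangle3[of x z "w i"] by linarith
      then have "dist (g (w i)) (g (w (Suc i))) \<le> dist (g (w i)) (g x) \<or> dist (g (w i)) (g (w (Suc i))) \<le> dist (g (w i)) (g z)"
        using M[of "w i" "w (Suc i)" x] M[of "w i" "w (Suc i)" z] small unfolding step by linarith
      moreover have "dist (g (w i)) (g z) \<le> dist (g x) (g (w i)) + dist (g x) (g z)"
        by (rule dist_triangle3)
      ultimately have "dist (g (w i)) (g (w (Suc i))) \<le> dist (g x) (g (w i)) + dist (g x) (g z)"
        using zero_le_dist[of "g x" "g z"] dist_commute[of "g x" "g (w i)"] by linarith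
      moreover have "dist (g x) (g (w (Suc i))) \<le> dist (g x) (g (w i)) + dist (g (w i)) (g (w (Suc i)))"
        by (rule dist_triangle)
      ultimately show ?case using Suc.IH by (simp add: algebra_simps)
    qed
    from this[of N] have "dist (g x) (g y) \<le> 2 ^ N * dist (g x) (g z) - dist (g x) (g z)"
      by (simp add: w left_diff_distrib)
    then show ?thesis using zero_le_dist[of "g x" "g z"] by linarith
  qed
  then show "\<exists>H>0. \<forall>x y z. dist x y \<le> T * dist x z \<longrightarrow> dist (g x) (g y) \<le> H * dist (g x) (g z)"
    by (intro exI[of _ "2 ^ N"]) auto
qed

section \<open>Homogeneity of the energy and rings of small energy\<close>

lemma shift_energy_cmult:
  assumes "f \<in> borel_measurable borel"
  shows "shift_energy p (\<lambda>y. c * f y) h = ennreal (\<bar>c\<bar> powr p) * shift_energy p f h"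
proof -
  note [measurable] = assms
  have "shift_energy p (\<lambda>y. c * f y) h = (\<integral>\<^sup>+ x. ennreal (\<bar>c\<bar> powr p) * ennreal (\<bar>f (x + h) - f x\<bar> powr p) \<partial>lborel)"
    unfolding shift_energy_def
    by (simp add: powr_mult abs_mult flip: right_diff_distrib ennreal_mult)
  also have "\<dots> = ennreal (\<bar>c\<bar> powr p) * shift_energy p f h"
    unfolding shift_energy_def by (rule nn_integral_cmult) measurable
  finally show ?thesis .
qed

context besov_exponents
begin

lemma besov_energy_cmult:
  assumes "f \<in> borel_measurable borel"
  shows "E (\<lambda>y. c * f y) = ennreal (\<bar>c\<bar> powr q) * E f"
proof -
  define I where "I = shift_energy p f"
  have [measurable]: "I \<in> borel_measurable borel" unfolding I_def using assms by (rule measurable_shift_energy)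
  have "E (\<lambda>y. c * f y) = (\<integral>\<^sup>+ h. ennreal (\<bar>c\<bar> powr q) * (ennreal (norm h powr - (q * s) / norm h ^ DIM('a)) * ennpowr (shift_energy p f h) (q / p)) \<partial>lborel)"
    unfolding besov_energy_def shift_energy_cmult[OF assms] using p_gt_0
    by (simp add: ennpowr_mult ennpowr_ennreal powr_powr mult_ac)
  also have "\<dots> = ennreal (\<bar>c\<bar> powr q) * E f"
    unfolding besov_energy_def I_def[symmetric] by (rule nn_integral_cmult) measurable
  finally show ?thesis .
qed

text \<open>Averaging \<open>N\<close> concentric bumps of geometric radii gives energy of order \<open>N\<^sup>1\<^sup>-\<^sup>q\<close>; this uses \<open>q > 1\<close>.\<close>

lemma ring_of_small_energy:
  assumes "0 < \<epsilon>"
  shows "\<exists>M>0. \<forall>(c::'a) \<rho>. 0 < \<rho> \<longrightarrow> (\<exists>f. continuous_on UNIV f \<and> (\<forall>x. dist c x \<le> \<rho> \<longrightarrow> f x = 1) \<and>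
     (\<forall>x. M * \<rho> \<le> dist c x \<longrightarrow> f x = 0) \<and> E f \<le> ennreal \<epsilon>)"
proof -
  obtain C where C: "0 < C" "\<forall>N (x :: nat \<Rightarrow> 'a) \<rho> L. 0 < \<rho> \<longrightarrow> 2 \<le> L \<longrightarrow>
     E (\<lambda>y. \<Sum>j<N. bump (x j) (\<rho> * L ^ j) y) \<le> ennreal (C * real N)"
    using energy_lacunary_le by (elim exE conjE) (rule that)
  have "(\<lambda>N. C * real N powr (1 - q)) \<longlonglongrightarrow> 0" using q by real_asymp
  from order_tendstoD(2)[OF this assms] obtain N0 where N0: "\<forall>N\<ge>N0. C * real N powr (1 - q) < \<epsilon>"
    by (auto simp: eventually_sequentially)
  obtain N where N: "0 < N" "C * real N powr (1 - q) < \<epsilon>"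
    using N0[rule_format, of "Suc N0"] by (intro that[of "Suc N0"]) auto
  \<comment> \<open>The largest of the \<open>N\<close> bumps has radius
    \<open>2 ^ (N - 1) * \<rho>\<close> and vanishes from twice that radius on, hence the outer
    radius \<open>2 ^ N * \<rho>\<close>.\<close>
  have "\<exists>f. continuous_on UNIV f \<and> (\<forall>x. dist c x \<le> \<rho> \<longrightarrow> f x = 1) \<and>
     (\<forall>x. 2 ^ N * \<rho> \<le> dist c x \<longrightarrow> f x = 0) \<and> E f \<le> ennreal \<epsilon>" if \<rho>: "0 < \<rho>" for c :: 'a and \<rho>
  proof -
    define F where "F y = (\<Sum>j<N. bump c (\<rho> * 2 ^ j) y)" for y
    define f where "f y = (1 / real N) * F y" for y
    have F: "continuous_on UNIV F" unfolding F_def[abs_def] by (intro continuous_intros)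
    have "continuous_on UNIV f" unfolding f_def[abs_def] by (intro continuous_intros F)
    moreover have "f x = 1" if "dist c x \<le> \<rho>" for x
    proof -
      have "bump c (\<rho> * 2 ^ j) x = 1" for j :: nat
      proof (rule bump_eq_1)
        have "\<rho> * 1 \<le> \<rho> * 2 ^ j" using \<rho> by (intro mult_left_mono) auto
        then show "dist c x \<le> \<rho> * 2 ^ j" using that by linarith
      qed (use \<rho> in simp)
      then show ?thesis using N(1) by (simp add: f_def F_def)
    qed
    moreover have "f x = 0" if "2 ^ N * \<rho> \<le> dist c x" for x
    proof -
      have "bump c (\<rho> * 2 ^ j) x = 0" if j: "j < N" for j :: nat
      proof (rule bump_eq_0)
        have "(2::real) ^ Suc j \<le> 2 ^ N" using j by (intro power_increasing) auto
        then have "2 ^ Suc j * \<rho> \<le> 2 ^ N * \<rho>" using \<rho> by (intro mult_right_mono) auto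
        then show "2 * (\<rho> * 2 ^ j) \<le> dist c x" using \<open>2 ^ N * \<rho> \<le> dist c x\<close> by (simp add: mult_ac)
      qed (use \<rho> in simp)
      then show ?thesis by (simp add: f_def F_def)
    qed
    moreover have "E f \<le> ennreal \<epsilon>"
    proof -
      have "E f = ennreal (\<bar>1 / real N\<bar> powr q) * E F"
        unfolding f_def[abs_def] by (rule besov_energy_cmult) (rule borel_measurable_continuous_onI[OF F])
      also have "\<dots> \<le> ennreal (\<bar>1 / real N\<bar> powr q) * ennreal (C * real N)"
        unfolding F_def[abs_def] using C(2)[rule_format, of \<rho> 2 "\<lambda>_. c" N] \<rho> by (intro mult_left_mono) auto
      also have "\<dots> = ennreal (C * real N powr (1 - q))"
        using N(1) C(1) by (simp add: powr_divide powr_diff mult_ac flip: ennreal_mult)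
      also have "\<dots> \<le> ennreal \<epsilon>" using N(2) by (intro ennreal_leI) simp
      finally show ?thesis .
    qed
    ultimately show ?thesis by blast
  qed
  then show ?thesis by (intro exI[of _ "2 ^ N"]) auto
qed

text \<open>On a ball of shifts of radius \<open>t j\<close>, at distance from 0 comparable with
  \<open>t j\<close>, the weight times the volume is scale invariant, so each ball contributes a
  multiple of \<open>M powr (q / p)\<close> whatever its size, and disjoint balls add up. One ball
  with \<open>M = N\<close> and \<open>N\<close> balls with \<open>M = 1\<close> are the two cases
  in which this is used.\<close>

lemma energy_lower_bound:
  assumes K: "0 < K"
  shows "\<exists>c>0. \<forall>f\<in>borel_measurable borel. \<forall>(H :: nat set) (a :: nat \<Rightarrow> 'a) t M.
     finite H \<longrightarrow> 0 \<le> M \<longrightarrow> disjoint_family_on (\<lambda>j. cball (a j) (t j)) H \<longrightarrow>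
     (\<forall>j\<in>H. 0 < t j \<and> t j < norm (a j) \<and> norm (a j) \<le> K * t j) \<longrightarrow>
     (\<forall>j\<in>H. \<forall>h\<in>cball (a j) (t j).
        ennreal (M * (unit_ball_vol (real DIM('a)) * t j ^ DIM('a))) \<le> shift_energy p f h) \<longrightarrow>
     ennreal (c * real (card H) * M powr (q / p)) \<le> E f"
proof -
  define n where "n = DIM('a)"
  define w where "w = unit_ball_vol (real n)"
  have w: "w > 0" by (simp add: w_def)
  define c where "c = (K + 1) powr (- (q * s)) / (K + 1) ^ n * w powr (q / p) * w"
  have c: "0 < c" using K w by (simp add: c_def)
  have main: "ennreal (c * real (card H) * M powr (q / p)) \<le> E f"
    if f: "f \<in> borel_measurable borel" and H: "finite H" and M: "0 \<le> M" and disj: "disjoint_family_on (\<lambda>j. cball (a j) (t j)) H"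
     and t: "\<forall>j\<in>H. 0 < t j \<and> t j < norm (a j) \<and> norm (a j) \<le> K * t j"
     and low: "\<forall>j\<in>H. \<forall>h\<in>cball (a j) (t j). ennreal (M * (w * t j ^ n)) \<le> shift_energy p f h"
    for f and H :: "nat set" and a :: "nat \<Rightarrow> 'a" and t M
  proof -
    \<comment> \<open>The value of the integrand that is guaranteed on the ball \<open>j\<close>,
      where \<open>norm h \<le> (K + 1) * t j\<close>; multiplied by the volume of that ball it no
      longer depends on \<open>j\<close>.\<close>
    define k where "k j = (K + 1) powr (- (q * s)) / (K + 1) ^ n * w powr (q / p) * M powr (q / p) / t j ^ n" for j
    have t0: "0 < t j" if "j \<in> H" for j using t that by blast
    have k: "0 \<le> k j" if "j \<in> H" for j using K w t0[OF that] by (simp add: k_def)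
    have "ennreal (c * real (card H) * M powr (q / p)) = (\<Sum>j\<in>H. ennreal (c * M powr (q / p)))"
      using c by (simp add: ennreal_mult ennreal_of_nat_eq_real_of_nat mult_ac)
    also have "\<dots> = (\<Sum>j\<in>H. ennreal (k j) * emeasure lborel (cball (a j) (t j)))"
    proof (rule sum.cong[OF refl])
      fix j assume j: "j \<in> H"
      have "c * M powr (q / p) = k j * (w * t j ^ n)" using t0[OF j] by (simp add: k_def c_def)
      then show "ennreal (c * M powr (q / p)) = ennreal (k j) * emeasure lborel (cball (a j) (t j))"
        using t0[OF j] k[OF j] w by (simp add: emeasure_lborel_cball w_def[symmetric] n_def[symmetric] less_imp_le flip: ennreal_mult)
    qed
    also have "\<dots> = (\<Sum>j\<in>H. \<integral>\<^sup>+ h. ennreal (k j) * indicator (cball (a j) (t j)) h \<partial>lborel)"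
      by (simp add: nn_integral_cmult_indicator)
    also have "\<dots> = (\<integral>\<^sup>+ h. (\<Sum>j\<in>H. ennreal (k j) * indicator (cball (a j) (t j)) h) \<partial>lborel)"
      by (intro nn_integral_sum[symmetric] borel_measurable_times_ennreal borel_measurable_indicator) auto
    also have "\<dots> \<le> E f"
      unfolding besov_energy_def
    proof (rule nn_integral_mono)
      fix h :: 'a
      show "(\<Sum>j\<in>H. ennreal (k j) * indicator (cball (a j) (t j)) h)
         \<le> ennreal (norm h powr - (q * s) / norm h ^ DIM('a)) * ennpowr (shift_energy p f h) (q / p)"
      proof (cases "\<exists>i\<in>H. h \<in> cball (a i) (t i)")
        case True
        then obtain i where i: "i \<in> H" "h \<in> cball (a i) (t i)" by blast
        have "h \<notin> cball (a j) (t j)" if "j \<in> H - {i}" for j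
          using disj i that unfolding disjoint_family_on_def by blast
        then have "(\<Sum>j\<in>H. ennreal (k j) * indicator (cball (a j) (t j)) h) = ennreal (k i)"
          using H i by (subst sum.remove[OF H i(1)]) (simp add: sum.neutral)
        also have "\<dots> \<le> ennreal (norm h powr - (q * s) / norm h ^ n * (M * (w * t i ^ n)) powr (q / p))"
        proof (rule ennreal_leI)
          have ti: "0 < t i" using t i by auto
          have nh: "norm h \<le> (K + 1) * t i" "0 < norm h"
          proof -
            have "norm (a i - h) \<le> t i" using i(2) by (simp add: dist_norm)
            then show "norm h \<le> (K + 1) * t i" "0 < norm h"
              using norm_triangle_ineq2[of "a i" h] norm_triangle_ineq2[of h "a i"] t i(1)
              by (auto simp: algebra_simps norm_minus_commute)
          qed
          have tn: "(t i ^ n) powr (q / p) = t i powr (q * s)"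
          proof -
            have "t i ^ n = t i powr (p * s)" using ti ps by (simp add: n_def powr_realpow)
            then show ?thesis using p_gt_0 by (simp add: powr_powr mult.commute)
          qed
          have "k i = ((K + 1) * t i) powr - (q * s) / ((K + 1) * t i) ^ n * (M * (w * t i ^ n)) powr (q / p)"
          proof -
            have "((K + 1) * t i) powr - (q * s) = (K + 1) powr - (q * s) * t i powr - (q * s)"
              by (rule powr_mult)
            moreover have "(M * (w * t i ^ n)) powr (q / p) = M powr (q / p) * (w powr (q / p) * t i powr (q * s))"
              using M w ti by (simp add: powr_mult tn)
            ultimately have "((K + 1) * t i) powr - (q * s) / ((K + 1) * t i) ^ n * (M * (w * t i ^ n)) powr (q / p)
                = k i * (t i powr - (q * s) * t i powr (q * s))"
              by (simp add: k_def power_mult_distrib)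
            moreover have "t i powr - (q * s) * t i powr (q * s) = 1" using ti by (simp add: powr_minus)
            ultimately show ?thesis by (simp only: mult_1_right)
          qed
          also have "\<dots> \<le> norm h powr - (q * s) / norm h ^ n * (M * (w * t i ^ n)) powr (q / p)"
          proof (intro mult_right_mono frac_le power_mono)
            show "((K + 1) * t i) powr - (q * s) \<le> norm h powr - (q * s)"
              using nh q s by (intro powr_mono2') auto
          qed (use nh in auto)
          finally show "k i \<le> norm h powr - (q * s) / norm h ^ n * (M * (w * t i ^ n)) powr (q / p)" .
        qed
        also have "\<dots> = ennreal (norm h powr - (q * s) / norm h ^ n) * ennpowr (ennreal (M * (w * t i ^ n))) (q / p)"
          using M w t0[OF i(1)] by (simp add: ennpowr_ennreal less_imp_le flip: ennreal_mult)
        also have "\<dots> \<le> ennreal (norm h powr - (q * s) / norm h ^ n) * ennpowr (shift_energy p f h) (q / p)"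
          using low i q p_gt_0 by (intro mult_left_mono ennpowr_mono) auto
        finally show ?thesis by (simp add: n_def)
      next
        case False
        then have "(\<Sum>j\<in>H. ennreal (k j) * indicator (cball (a j) (t j)) h) = 0" by (intro sum.neutral) auto
        then show ?thesis by simp
      qed
    qed
    finally show ?thesis .
  qed
  show ?thesis
    by (intro exI[of _ c] conjI ballI allI impI c) (rule main[unfolded w_def n_def])
qed

text \<open>Each ball contributes its volume because the integrand is at least 1 there, and
  disjointness lets the volumes add.\<close>

lemma shift_energy_lower_bound:
  fixes f :: "'a \<Rightarrow> real" and x :: "'i \<Rightarrow> 'a"
  assumes f: "f \<in> borel_measurable borel" and J: "finite J" and r: "0 \<le> r"
    and disj: "disjoint_family_on (\<lambda>j. cball (x j) r) J"
    and jump: "\<And>j u. j \<in> J \<Longrightarrow> u \<in> cball (x j) r \<Longrightarrow> 1 \<le> \<bar>f (u + h) - f u\<bar>"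
  shows "ennreal (real (card J) * (unit_ball_vol (real DIM('a)) * r ^ DIM('a))) \<le> shift_energy p f h"
proof -
  define w where "w = unit_ball_vol (real DIM('a)) * r ^ DIM('a)"
  have w: "0 \<le> w" using r by (simp add: w_def)
  have "emeasure lborel (cball (x j) r) = ennreal w" for j
    using r by (simp add: emeasure_lborel_cball w_def)
  then have "ennreal (real (card J) * w) = (\<Sum>j\<in>J. emeasure lborel (cball (x j) r))"
    using w by (simp add: ennreal_mult ennreal_of_nat_eq_real_of_nat)
  also have "\<dots> = (\<integral>\<^sup>+ u. (\<Sum>j\<in>J. indicator (cball (x j) r) u) \<partial>lborel)"
    by (subst nn_integral_sum) (auto intro!: borel_measurable_indicator)
  also have "\<dots> \<le> shift_energy p f h"
    unfolding shift_energy_def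
  proof (rule nn_integral_mono)
    fix u
    show "(\<Sum>j\<in>J. indicator (cball (x j) r) u) \<le> ennreal (\<bar>f (u + h) - f u\<bar> powr p)"
    proof (cases "\<exists>i\<in>J. u \<in> cball (x i) r")
      case True
      then obtain i where i: "i \<in> J" "u \<in> cball (x i) r" by blast
      have "u \<notin> cball (x j) r" if "j \<in> J - {i}" for j
        using disj i that unfolding disjoint_family_on_def by blast
      then have "(\<Sum>j\<in>J. indicator (cball (x j) r) u) = (1::ennreal)"
        using J i by (subst sum.remove[OF J i(1)]) (simp add: sum.neutral)
      also have "\<dots> \<le> ennreal (\<bar>f (u + h) - f u\<bar> powr p)"
        using ge_one_powr_ge_zero[OF jump[OF i], of p] p_gt_0 by (simp flip: ennreal_1)
      finally show ?thesis .
    next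
      case False
      then have "(\<Sum>j\<in>J. indicator (cball (x j) r) u) = (0::ennreal)" by (intro sum.neutral) auto
      then show ?thesis by simp
    qed
  qed
  finally show ?thesis by (simp add: w_def)
qed

end

subsection \<open>Comparison of scales\<close>

definition scale_comparable :: "('a::metric_space \<Rightarrow> 'b::metric_space) \<Rightarrow> bool" where
  "scale_comparable g \<longleftrightarrow>
     (\<exists>Q>0. \<forall>x y x' y'. dist x y \<le> dist x' y' \<longrightarrow> dist (g x) (g y) \<le> Q * dist (g x') (g y'))"

definition unit_dir :: "'a::euclidean_space" where
  "unit_dir = (SOME e. e \<in> Basis)"

lemma norm_unit_dir [simp]: "norm (unit_dir :: 'a::euclidean_space) = 1"
proof -
  have "(unit_dir :: 'a) \<in> Basis" unfolding unit_dir_def by (rule someI_ex) (use nonempty_Basis in blast)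
  then show ?thesis by simp
qed

text \<open>Stands for the size of the image of the ball of radius \<open>u\<close> about
  \<open>x\<close>. Fixing one direction makes it plainly continuous in \<open>x\<close>, as the
  intermediate value argument requires, and for weakly quasisymmetric maps other directions give
  comparable values.\<close>

definition stretch :: "('a::euclidean_space \<Rightarrow> 'b::metric_space) \<Rightarrow> real \<Rightarrow> 'a \<Rightarrow> real" where
  "stretch g u x = dist (g x) (g (x + u *\<^sub>R unit_dir))"

lemma dist_shift_unit_dir [simp]: "dist x (x + u *\<^sub>R unit_dir) = \<bar>u\<bar>"
  by (simp add: dist_norm)

lemma stretch_pos:
  assumes "inj g" "0 < u"
  shows "0 < stretch g u x"
proof -
  have "x + u *\<^sub>R unit_dir \<noteq> x" using assms(2) dist_shift_unit_dir[of x u] by (metis abs_zero dist_self less_irrefl abs_eq_0)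
  then show ?thesis using assms(1) by (auto simp: stretch_def dest: injD)
qed

text \<open>Both endpoints of the segment at \<open>y\<close> lie within \<open>(S + 1) * u\<close>
  of \<open>x\<close>, hence their images within \<open>H * stretch g u x\<close> of
  \<open>g x\<close>.\<close>

lemma stretch_comparable:
  assumes "weak_qs g" "0 \<le> S"
  shows "\<exists>\<Lambda>>0. \<forall>u>0. \<forall>x y. dist x y \<le> S * u \<longrightarrow> stretch g u y \<le> \<Lambda> * stretch g u x"
proof -
  obtain H where H: "0 < H" "\<And>x y z. dist x y \<le> (S + 1) * dist x z \<Longrightarrow> dist (g x) (g y) \<le> H * dist (g x) (g z)"
    using weak_qsE[OF assms(1), of "S + 1"] assms(2) by auto
  have "stretch g u y \<le> 2 * H * stretch g u x" if u: "0 < u" "dist x y \<le> S * u" for u x y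
  proof -
    have "dist x (y + u *\<^sub>R unit_dir) \<le> dist x y + dist y (y + u *\<^sub>R unit_dir)" by (rule dist_triangle)
    then have "dist x (y + u *\<^sub>R unit_dir) \<le> (S + 1) * u" "dist x y \<le> (S + 1) * u"
      using u by (auto simp: algebra_simps)
    then have "dist (g x) (g (y + u *\<^sub>R unit_dir)) \<le> H * stretch g u x" "dist (g x) (g y) \<le> H * stretch g u x"
      unfolding stretch_def using u(1) by (auto intro!: H(2))
    then show ?thesis
      using dist_triangle3[of "g y" "g (y + u *\<^sub>R unit_dir)" "g x"] by (simp add: stretch_def)
  qed
  then show ?thesis using H(1) by (intro exI[of _ "2 * H"]) auto
qed

text \<open>Continuity of \<open>stretch g u\<close> realises every intermediate value. Separation
  comes for free: points closer than \<open>S * u\<close> have stretches of ratio at most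
  \<Lambda>0, while distinct chosen values differ by a factor of at least \<Lambda>.\<close>

lemma lacunary_stretch_points:
  fixes g :: "'a::euclidean_space \<Rightarrow> 'a"
  assumes g: "continuous_on UNIV g" "inj g" "weak_qs g" and S: "0 \<le> S"
  shows "\<exists>\<Lambda>\<ge>2. \<forall>N u x y. 0 < u \<longrightarrow> \<Lambda> ^ N * stretch g u y < stretch g u x \<longrightarrow>
    (\<exists>z. (\<forall>j<N. stretch g u (z j) = \<Lambda> ^ j * stretch g u y) \<and>
         (\<forall>i<N. \<forall>j<N. i \<noteq> j \<longrightarrow> S * u < dist (z i) (z j)))"
proof -
  obtain \<Lambda>0 where \<Lambda>0: "0 < \<Lambda>0" "\<And>u x y. 0 < u \<Longrightarrow> dist x y \<le> S * u \<Longrightarrow> stretch g u y \<le> \<Lambda>0 * stretch g u x"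
    using stretch_comparable[OF g(3) S] by blast
  \<comment> \<open>Adding 2 makes \<Lambda> strictly larger than \<Lambda>0, for the separation,
    and at least 2, for \<open>energy_lacunary_le\<close>.\<close>
  define \<Lambda> where "\<Lambda> = \<Lambda>0 + 2"
  have \<Lambda>: "2 \<le> \<Lambda>" "\<Lambda>0 < \<Lambda>" using \<Lambda>0(1) by (simp_all add: \<Lambda>_def)
  have "\<exists>z. (\<forall>j<N. stretch g u (z j) = \<Lambda> ^ j * stretch g u y) \<and>
         (\<forall>i<N. \<forall>j<N. i \<noteq> j \<longrightarrow> S * u < dist (z i) (z j))"
    if u: "0 < u" and big: "\<Lambda> ^ N * stretch g u y < stretch g u x" for N u x y
  proof -
    have pos: "0 < stretch g u x" for x using g(2) u by (rule stretch_pos)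
    have cont: "continuous_on UNIV (stretch g u)"
    proof -
      have "continuous_on UNIV (\<lambda>x. g (x + u *\<^sub>R unit_dir))"
        by (rule continuous_on_compose2[OF g(1)]) (auto intro!: continuous_intros)
      then show ?thesis unfolding stretch_def[abs_def] by (intro continuous_on_dist g(1))
    qed
    have "\<exists>z. stretch g u z = \<Lambda> ^ j * stretch g u y" if "j < N" for j
    proof -
      have conn: "connected (range (stretch g u))"
        using cont by (intro connected_continuous_image) auto
      have "\<Lambda> ^ j * stretch g u y \<le> \<Lambda> ^ N * stretch g u y"
        using that \<Lambda>(1) pos[of y] by (intro mult_right_mono power_increasing) auto
      then have hi: "\<Lambda> ^ j * stretch g u y \<le> stretch g u x" using big by linarith
      have "1 * stretch g u y \<le> \<Lambda> ^ j * stretch g u y"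
        using \<Lambda>(1) pos[of y] by (intro mult_right_mono one_le_power) auto
      then have lo: "stretch g u y \<le> \<Lambda> ^ j * stretch g u y" by simp
      have "\<Lambda> ^ j * stretch g u y \<in> range (stretch g u)"
        by (rule connectedD_interval[OF conn rangeI rangeI lo hi])
      then show ?thesis by auto
    qed
    then have "\<forall>j. \<exists>z. j < N \<longrightarrow> stretch g u z = \<Lambda> ^ j * stretch g u y" by blast
    from choice[OF this] obtain z where z: "\<And>j. j < N \<Longrightarrow> stretch g u (z j) = \<Lambda> ^ j * stretch g u y" by blast
    have lt: "S * u < dist (z i) (z j)" if ij: "i < j" "j < N" for i j
    proof (rule ccontr)
      assume "\<not> S * u < dist (z i) (z j)"
      then have "stretch g u (z j) \<le> \<Lambda>0 * stretch g u (z i)" using u by (intro \<Lambda>0(2)) auto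
      also have "\<dots> < \<Lambda> * stretch g u (z i)" using \<Lambda>(2) pos by (intro mult_strict_right_mono)
      also have "\<dots> = \<Lambda> ^ Suc i * stretch g u y" using z[of i] ij by simp
      also have "\<dots> \<le> \<Lambda> ^ j * stretch g u y"
        using ij \<Lambda>(1) pos[of y] by (intro mult_right_mono power_increasing) auto
      also have "\<dots> = stretch g u (z j)" using z[of j] ij by simp
      finally show False by simp
    qed
    have "S * u < dist (z i) (z j)" if "i < N" "j < N" "i \<noteq> j" for i j
      using lt[of i j] lt[of j i] that by (cases "i < j") (auto simp: dist_commute)
    with z show ?thesis by blast
  qed
  then show ?thesis using \<Lambda>(1) by blast
qed

text \<open>Weak quasisymmetry passes from an arbitrary pair to the fixed direction and back, with
  one change of base point in between.\<close>

lemma scale_comparable_of_stretch: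
  fixes g :: "'a::euclidean_space \<Rightarrow> 'b::metric_space"
  assumes g: "weak_qs g" and Q: "0 < Q" "\<And>u x y. 0 < u \<Longrightarrow> stretch g u x \<le> Q * stretch g u y"
  shows "scale_comparable g"
proof -
  obtain H where H: "0 < H" "\<And>x y z. dist x y \<le> 1 * dist x z \<Longrightarrow> dist (g x) (g y) \<le> H * dist (g x) (g z)"
    using weak_qsE[OF g, of 1] by auto
  have "dist (g x) (g y) \<le> (H * Q * H) * dist (g x') (g y')" if d: "dist x y \<le> dist x' y'" for x y x' y'
  proof (cases "dist x' y' = 0")
    case True
    then show ?thesis using d by simp
  next
    case False
    define u where "u = dist x' y'"
    have u: "0 < u" using False by (simp add: u_def)
    have "dist (g x) (g y) \<le> H * stretch g u x"
      unfolding stretch_def by (rule H(2)) (use d u in \<open>simp add: u_def\<close>)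
    also have "\<dots> \<le> H * (Q * stretch g u x')" using Q(2)[OF u] H(1) by (intro mult_left_mono) auto
    also have "\<dots> \<le> H * (Q * (H * dist (g x') (g y')))"
      unfolding stretch_def using H(1) Q(1) u by (intro mult_left_mono H(2)) (auto simp: u_def)
    finally show ?thesis by (simp add: mult_ac)
  qed
  moreover have "0 < H * Q * H" using H(1) Q(1) by simp
  ultimately show ?thesis unfolding scale_comparable_def by blast
qed

text \<open>The point \<open>z\<close> copies the distance \<open>dist (h a) (h b)\<close> to the
  base point \<open>h a'\<close>. Comparability of \<open>g\<close> bounds
  \<open>dist a' (g z)\<close> by \<open>Q * dist a' b'\<close>, and then all points involved share
  the base point \<open>a'\<close>, where weak quasisymmetry of \<open>h\<close> applies.\<close>

lemma scale_comparable_inverse: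
  fixes g h :: "'a::euclidean_space \<Rightarrow> 'a"
  assumes "scale_comparable g" "weak_qs h" and inv: "\<And>x. h (g x) = x" "\<And>x. g (h x) = x"
  shows "scale_comparable h"
proof -
  obtain Q where Q: "0 < Q" "\<And>x y x' y'. dist x y \<le> dist x' y' \<Longrightarrow> dist (g x) (g y) \<le> Q * dist (g x') (g y')"
    using assms(1) unfolding scale_comparable_def by blast
  obtain H where H: "0 < H" "\<And>x y z. dist x y \<le> Q * dist x z \<Longrightarrow> dist (h x) (h y) \<le> H * dist (h x) (h z)"
    using weak_qsE[OF assms(2) Q(1)] by blast
  have "dist (h a) (h b) \<le> H * dist (h a') (h b')" if d: "dist a b \<le> dist a' b'" for a b a' b'
  proof -
    define z where "z = h a' + dist (h a) (h b) *\<^sub>R unit_dir"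
    have z: "dist (h a') z = dist (h a) (h b)" by (simp add: z_def)
    then have "dist a' (g z) \<le> Q * dist a b" using Q(2)[of "h a'" z "h a" "h b"] by (simp add: inv)
    also have "\<dots> \<le> Q * dist a' b'" using d Q(1) by simp
    finally have "dist (h a') (h (g z)) \<le> H * dist (h a') (h b')" by (rule H(2))
    then show ?thesis using z by (simp add: inv)
  qed
  then show ?thesis unfolding scale_comparable_def using H(1) by blast
qed

section \<open>From comparable scales to bi-Lipschitz bounds\<close>

lemma dist_image_chain:
  fixes g :: "'a::real_normed_vector \<Rightarrow> 'b::metric_space"
  assumes "0 < k" and B: "\<And>a b. dist a b \<le> dist x y / real k \<Longrightarrow> dist (g a) (g b) \<le> B"
  shows "dist (g x) (g y) \<le> real k * B"
proof -
  define w where "w i = x + (real i / real k) *\<^sub>R (y - x)" for i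
  have w: "w 0 = x" "w k = y" using assms(1) by (simp_all add: w_def)
  have step: "dist (w i) (w (Suc i)) = dist x y / real k" for i
  proof -
    have "w i - w (Suc i) = (1 / real k) *\<^sub>R (x - y)"
      by (simp add: w_def algebra_simps add_divide_distrib)
    then show ?thesis by (simp add: dist_norm)
  qed
  have "dist (g x) (g (w i)) \<le> real i * B" for i
  proof (induction i)
    case (Suc i)
    have "dist (g (w i)) (g (w (Suc i))) \<le> B" by (rule B) (simp add: step)
    then show ?case
      using Suc.IH dist_triangle[of "g x" "g (w (Suc i))" "g (w i)"] by (simp add: algebra_simps)
  qed (simp add: w)
  from this[of k] show ?thesis by (simp add: w)
qed

text \<open>About \<open>dist x y\<close> steps of length at most 1 join \<open>x\<close> to
  \<open>y\<close>, and the image of each is bounded by that of the unit segment.\<close>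

lemma scale_comparable_large:
  fixes g :: "'a::euclidean_space \<Rightarrow> 'b::metric_space"
  assumes "scale_comparable g"
  shows "\<exists>A>0. \<forall>x y. 1 \<le> dist x y \<longrightarrow> dist (g x) (g y) \<le> A * dist x y"
proof -
  obtain Q where Q: "0 < Q" "\<And>x y x' y'. dist x y \<le> dist x' y' \<Longrightarrow> dist (g x) (g y) \<le> Q * dist (g x') (g y')"
    using assms unfolding scale_comparable_def by blast
  define m where "m = stretch g 1 0"
  have m: "0 \<le> m" by (simp add: m_def stretch_def)
  have "dist (g x) (g y) \<le> (2 * (Q * m) + 1) * dist x y" if xy: "1 \<le> dist x y" for x y
  proof -
    define k where "k = nat \<lceil>dist x y\<rceil>"
    have k: "0 < k" "dist x y \<le> real k" "real k \<le> 2 * dist x y"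
      unfolding k_def using xy by linarith+
    have "dist (g x) (g y) \<le> real k * (Q * m)"
    proof (rule dist_image_chain[OF k(1)])
      fix a b :: 'a assume "dist a b \<le> dist x y / real k"
      also have "\<dots> \<le> 1" using k by simp
      finally show "dist (g a) (g b) \<le> Q * m" unfolding m_def stretch_def by (intro Q(2)) simp
    qed
    also have "\<dots> \<le> (2 * dist x y) * (Q * m)" using k m Q by (intro mult_right_mono) auto
    also have "\<dots> \<le> (2 * (Q * m) + 1) * dist x y" by (simp add: algebra_simps)
    finally show ?thesis .
  qed
  then show ?thesis using m Q(1) by (intro exI[of _ "2 * (Q * m) + 1"]) (auto intro: add_nonneg_pos)
qed

text \<open>The roles are reversed: the unit segment is cut into about \<open>1 / dist x y\<close>
  steps of length at most \<open>dist x y\<close>, so its image, of fixed length, is bounded by that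
  many multiples of \<open>dist (g x) (g y)\<close>.\<close>

lemma scale_comparable_small:
  fixes g :: "'a::euclidean_space \<Rightarrow> 'b::metric_space"
  assumes "scale_comparable g" "inj g"
  shows "\<exists>A>0. \<forall>x y. dist x y \<le> 1 \<longrightarrow> dist x y \<le> A * dist (g x) (g y)"
proof -
  obtain Q where Q: "0 < Q" "\<And>x y x' y'. dist x y \<le> dist x' y' \<Longrightarrow> dist (g x) (g y) \<le> Q * dist (g x') (g y')"
    using assms(1) unfolding scale_comparable_def by blast
  define m where "m = stretch g 1 0"
  have m: "0 < m" unfolding m_def using assms(2) by (rule stretch_pos) simp
  have "dist x y \<le> (2 * Q / m) * dist (g x) (g y)" if xy: "dist x y \<le> 1" for x y
  proof (cases "dist x y = 0")
    case False
    then have d: "0 < dist x y" by simp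
    define k where "k = nat \<lceil>1 / dist x y\<rceil>"
    have "1 \<le> 1 / dist x y" using d xy by simp
    then have k: "0 < k" "1 / dist x y \<le> real k" "real k \<le> 2 * (1 / dist x y)"
      unfolding k_def by linarith+
    have "dist (g 0) (g (0 + 1 *\<^sub>R unit_dir)) \<le> real k * (Q * dist (g x) (g y))"
    proof (rule dist_image_chain[OF k(1)])
      fix a b :: 'a assume "dist a b \<le> dist 0 (0 + 1 *\<^sub>R (unit_dir :: 'a)) / real k"
      also have "\<dots> = 1 / real k" by (simp only: dist_shift_unit_dir abs_one)
      also have "\<dots> \<le> dist x y" using k d by (simp add: field_simps)
      finally show "dist (g a) (g b) \<le> Q * dist (g x) (g y)" by (rule Q(2))
    qed
    also have "\<dots> \<le> (2 * (1 / dist x y)) * (Q * dist (g x) (g y))"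
      using k Q(1) by (intro mult_right_mono) auto
    finally have "m \<le> (2 * (1 / dist x y)) * (Q * dist (g x) (g y))" by (simp add: m_def stretch_def)
    then show ?thesis using d m by (simp add: field_simps)
  qed (use m Q in simp)
  then show ?thesis using m Q(1) by (intro exI[of _ "2 * Q / m"]) auto
qed

text \<open>Subdivision controls \<open>g\<close> when \<open>dist x y\<close> is at least 1 and,
  applied to the inverse, when the image distance is at most 1. In the one remaining range both
  distances are comparable with constants.\<close>

lemma scale_comparable_Lipschitz:
  fixes g h :: "'a::euclidean_space \<Rightarrow> 'a"
  assumes g: "scale_comparable g" and h: "scale_comparable h" and inv: "\<And>x. h (g x) = x" "\<And>x. g (h x) = x"
  shows "\<exists>L>0. \<forall>x y. dist (g x) (g y) \<le> L * dist x y"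
proof -
  have inj: "inj h" using inv(2) by (metis injI)
  obtain A where A: "0 < A" "\<And>x y. 1 \<le> dist x y \<Longrightarrow> dist (g x) (g y) \<le> A * dist x y"
    using scale_comparable_large[OF g] by blast
  obtain B where B: "0 < B" "\<And>x y. dist x y \<le> 1 \<Longrightarrow> dist x y \<le> B * dist (h x) (h y)"
    using scale_comparable_small[OF h inj] by blast
  obtain Q where Q: "0 < Q" "\<And>x y x' y'. dist x y \<le> dist x' y' \<Longrightarrow> dist (g x) (g y) \<le> Q * dist (g x') (g y')"
    using g unfolding scale_comparable_def by blast
  obtain R where R: "0 < R" "\<And>x y x' y'. dist x y \<le> dist x' y' \<Longrightarrow> dist (h x) (h y) \<le> R * dist (h x') (h y')"
    using h unfolding scale_comparable_def by blast
  define m where "m = stretch g 1 0"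
  define m' where "m' = stretch h 1 0"
  have m': "0 < m'" unfolding m'_def using inj by (rule stretch_pos) simp
  have m: "0 \<le> m" by (simp add: m_def stretch_def)
  \<comment> \<open>For \<open>dist x y < 1 < dist (g x) (g y)\<close>: comparison with unit
    segments gives \<open>dist (g x) (g y) \<le> Q * m\<close> and
    \<open>dist x y \<ge> m' / R\<close>, and \<open>D\<close> is the quotient of the two
    bounds.\<close>
  define D where "D = Q * m * (R / m')"
  have D: "0 \<le> D" using Q R m m' by (simp add: D_def)
  have "dist (g x) (g y) \<le> (A + B + D) * dist x y" for x y
  proof -
    have "dist (g x) (g y) \<le> A * dist x y \<or> dist (g x) (g y) \<le> B * dist x y \<or> dist (g x) (g y) \<le> D * dist x y"
    proof (cases "dist (g x) (g y) \<le> 1")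
      case True
      then show ?thesis using B(2)[of "g x" "g y"] by (simp add: inv)
    next
      case F: False
      show ?thesis
      proof (cases "1 \<le> dist x y")
        case True
        then show ?thesis using A(2) by blast
      next
        case False
        have "dist (g x) (g y) \<le> Q * m"
          unfolding m_def stretch_def by (rule Q(2)) (use False in simp)
        moreover have "m' \<le> R * dist (h (g x)) (h (g y))"
          unfolding m'_def stretch_def by (rule R(2)) (use F in simp)
        then have "1 \<le> (R / m') * dist x y" using m' by (simp add: inv field_simps)
        then have "Q * m * 1 \<le> Q * m * ((R / m') * dist x y)" using Q m by (intro mult_left_mono) auto
        ultimately have "dist (g x) (g y) \<le> D * dist x y" by (simp add: D_def mult.assoc)
        then show ?thesis by blast
      qed
    qed
    moreover have "0 \<le> A * dist x y" "0 \<le> B * dist x y" "0 \<le> D * dist x y"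
      using A B D by simp_all
    ultimately show ?thesis by (simp add: distrib_right) linarith
  qed
  moreover have "0 < A + B + D" using A B D by simp
  ultimately show ?thesis by blast
qed

lemma scale_comparable_bi_Lipschitz:
  fixes g h :: "'a::euclidean_space \<Rightarrow> 'a"
  assumes g: "scale_comparable g" and h: "scale_comparable h" and inv: "\<And>x. h (g x) = x" "\<And>x. g (h x) = x"
  shows "bi_Lipschitz g"
proof -
  obtain L where L: "0 < L" "\<And>x y. dist (g x) (g y) \<le> L * dist x y"
    using scale_comparable_Lipschitz[OF g h inv] by blast
  obtain M where M: "0 < M" "\<And>x y. dist (h x) (h y) \<le> M * dist x y"
    using scale_comparable_Lipschitz[OF h g inv(2,1)] by blast
  define K where "K = L + M + 1"
  have "inverse K * dist x y \<le> dist (g x) (g y) \<and> dist (g x) (g y) \<le> K * dist x y" for x y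
  proof
    have "dist x y \<le> M * dist (g x) (g y)" using M(2)[of "g x" "g y"] by (simp add: inv)
    also have "\<dots> \<le> K * dist (g x) (g y)" using L M by (intro mult_right_mono) (auto simp: K_def)
    finally show "inverse K * dist x y \<le> dist (g x) (g y)" using L M by (simp add: K_def field_simps)
    have "dist (g x) (g y) \<le> L * dist x y" by (rule L(2))
    also have "\<dots> \<le> K * dist x y" using L M by (intro mult_right_mono) (auto simp: K_def)
    finally show "dist (g x) (g y) \<le> K * dist x y" .
  qed
  moreover have "1 \<le> K" using L M by (simp add: K_def)
  ultimately show ?thesis unfolding bi_Lipschitz_def by blast
qed

lemma powr_dominates:
  fixes a b c K :: real
  assumes "b < a" "0 < c"
  shows "\<exists>N>0. K * real N powr b < c * real N powr a"
proof -
  have "(\<lambda>N. K * real N powr (b - a)) \<longlonglongrightarrow> 0" using assms(1) by real_asymp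
  from order_tendstoD(2)[OF this assms(2)] obtain N0 where N0: "\<forall>N\<ge>N0. K * real N powr (b - a) < c"
    by (auto simp: eventually_sequentially)
  have "K * real (Suc N0) powr (b - a) * real (Suc N0) powr a < c * real (Suc N0) powr a"
    using N0[rule_format, of "Suc N0"] by (intro mult_strict_right_mono) auto
  then have "K * real (Suc N0) powr b < c * real (Suc N0) powr a"
    by (simp add: mult.assoc flip: powr_add)
  then show ?thesis by blast
qed

subsection \<open>Homeomorphisms inducing bounded composition operators\<close>

locale besov_homeomorphism = besov_exponents s p q type
  for s p q :: real and type :: "'a::euclidean_space itself" +
  fixes \<phi> \<psi> :: "'a \<Rightarrow> 'a" and C :: real
  assumes dim: "2 \<le> DIM('a)" and hom: "homeomorphism UNIV UNIV \<phi> \<psi>" and C: "0 < C"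
    and bounded: "\<And>f. continuous_on UNIV f \<Longrightarrow> E f < \<infinity> \<Longrightarrow> E (f \<circ> \<phi>) \<le> ennreal C * E f"
begin

lemma inv [simp]: "\<psi> (\<phi> x) = x" "\<phi> (\<psi> x) = x"
  using hom by (auto simp: homeomorphism_def)

lemma cont: "continuous_on S \<phi>" "continuous_on S \<psi>"
  using hom by (auto simp: homeomorphism_def intro: continuous_on_subset)

lemma inj: "inj \<phi>" "inj \<psi>"
  using inv by (metis injI)+

text \<open>If the inequality failed, the \<psi>-images of the closed ball about \<open>x\<close>
  through \<open>y\<close> and of the exterior of the ball through \<open>z\<close> would be two
  connected sets of size at least \<open>l\<close> and distance at most \<open>T * l\<close>. The
  pulled-back ring function separates them, against the Loewner estimate. The exterior is connected
  because the dimension is at least 2.\<close>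

lemma ring_distortion:
  assumes T: "0 < T"
  shows "\<exists>M>0. \<forall>x y z. M * dist x y \<le> dist x z \<longrightarrow> T * dist (\<psi> x) (\<psi> y) \<le> dist (\<psi> x) (\<psi> z)"
proof -
  obtain \<delta> where \<delta>: "\<delta> > 0"
    and low: "\<And>f X Y a b c d l. \<lbrakk>continuous_on UNIV f; connected X; connected Y; a \<in> X; b \<in> X; c \<in> Y; d \<in> Y;
      0 < l; l \<le> dist a b; l \<le> dist c d; dist a c \<le> T * l; \<forall>x\<in>X. 1 \<le> f x; \<forall>y\<in>Y. f y \<le> 0\<rbrakk>
      \<Longrightarrow> ennreal \<delta> \<le> E f"
    by (rule loewner[OF T]) blast
  \<comment> \<open>Composition multiplies the energy by at most \<open>C\<close>, so this target
    leaves \<open>\<delta> / 2\<close>, strictly below the Loewner bound.\<close>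
  have "0 < \<delta> / (2 * C)" using \<delta> C by simp
  from ring_of_small_energy[OF this] obtain M where M: "0 < M"
    "\<forall>(c::'a) \<rho>. 0 < \<rho> \<longrightarrow> (\<exists>f. continuous_on UNIV f \<and> (\<forall>x. dist c x \<le> \<rho> \<longrightarrow> f x = 1) \<and>
     (\<forall>x. M * \<rho> \<le> dist c x \<longrightarrow> f x = 0) \<and> E f \<le> ennreal (\<delta> / (2 * C)))"
    by (elim exE conjE) (rule that)
  have "T * dist (\<psi> x) (\<psi> y) \<le> dist (\<psi> x) (\<psi> z)" if xyz: "M * dist x y \<le> dist x z" for x y z
  proof (rule ccontr)
    assume "\<not> ?thesis"
    then have less: "dist (\<psi> x) (\<psi> z) < T * dist (\<psi> x) (\<psi> y)" by simp
    define l where "l = dist (\<psi> x) (\<psi> y)"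
    have l: "0 < l" using less T zero_le_dist[of "\<psi> x" "\<psi> z"] unfolding l_def
      by (metis mult_zero_right not_less zero_less_dist_iff dist_self)
    define \<rho> where "\<rho> = dist x y"
    have \<rho>: "0 < \<rho>" using l by (auto simp: \<rho>_def l_def)
    from M(2)[rule_format, OF \<rho>, of x] obtain f where f: "continuous_on UNIV f"
      "\<And>u. dist x u \<le> \<rho> \<Longrightarrow> f u = 1" "\<And>u. M * \<rho> \<le> dist x u \<Longrightarrow> f u = 0" "E f \<le> ennreal (\<delta> / (2 * C))"
      by blast
    have fin: "E f < \<infinity>" using f(4) by (rule le_less_trans) simp
    define X where "X = \<psi> ` cball x \<rho>"
    define Y where "Y = \<psi> ` (- ball x (dist x z))"
    have "connected X" unfolding X_def by (intro connected_continuous_image cont convex_connected convex_cball)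
    moreover have "connected Y" unfolding Y_def
      by (intro connected_continuous_image cont connected_complement_bounded_convex) (use dim in auto)
    moreover have "\<psi> x \<in> X" "\<psi> y \<in> X" using \<rho> by (auto simp: X_def \<rho>_def)
    moreover have "\<psi> z \<in> Y" by (auto simp: Y_def)
    moreover obtain d where d: "d \<in> Y" "l \<le> dist (\<psi> z) d"
    proof -
      \<comment> \<open>\<open>Y\<close> is the complement of a bounded set, hence contains points
        arbitrarily far from \<open>\<psi> z\<close>.\<close>
      have "compact (\<psi> ` cball x (dist x z))" by (intro compact_continuous_image cont) auto
      then have "bounded (\<psi> ` cball x (dist x z) \<union> ball (\<psi> z) l)"
        using compact_imp_bounded by auto
      then have "\<psi> ` cball x (dist x z) \<union> ball (\<psi> z) l \<noteq> UNIV"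
        using not_bounded_UNIV by metis
      then obtain d where d: "d \<notin> \<psi> ` cball x (dist x z)" "d \<notin> ball (\<psi> z) l" by blast
      have "\<phi> d \<notin> cball x (dist x z)" using d(1) inv(1)[of d] by (metis image_eqI)
      then have "d \<in> Y" unfolding Y_def by (intro image_eqI[of _ _ "\<phi> d"]) auto
      then show ?thesis using d(2) by (intro that) auto
    qed
    moreover have "l \<le> dist (\<psi> x) (\<psi> y)" by (simp add: l_def)
    moreover have "dist (\<psi> x) (\<psi> z) \<le> T * l" using less by (simp add: l_def)
    moreover have "\<forall>u\<in>X. 1 \<le> (f \<circ> \<phi>) u" using f(2) by (auto simp: X_def)
    moreover have "\<forall>u\<in>Y. (f \<circ> \<phi>) u \<le> 0" using f(3) xyz by (auto simp: Y_def \<rho>_def)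
    moreover have "continuous_on UNIV (f \<circ> \<phi>)"
      by (intro continuous_on_compose cont continuous_on_subset[OF f(1)]) auto
    ultimately have "ennreal \<delta> \<le> E (f \<circ> \<phi>)" using l by (intro low) assumption+
    also have "\<dots> \<le> ennreal C * E f" by (rule bounded[OF f(1) fin])
    also have "\<dots> \<le> ennreal C * ennreal (\<delta> / (2 * C))" by (intro mult_left_mono f(4)) auto
    also have "\<dots> = ennreal (\<delta> / 2)" using C \<delta> by (simp flip: ennreal_mult)
    finally show False using \<delta> by (simp add: ennreal_le_iff)
  qed
  with M(1) show ?thesis by blast
qed

lemma weak_qs_inverse: "weak_qs \<psi>"
proof -
  obtain M where M: "0 < M" "\<And>x y z. M * dist x y \<le> dist x z \<Longrightarrow> 1 * dist (\<psi> x) (\<psi> y) \<le> dist (\<psi> x) (\<psi> z)"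
    using ring_distortion[of 1] by auto
  from M show ?thesis by (intro weak_qs_chain) auto
qed

text \<open>Contrapositive of \<open>ring_distortion\<close> at the points \<open>\<phi> x\<close>,
  \<open>\<phi> z\<close>, \<open>\<phi> y\<close>. The factor \<open>T + 1\<close> contradicts
  \<open>dist x y \<le> T * dist x z\<close> unless all three points coincide.\<close>

lemma weak_qs_map: "weak_qs \<phi>"
  unfolding weak_qs_def
proof (intro allI impI)
  fix T :: real assume T: "0 < T"
  obtain M where M: "0 < M" "\<And>x y z. M * dist x y \<le> dist x z \<Longrightarrow> (T + 1) * dist (\<psi> x) (\<psi> y) \<le> dist (\<psi> x) (\<psi> z)"
    using ring_distortion[of "T + 1"] T by auto
  have "dist (\<phi> x) (\<phi> y) \<le> M * dist (\<phi> x) (\<phi> z)" if xyz: "dist x y \<le> T * dist x z" for x y z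
  proof (rule ccontr)
    assume neg: "\<not> ?thesis"
    then have "(T + 1) * dist x z \<le> dist x y" using M(2)[of "\<phi> x" "\<phi> z" "\<phi> y"] by simp
    then have "dist x z = 0" using xyz zero_le_dist[of x z] unfolding distrib_right by linarith
    then have "x = y" using xyz by simp
    then show False using neg M(1) by simp
  qed
  then show "\<exists>H>0. \<forall>x y z. dist x y \<le> T * dist x z \<longrightarrow> dist (\<phi> x) (\<phi> y) \<le> H * dist (\<phi> x) (\<phi> z)"
    using M(1) by blast
qed

section \<open>Transplanted sums of bumps\<close>

lemma continuous_sum_bump: "continuous_on UNIV (\<lambda>y :: 'a. \<Sum>j<(N::nat). bump (x j) (r j) y)"
  by (intro continuous_intros)

lemma measurable_comp_map:
  fixes f :: "'a \<Rightarrow> real"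
  assumes "continuous_on UNIV f"
  shows "f \<circ> \<phi> \<in> borel_measurable borel"
  by (intro borel_measurable_continuous_onI continuous_on_compose cont continuous_on_subset[OF assms]) auto

lemma one_le_sum_bump:
  assumes "j < N" "0 < r j" "dist (x j) y \<le> r j"
  shows "1 \<le> (\<Sum>j<(N::nat). bump (x j) (r j) (y :: 'a))"
proof -
  have "bump (x j) (r j) y \<le> (\<Sum>j<N. bump (x j) (r j) y)"
    by (rule member_le_sum[of j "{..<N}"]) (use assms(1) bump_bounds in auto)
  then show ?thesis using assms by (simp add: bump_eq_1)
qed

text \<open>Points with very different image scales: bumps of lacunary radii have energy of order \<open>N\<close>, while their
  pullbacks are \<open>N\<close> disjoint bumps of one common size, of energy of order \<open>N\<^sup>q\<^sup>/\<^sup>p\<close>.\<close>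

lemma stretch_ratio_bounded_gt:
  assumes "p < q"
  shows "\<exists>Q>0. \<forall>u>0. \<forall>x y. stretch \<phi> u x \<le> Q * stretch \<phi> u y"
proof -
  obtain K where K: "0 < K" "\<And>x y z. dist x y \<le> 1 * dist x z \<Longrightarrow> dist (\<phi> x) (\<phi> y) \<le> K * dist (\<phi> x) (\<phi> z)"
    using weak_qsE[OF weak_qs_map, of 1] by auto
  obtain H where H: "0 < H" "\<And>x y z. dist x y \<le> (2 * K) * dist x z \<Longrightarrow> dist (\<psi> x) (\<psi> y) \<le> H * dist (\<psi> x) (\<psi> z)"
    using weak_qsE[OF weak_qs_inverse, of "2 * K"] K(1) by auto
  \<comment> \<open>A pulled-back bump stays within \<open>H * u\<close> of its centre. The shift
    \<open>D * u\<close> moves the ball of radius \<open>u\<close> about \<open>z j\<close> off its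
    own bump, and since shifted points are at most \<open>(D + 1) * u\<close> from
    \<open>z j\<close>, separation by \<open>S * u\<close> keeps them off the other bumps.\<close>
  define D where "D = H + 2"
  define S where "S = H + D + 2"
  have D: "2 < D" using H by (simp add: D_def)
  have "0 \<le> S" "1 < S" using H D by (simp_all add: S_def)
  from lacunary_stretch_points[OF cont(1) inj(1) weak_qs_map this(1)]
  obtain \<Lambda> where \<Lambda>: "2 \<le> \<Lambda>" "\<And>N u x y. 0 < u \<Longrightarrow> \<Lambda> ^ N * stretch \<phi> u y < stretch \<phi> u x \<Longrightarrow>
    (\<exists>z. (\<forall>j<N. stretch \<phi> u (z j) = \<Lambda> ^ j * stretch \<phi> u y) \<and>
         (\<forall>i<N. \<forall>j<N. i \<noteq> j \<longrightarrow> S * u < dist (z i) (z j)))" by blast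
  obtain CL where CL: "0 < CL" "\<forall>N (x :: nat \<Rightarrow> 'a) \<rho> L. 0 < \<rho> \<longrightarrow> 2 \<le> L \<longrightarrow>
     E (\<lambda>y. \<Sum>j<N. bump (x j) (\<rho> * L ^ j) y) \<le> ennreal (CL * real N)"
    using energy_lacunary_le by (elim exE conjE) (rule that)
  have "0 < 2 * D" using D by simp
  from energy_lower_bound[OF this] obtain c where c: "0 < c" "\<forall>f\<in>borel_measurable borel. \<forall>(H :: nat set) (a :: nat \<Rightarrow> 'a) t M.
     finite H \<longrightarrow> 0 \<le> M \<longrightarrow> disjoint_family_on (\<lambda>j. cball (a j) (t j)) H \<longrightarrow>
     (\<forall>j\<in>H. 0 < t j \<and> t j < norm (a j) \<and> norm (a j) \<le> 2 * D * t j) \<longrightarrow>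
     (\<forall>j\<in>H. \<forall>h\<in>cball (a j) (t j).
        ennreal (M * (unit_ball_vol (real DIM('a)) * t j ^ DIM('a))) \<le> shift_energy p f h) \<longrightarrow>
     ennreal (c * real (card H) * M powr (q / p)) \<le> E f"
    by (elim exE conjE) (rule that)
  have "1 < q / p" using assms p_gt_0 by simp
  from powr_dominates[OF this c(1), of "C * CL"] obtain N where N: "0 < N" "C * CL * real N < c * real N powr (q / p)"
    by auto
  have "stretch \<phi> u x \<le> \<Lambda> ^ N * stretch \<phi> u y" if u: "0 < u" for u x y
  proof (rule ccontr)
    assume "\<not> ?thesis"
    then obtain z where z: "\<And>j. j < N \<Longrightarrow> stretch \<phi> u (z j) = \<Lambda> ^ j * stretch \<phi> u y"
      and sep: "\<And>i j. i < N \<Longrightarrow> j < N \<Longrightarrow> i \<noteq> j \<Longrightarrow> S * u < dist (z i) (z j)"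
      using \<Lambda>(2)[OF u, of N y x] by (auto simp: not_le)
    \<comment> \<open>The factor \<open>K\<close> makes the bump equal to 1 on the \<phi>-image of
      the ball of radius \<open>u\<close> about \<open>z j\<close>, and the radii form the lacunary
      sequence with ratio \<Lambda>.\<close>
    define r where "r j = (K * stretch \<phi> u y) * \<Lambda> ^ j" for j
    have r0: "0 < r j" for j using K(1) \<Lambda>(1) stretch_pos[OF inj(1) u, of y] by (simp add: r_def)
    have rz: "r j = K * dist (\<phi> (z j)) (\<phi> (z j + u *\<^sub>R unit_dir))" if "j < N" for j
      using z[OF that] by (simp add: r_def stretch_def)
    define f where "f = (\<lambda>y. \<Sum>j<N. bump (\<phi> (z j)) (r j) y)"
    define F where "F = f \<circ> \<phi>"
    have f: "continuous_on UNIV f" unfolding f_def by (rule continuous_sum_bump)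
    have Ef: "E f \<le> ennreal (CL * real N)"
      unfolding f_def r_def using CL(2) K(1) \<Lambda>(1) stretch_pos[OF inj(1) u, of y] by simp
    have inner: "1 \<le> F v" if "j < N" "dist (z j) v \<le> u" for j v
    proof -
      have "dist (\<phi> (z j)) (\<phi> v) \<le> r j" unfolding rz[OF that(1)] by (rule K(2)) (use that u in simp)
      then show ?thesis unfolding F_def f_def comp_def using that r0 by (intro one_le_sum_bump) auto
    qed
    have outer: "F v = 0" if j: "j < N" and v: "dist (z j + (D * u) *\<^sub>R unit_dir) v \<le> u" for j v
    proof -
      have "bump (\<phi> (z i)) (r i) (\<phi> v) = 0" if i: "i < N" for i
      proof (rule ccontr)
        assume "bump (\<phi> (z i)) (r i) (\<phi> v) \<noteq> 0"
        then have "dist (\<phi> (z i)) (\<phi> v) < 2 * r i" using bump_eq_0[OF r0] by (meson not_less)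
        then have "dist (\<phi> (z i)) (\<phi> v) \<le> (2 * K) * dist (\<phi> (z i)) (\<phi> (z i + u *\<^sub>R unit_dir))"
          by (simp add: rz[OF i])
        from H(2)[OF this] have iv: "dist (z i) v \<le> H * u" using u by simp
        have "dist (z j) (z j + (D * u) *\<^sub>R unit_dir) = D * u" using D u by simp
        then have "D * u \<le> dist (z j) v + u" "dist (z j) v \<le> D * u + u"
          using dist_triangle2[of "z j" "z j + (D * u) *\<^sub>R unit_dir" v]
            dist_triangle[of "z j" v "z j + (D * u) *\<^sub>R unit_dir"] v by linarith+
        then show False
        proof (cases "i = j")
          case True
          with iv \<open>D * u \<le> dist (z j) v + u\<close> show False using u by (simp add: D_def algebra_simps)
        next
          case False
          have "S * u < H * u + (D * u + u)"
            using sep[OF i j False] dist_triangle2[of "z i" "z j" v] iv \<open>dist (z j) v \<le> D * u + u\<close> by linarith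
          then show False using u by (simp add: S_def algebra_simps)
        qed
      qed
      then show ?thesis by (simp add: F_def f_def)
    qed
    define a where "a = (D * u) *\<^sub>R (unit_dir :: 'a)"
    have a: "norm a = D * u" using D u by (simp add: a_def)
    have disj: "disjoint_family_on (\<lambda>j. cball (z j) (u / 2)) {..<N}"
      unfolding disjoint_family_on_def
    proof (intro ballI impI)
      fix i j assume ij: "i \<in> {..<N}" "j \<in> {..<N}" "i \<noteq> j"
      then have "S * u < dist (z i) (z j)" using sep by auto
      moreover have "1 * u < S * u" using \<open>1 < S\<close> u by (intro mult_strict_right_mono)
      ultimately have far: "u < dist (z i) (z j)" by simp
      show "cball (z i) (u / 2) \<inter> cball (z j) (u / 2) = {}"
      proof (rule ccontr)
        assume "\<not> ?thesis"
        then obtain v where "dist (z i) v \<le> u / 2" "dist (z j) v \<le> u / 2" by auto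
        then show False using far dist_triangle2[of "z i" "z j" v] by linarith
      qed
    qed
    \<comment> \<open>All \<open>N\<close> jumps occur for one and the same ball of shifts, so a
      single index with \<open>M = N\<close> produces the power \<open>q / p\<close>. The radii
      \<open>u / 2\<close> of base points and of shifts add up to the \<open>u\<close> allowed by
      \<open>outer\<close>.\<close>
    have "ennreal (c * real (card {0::nat}) * real N powr (q / p)) \<le> E F"
    proof (rule c(2)[rule_format, where a = "\<lambda>_. a" and t = "\<lambda>_. u / 2"])
      show "F \<in> borel_measurable borel" unfolding F_def by (rule measurable_comp_map[OF f])
      show "0 < u / 2 \<and> u / 2 < norm a \<and> norm a \<le> 2 * D * (u / 2)"
      proof -
        have "2 * u < D * u" using D u by (intro mult_strict_right_mono)
        then show ?thesis using u by (simp add: a)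
      qed
      fix h assume h: "h \<in> cball a (u / 2)"
      have "ennreal (real (card {..<N}) * (unit_ball_vol (real DIM('a)) * (u / 2) ^ DIM('a))) \<le> shift_energy p F h"
      proof (rule shift_energy_lower_bound[OF _ _ _ disj])
        show "F \<in> borel_measurable borel" unfolding F_def by (rule measurable_comp_map[OF f])
        fix j v assume j: "j \<in> {..<N}" and v: "v \<in> cball (z j) (u / 2)"
        have "dist (z j + a) (v + h) \<le> dist (z j) v + dist a h" by (rule dist_triangle_add)
        then have "F (v + h) = 0" using j v h by (intro outer[of j]) (auto simp: a_def)
        moreover have "1 \<le> F v" using j v u by (intro inner[of j]) auto
        ultimately show "1 \<le> \<bar>F (v + h) - F v\<bar>" by simp
      qed (use u in auto)
      then show "ennreal (real N * (unit_ball_vol (real DIM('a)) * (u / 2) ^ DIM('a))) \<le> shift_energy p F h" by simp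
    qed (auto simp: disjoint_family_on_def)
    also have "E F \<le> ennreal C * E f"
      unfolding F_def by (rule bounded[OF f]) (use Ef in \<open>auto intro: le_less_trans\<close>)
    also have "\<dots> \<le> ennreal C * ennreal (CL * real N)" by (intro mult_left_mono Ef) auto
    also have "\<dots> = ennreal (C * CL * real N)" using C CL(1) by (simp add: mult.assoc flip: ennreal_mult)
    finally have "c * real N powr (q / p) \<le> C * CL * real N"
      using C CL(1) c(1) by (simp add: ennreal_le_iff)
    with N(2) show False by simp
  qed
  then show ?thesis using \<Lambda>(1) by (intro exI[of _ "\<Lambda> ^ N"]) auto
qed

text \<open>The roles are exchanged: bumps of one size pull back to bumps of lacunary sizes.\<close>

lemma stretch_ratio_bounded_lt:
  assumes "q < p"
  shows "\<exists>Q>0. \<forall>u>0. \<forall>x y. stretch \<psi> u x \<le> Q * stretch \<psi> u y"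
proof -
  obtain K where K: "0 < K" "\<And>x y z. dist x y \<le> 1 * dist x z \<Longrightarrow> dist (\<phi> x) (\<phi> y) \<le> K * dist (\<phi> x) (\<phi> z)"
    using weak_qsE[OF weak_qs_map, of 1] by auto
  obtain H where H: "0 < H" "\<And>x y z. dist x y \<le> (2 * K) * dist x z \<Longrightarrow> dist (\<psi> x) (\<psi> y) \<le> H * dist (\<psi> x) (\<psi> z)"
    using weak_qsE[OF weak_qs_inverse, of "2 * K"] K(1) by auto
  define D where "D = H + 2"
  have D: "2 < D" using H by (simp add: D_def)
  \<comment> \<open>Points of the shifted ball lie within \<open>(D + 1) * t j\<close> of
    \<open>\<psi> (z j)\<close>, so their \<phi>-images lie within \<open>G * u\<close> of
    \<open>z j\<close>. In \<open>S\<close>, the term \<open>4 * K\<close> separates the bumps and,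
    together with \<open>G\<close>, keeps these images outside every other bump.\<close>
  obtain G where G: "0 < G" "\<And>x y z. dist x y \<le> (D + 1) * dist x z \<Longrightarrow> dist (\<phi> x) (\<phi> y) \<le> G * dist (\<phi> x) (\<phi> z)"
    using weak_qsE[OF weak_qs_map, of "D + 1"] D by auto
  define S where "S = G + 4 * K"
  have "0 \<le> S" using G K by (simp add: S_def)
  from lacunary_stretch_points[OF cont(2) inj(2) weak_qs_inverse this(1)]
  obtain \<Lambda> where \<Lambda>: "2 \<le> \<Lambda>" "\<And>N u x y. 0 < u \<Longrightarrow> \<Lambda> ^ N * stretch \<psi> u y < stretch \<psi> u x \<Longrightarrow>
    (\<exists>z. (\<forall>j<N. stretch \<psi> u (z j) = \<Lambda> ^ j * stretch \<psi> u y) \<and>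
         (\<forall>i<N. \<forall>j<N. i \<noteq> j \<longrightarrow> S * u < dist (z i) (z j)))" by blast
  obtain CS where CS: "0 < CS" "\<forall>J (x :: nat \<Rightarrow> 'a) \<rho>. finite J \<longrightarrow> 0 < \<rho> \<longrightarrow> (\<forall>i\<in>J. \<forall>j\<in>J. i \<noteq> j \<longrightarrow> 4 * \<rho> \<le> dist (x i) (x j)) \<longrightarrow>
     E (\<lambda>y. \<Sum>j\<in>(J :: nat set). bump (x j) \<rho> y) \<le> ennreal (CS * real (card J) powr (q / p))"
    using energy_same_scale_le by (elim exE conjE) (rule that)
  have "0 < 2 * D" using D by simp
  from energy_lower_bound[OF this] obtain c where c: "0 < c" "\<forall>f\<in>borel_measurable borel. \<forall>(H :: nat set) (a :: nat \<Rightarrow> 'a) t M.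
     finite H \<longrightarrow> 0 \<le> M \<longrightarrow> disjoint_family_on (\<lambda>j. cball (a j) (t j)) H \<longrightarrow>
     (\<forall>j\<in>H. 0 < t j \<and> t j < norm (a j) \<and> norm (a j) \<le> 2 * D * t j) \<longrightarrow>
     (\<forall>j\<in>H. \<forall>h\<in>cball (a j) (t j).
        ennreal (M * (unit_ball_vol (real DIM('a)) * t j ^ DIM('a))) \<le> shift_energy p f h) \<longrightarrow>
     ennreal (c * real (card H) * M powr (q / p)) \<le> E f"
    by (elim exE conjE) (rule that)
  have "q / p < 1" using assms p_gt_0 by simp
  from powr_dominates[OF this c(1), of "C * CS"] obtain N where N: "0 < N" "C * CS * real N powr (q / p) < c * real N"
    by auto
  have "stretch \<psi> u x \<le> \<Lambda> ^ N * stretch \<psi> u y" if u: "0 < u" for u x y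
  proof (rule ccontr)
    assume "\<not> ?thesis"
    then obtain z where z: "\<And>j. j < N \<Longrightarrow> stretch \<psi> u (z j) = \<Lambda> ^ j * stretch \<psi> u y"
      and sep: "\<And>i j. i < N \<Longrightarrow> j < N \<Longrightarrow> i \<noteq> j \<Longrightarrow> S * u < dist (z i) (z j)"
      using \<Lambda>(2)[OF u, of N y x] by (auto simp: not_le)
    define t where "t j = stretch \<psi> u (z j)" for j
    have t0: "0 < t j" for j unfolding t_def by (rule stretch_pos[OF inj(2) u])
    have tz: "t j = dist (\<psi> (z j)) (\<psi> (z j + u *\<^sub>R unit_dir))" for j by (simp add: t_def stretch_def)
    define f where "f = (\<lambda>y. \<Sum>j<N. bump (z j) (K * u) y)"
    define F where "F = f \<circ> \<phi>"
    have f: "continuous_on UNIV f" unfolding f_def by (rule continuous_sum_bump)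
    have Ef: "E f \<le> ennreal (CS * real N powr (q / p))"
    proof -
      have "4 * (K * u) \<le> dist (z i) (z j)" if "i \<in> {..<N}" "j \<in> {..<N}" "i \<noteq> j" for i j
      proof -
        have "4 * (K * u) \<le> S * u" using G u by (simp add: S_def algebra_simps)
        then show ?thesis using sep[of i j] that by simp
      qed
      then have "E (\<lambda>y. \<Sum>j\<in>{..<N}. bump (z j) (K * u) y) \<le> ennreal (CS * real (card {..<N}) powr (q / p))"
        using K(1) u by (intro CS(2)[rule_format]) auto
      then show ?thesis by (simp add: f_def)
    qed
    have inner: "1 \<le> F v" if "j < N" "dist (\<psi> (z j)) v \<le> t j" for j v
    proof -
      have "dist (\<phi> (\<psi> (z j))) (\<phi> v) \<le> K * dist (\<phi> (\<psi> (z j))) (\<phi> (\<psi> (z j + u *\<^sub>R unit_dir)))"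
        by (rule K(2)) (use that in \<open>simp add: tz\<close>)
      then have "dist (z j) (\<phi> v) \<le> K * u" using u by simp
      then show ?thesis unfolding F_def f_def comp_def
        using that K(1) u by (intro one_le_sum_bump[where r = "\<lambda>_. K * u"]) auto
    qed
    have outer: "F v = 0" if j: "j < N" and v: "dist (\<psi> (z j) + (D * t j) *\<^sub>R unit_dir) v \<le> t j" for j v
    proof -
      have "bump (z i) (K * u) (\<phi> v) = 0" if i: "i < N" for i
      proof (rule ccontr)
        assume "bump (z i) (K * u) (\<phi> v) \<noteq> 0"
        then have iv: "dist (z i) (\<phi> v) < 2 * (K * u)" using bump_eq_0[of "K * u"] K(1) u by (meson not_less mult_pos_pos)
        have "dist (\<psi> (z j)) (\<psi> (z j) + (D * t j) *\<^sub>R unit_dir) = D * t j" using D t0[of j] by simp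
        then have near: "D * t j \<le> dist (\<psi> (z j)) v + t j" "dist (\<psi> (z j)) v \<le> D * t j + t j"
          using dist_triangle2[of "\<psi> (z j)" "\<psi> (z j) + (D * t j) *\<^sub>R unit_dir" v]
            dist_triangle[of "\<psi> (z j)" v "\<psi> (z j) + (D * t j) *\<^sub>R unit_dir"] v by linarith+
        show False
        proof (cases "i = j")
          case True
          have "dist (z j) (\<phi> v) \<le> (2 * K) * dist (z j) (z j + u *\<^sub>R unit_dir)" using iv True u by simp
          from H(2)[OF this] have "dist (\<psi> (z j)) v \<le> H * t j" by (simp add: tz)
          with near(1) show False using t0[of j] by (simp add: D_def algebra_simps)
        next
          case False
          have "dist (\<phi> (\<psi> (z j))) (\<phi> v) \<le> G * dist (\<phi> (\<psi> (z j))) (\<phi> (\<psi> (z j + u *\<^sub>R unit_dir)))"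
            by (rule G(2)) (use near(2) in \<open>simp add: tz[symmetric] algebra_simps\<close>)
          then have "dist (z j) (\<phi> v) \<le> G * u" using u by simp
          then have "S * u < 2 * (K * u) + G * u"
            using sep[OF i j False] dist_triangle2[of "z i" "z j" "\<phi> v"] iv by linarith
          moreover have "0 < K * u" using K(1) u by simp
          ultimately show False by (simp add: S_def algebra_simps)
        qed
      qed
      then show ?thesis by (simp add: F_def f_def)
    qed
    define a where "a j = (D * t j) *\<^sub>R (unit_dir :: 'a)" for j
    have a: "norm (a j) = D * t j" for j using D t0[of j] by (simp add: a_def)
    \<comment> \<open>Shifts in the ball \<open>i\<close> have norm within \<open>t i / 2\<close> of
      \<open>D * t i\<close>. As \<open>t j \<ge> 2 * t i\<close>, an overlap would force
      \<open>D \<le> 3/2\<close>, whereas \<open>D > 2\<close>.\<close>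
    have gap: "cball (a i) (t i / 2) \<inter> cball (a j) (t j / 2) = {}" if ij: "i < j" "j < N" for i j
    proof (rule ccontr)
      assume "\<not> ?thesis"
      then obtain h where h: "dist (a i) h \<le> t i / 2" "dist (a j) h \<le> t j / 2" by auto
      have "t j = \<Lambda> ^ j * stretch \<psi> u y" "t i = \<Lambda> ^ i * stretch \<psi> u y" using z ij by (auto simp: t_def)
      moreover have "\<Lambda> ^ Suc i * stretch \<psi> u y \<le> \<Lambda> ^ j * stretch \<psi> u y"
        using ij \<Lambda>(1) stretch_pos[OF inj(2) u, of y] by (intro mult_right_mono power_increasing) auto
      ultimately have "\<Lambda> * t i \<le> t j" by simp
      moreover have "2 * t i \<le> \<Lambda> * t i" using \<Lambda>(1) t0[of i] by (intro mult_right_mono) auto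
      ultimately have tij: "2 * t i \<le> t j" by linarith
      have "D * t j - t j / 2 \<le> norm h" "norm h \<le> D * t i + t i / 2"
        using h norm_triangle_ineq2[of "a j" h] norm_triangle_ineq2[of h "a i"]
        by (simp_all add: a dist_norm norm_minus_commute)
      then have "(D - 1/2) * t j \<le> (D + 1/2) * t i" by (simp add: algebra_simps)
      moreover have "(D - 1/2) * (2 * t i) \<le> (D - 1/2) * t j" using tij D by (intro mult_left_mono) auto
      ultimately have "(D - 3/2) * t i \<le> 0" by (simp add: algebra_simps)
      then show False using D t0[of i] by (simp add: mult_le_0_iff)
    qed
    have disj: "disjoint_family_on (\<lambda>j. cball (a j) (t j / 2)) {..<N}"
      unfolding disjoint_family_on_def
    proof (intro ballI impI)
      fix i j assume "i \<in> {..<N}" "j \<in> {..<N}" "i \<noteq> j"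
      then show "cball (a i) (t i / 2) \<inter> cball (a j) (t j / 2) = {}"
        using gap[of i j] gap[of j i] by (cases "i < j") (auto simp: Int_commute)
    qed
    \<comment> \<open>Now every scale has its own ball of shifts with a single ball of jumps:
      \<open>N\<close> indices, each with \<open>M = 1\<close>.\<close>
    have "ennreal (c * real (card {..<N}) * 1 powr (q / p)) \<le> E F"
    proof (rule c(2)[rule_format, where a = a and t = "\<lambda>j. t j / 2"])
      show "F \<in> borel_measurable borel" unfolding F_def by (rule measurable_comp_map[OF f])
      show "disjoint_family_on (\<lambda>j. cball (a j) (t j / 2)) {..<N}" by (rule disj)
      fix j assume j: "j \<in> {..<N}"
      show "0 < t j / 2 \<and> t j / 2 < norm (a j) \<and> norm (a j) \<le> 2 * D * (t j / 2)"
      proof -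
        have "2 * t j < D * t j" using D t0[of j] by (intro mult_strict_right_mono)
        then show ?thesis using t0[of j] by (simp add: a)
      qed
      fix h assume h: "h \<in> cball (a j) (t j / 2)"
      have "ennreal (real (card {j}) * (unit_ball_vol (real DIM('a)) * (t j / 2) ^ DIM('a))) \<le> shift_energy p F h"
      proof (rule shift_energy_lower_bound[where x = "\<lambda>j. \<psi> (z j)"])
        show "F \<in> borel_measurable borel" unfolding F_def by (rule measurable_comp_map[OF f])
        fix i v assume i: "i \<in> {j}" and v: "v \<in> cball (\<psi> (z i)) (t j / 2)"
        have "dist (\<psi> (z j) + a j) (v + h) \<le> dist (\<psi> (z j)) v + dist (a j) h" by (rule dist_triangle_add)
        then have "F (v + h) = 0" using i j v h by (intro outer[of j]) (auto simp: a_def)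
        moreover have "1 \<le> F v" using i j v t0[of j] by (intro inner[of j]) auto
        ultimately show "1 \<le> \<bar>F (v + h) - F v\<bar>" by simp
      qed (use t0[of j] in \<open>auto simp: disjoint_family_on_def\<close>)
      then show "ennreal (1 * (unit_ball_vol (real DIM('a)) * (t j / 2) ^ DIM('a))) \<le> shift_energy p F h" by simp
    qed auto
    also have "E F \<le> ennreal C * E f"
      unfolding F_def by (rule bounded[OF f]) (use Ef in \<open>auto intro: le_less_trans\<close>)
    also have "\<dots> \<le> ennreal C * ennreal (CS * real N powr (q / p))" by (intro mult_left_mono Ef) auto
    also have "\<dots> = ennreal (C * CS * real N powr (q / p))" using C CS(1) by (simp add: mult.assoc flip: ennreal_mult)
    finally have "c * real N \<le> C * CS * real N powr (q / p)"
      using C CS(1) c(1) by (simp add: ennreal_le_iff)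
    with N(2) show False by simp
  qed
  then show ?thesis using \<Lambda>(1) by (intro exI[of _ "\<Lambda> ^ N"]) auto
qed

text \<open>The sign of \<open>q - p\<close> decides for which of \<phi> and \<psi> the stretches
  are bounded; \<open>scale_comparable_inverse\<close> transfers comparability to the other
  map.\<close>

lemma bi_Lipschitz_map:
  assumes "q \<noteq> p"
  shows "bi_Lipschitz \<phi>"
proof (cases "p < q")
  case True
  then obtain Q where Q: "0 < Q" "\<And>u x y. 0 < u \<Longrightarrow> stretch \<phi> u x \<le> Q * stretch \<phi> u y"
    using stretch_ratio_bounded_gt by blast
  have "scale_comparable \<phi>" by (rule scale_comparable_of_stretch[OF weak_qs_map Q])
  moreover from this have "scale_comparable \<psi>" by (rule scale_comparable_inverse[OF _ weak_qs_inverse]) simp_all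
  ultimately show ?thesis by (rule scale_comparable_bi_Lipschitz) simp_all
next
  case False
  then have "q < p" using assms by simp
  then obtain Q where Q: "0 < Q" "\<And>u x y. 0 < u \<Longrightarrow> stretch \<psi> u x \<le> Q * stretch \<psi> u y"
    using stretch_ratio_bounded_lt by blast
  have psi: "scale_comparable \<psi>" by (rule scale_comparable_of_stretch[OF weak_qs_inverse Q])
  then have "scale_comparable \<phi>" by (rule scale_comparable_inverse[OF _ weak_qs_map]) simp_all
  then show ?thesis using psi by (rule scale_comparable_bi_Lipschitz) simp_all
qed

end

theorem theorem1p1:
  fixes \<phi> :: "real ^ 'n \<Rightarrow> real ^ 'n" and s q :: real
  assumes "CARD('n) \<ge> 2"
    and "\<exists>\<psi>. homeomorphism UNIV UNIV \<phi> \<psi>"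
    and "0 < s" and "s < 1"
    and "1 < q" and "q \<noteq> real CARD('n) / s"
    and "composition_bounded_on_besov s (real CARD('n) / s) q \<phi>"
  shows "bi_Lipschitz \<phi>"
proof -
  obtain \<psi> where hom: "homeomorphism UNIV UNIV \<phi> \<psi>" using assms(2) by blast
  obtain C where C: "0 < C" "\<And>f. continuous_on UNIV f \<Longrightarrow> besov_energy s (real CARD('n) / s) q f < \<infinity> \<Longrightarrow>
      besov_energy s (real CARD('n) / s) q (f \<circ> \<phi>) \<le> ennreal C * besov_energy s (real CARD('n) / s) q f"
    using composition_bounded_energy[OF assms(7)] assms(5) by auto
  interpret besov_homeomorphism s "real CARD('n) / s" q "TYPE(real ^ 'n)" \<phi> \<psi> C
    by unfold_locales (use assms(1,3,4,5) hom C in auto)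
  show ?thesis by (rule bi_Lipschitz_map[OF assms(6)])
qed

end
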